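(* Let $N\ge 1$ and $m\ge 1$ be integers, let $1<p<\infty$, and let $K\subset\mathbb{R}^N$ be a bounded, convex, symmetric set containing the origin and with nonempty interior. Let $f\in W^{m,p}(\mathbb{R}^N)$. Then $$\lim_{\delta\to 0^+}\ \iint_{\{(x,y)\in\mathbb{R}^N\times\mathbb{R}^N:\ |R^m f(x,y)|>\delta\}}\frac{\delta^p}{\|x-y\|_K^{N+mp}}\,dx\,dy=\frac{N+mp}{m^{mp+1}\,p}\int_{\mathbb{R}^N}\int_K |D^m f(x)(y,\dots,y)|^p\,dy\,dx.$$
   Context: Symmetric means $K=-K$. $\|\cdot\|_K$ is the norm on $\mathbb{R}^N$ with unit ball $K$: $\|x\|_K=\inf\{\lambda>0: x/\lambda\in K\}$. $W^{m,p}(\mathbb{R}^N)$ is the usual Sobolev space. For $\sigma=(\sigma_1,\dots,\sigma_N)\in\mathbb{R}^N$ and a.e. $x$, $$D^m f(x)(\sigma,\dots,\sigma)=\sum_{1\le i_1,\dots,i_m\le N}\sigma_{i_1}\cdots\sigma_{i_m}\frac{\partial^m f}{\partial x_{i_1}\cdots\partial x_{i_m}}(x)$$ (weak derivatives). Finally, $$R^m f(x,y)=\sum_{j=0}^m(-1)^j\binom{m}{j}f\left(\frac{m-j}{m}x+\frac{j}{m}y\right).$$ *)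

theory Defs
  imports "HOL-Analysis.Analysis"
begin

text \<open>
  N-dimensional space is \<open>real ^ 'n\<close> with N = \<open>CARD('n)\<close>. An iterated partial derivative is
  indexed by the list \<open>[i\<^sub>1, \<dots>, i\<^sub>k] :: 'n list\<close> of the directions of differentiation, the last
  entry being applied first; the length of the list is the order.
\<close>

definition partial :: "'n \<Rightarrow> (real ^ 'n \<Rightarrow> real) \<Rightarrow> real ^ 'n \<Rightarrow> real"
  where "partial i \<phi> x = frechet_derivative \<phi> (at x) (axis i 1)"

definition partials :: "'n list \<Rightarrow> (real ^ 'n \<Rightarrow> real) \<Rightarrow> real ^ 'n \<Rightarrow> real"
  where "partials is \<phi> = foldr partial is \<phi>"

text \<open>
  Smooth compactly supported functions. Differentiability of every iterated partial derivative also
  gives continuity of every iterated partial derivative.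
\<close>

definition test_function :: "(real ^ 'n \<Rightarrow> real) \<Rightarrow> bool"
  where "test_function \<phi> \<longleftrightarrow>
    (\<forall>is. partials is \<phi> differentiable_on UNIV) \<and> compact (closure {x. \<phi> x \<noteq> 0})"

definition locally_integrable :: "(real ^ 'n \<Rightarrow> real) \<Rightarrow> bool"
  where "locally_integrable f \<longleftrightarrow> (\<forall>C. compact C \<longrightarrow> f absolutely_integrable_on C)"

definition has_weak_partials :: "(real ^ 'n \<Rightarrow> real) \<Rightarrow> 'n list \<Rightarrow> (real ^ 'n \<Rightarrow> real) \<Rightarrow> bool"
  where "has_weak_partials f is g \<longleftrightarrow>
    locally_integrable f \<and> locally_integrable g \<and>
    (\<forall>\<phi>. test_function \<phi> \<longrightarrow>
      (\<integral>x. f x * partials is \<phi> x \<partial>lebesgue) = (- 1) ^ length is * (\<integral>x. g x * \<phi> x \<partial>lebesgue))"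

text \<open>Weak derivatives are unique up to null sets; this picks a representative.\<close>

definition weak_partials :: "'n list \<Rightarrow> (real ^ 'n \<Rightarrow> real) \<Rightarrow> real ^ 'n \<Rightarrow> real"
  where "weak_partials is f = (SOME g. has_weak_partials f is g)"

text \<open>
  Elements of the Lebesgue and Sobolev spaces are represented by actual functions, without passing
  to classes modulo null sets.
\<close>

definition Lp :: "real \<Rightarrow> (real ^ 'n \<Rightarrow> real) set"
  where "Lp p = {f \<in> borel_measurable lebesgue. integrable lebesgue (\<lambda>x. \<bar>f x\<bar> powr p)}"

definition Sobolev :: "nat \<Rightarrow> real \<Rightarrow> (real ^ 'n \<Rightarrow> real) set"
  where "Sobolev m p = {f \<in> Lp p. \<forall>is. length is \<le> m \<longrightarrow> (\<exists>g \<in> Lp p. has_weak_partials f is g)}"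

definition D_pow :: "nat \<Rightarrow> (real ^ 'n \<Rightarrow> real) \<Rightarrow> real ^ 'n \<Rightarrow> real ^ 'n \<Rightarrow> real"
  where "D_pow m f x \<sigma> =
    (\<Sum>is\<in>{is :: 'n list. length is = m}. (\<Prod>i\<leftarrow>is. \<sigma> $ i) * weak_partials is f x)"

definition R_diff :: "nat \<Rightarrow> (real ^ 'n \<Rightarrow> real) \<Rightarrow> real ^ 'n \<Rightarrow> real ^ 'n \<Rightarrow> real"
  where "R_diff m f x y =
    (\<Sum>j = 0..m. (- 1) ^ j * real (m choose j) *
       f ((real (m - j) / real m) *\<^sub>R x + (real j / real m) *\<^sub>R y))"

definition norm_of_ball :: "(real ^ 'n) set \<Rightarrow> real ^ 'n \<Rightarrow> real"
  where "norm_of_ball K x = Inf {l. 0 < l \<and> x /\<^sub>R l \<in> K}"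

end

theory Submission
  imports Defs
begin

text \<open>
  Put \<open>a = N + m p\<close> and, for \<open>\<delta> = e ^ m\<close>, substitute
  \<open>y = x + m e k\<close> in the double integral. Then \<open>R_diff m f x y\<close> becomes, up to
  sign, the \<open>m\<close>-th forward difference of \<open>f\<close> at \<open>x\<close> with step
  \<open>e k\<close>, all powers of \<open>e\<close> in the weight cancel, and the integral equals
  \<open>m powr (- m p)\<close> times the \<open>k\<close>-integral of
  \<open>norm_of_ball K k powr (- a)\<close> against the volume of the set of those \<open>x\<close> where that
  difference, divided by \<open>e ^ m\<close>, exceeds 1 in absolute value (lemma
  \<open>functional_rescaled\<close>).

  For fixed \<open>k\<close> the difference quotient is an average of
  \<open>F k x = D\<^sup>m f(x)(k, \<dots>, k)\<close> over the points \<open>x + s e k\<close> with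
  \<open>0 \<le> s \<le> m\<close>, the averaging density being a B-spline of total mass 1 (lemmas
  \<open>peano_kernel_exists\<close> and \<open>difference_eq_average\<close>; the weak derivative enters by duality
  with test functions). These averages tend to \<open>F k\<close> in measure as \<open>e\<close> tends to 0, so the
  volumes tend to the volume of the set where \<open>\<bar>F k\<bar> > 1\<close>, provided
  \<open>\<bar>F k\<bar> = 1\<close> only on a null set (lemma \<open>level_set_convergence\<close>).

  The limit may be taken under the \<open>k\<close>-integral by dominated convergence. The averages are bounded,
  uniformly in \<open>e\<close>, by a one-sided maximal function of \<open>F k\<close> along the ray in direction
  \<open>k\<close>. Its weak type inequality holds with a constant independent of the direction (lemma
  \<open>maximal_weak_type\<close>, proved by Hopf's maximal ergodic argument), and for \<open>p > 1\<close> it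
  makes the dominating function integrable (lemma \<open>domination\<close>).

  The value of the limit, the finiteness of the dominating integral and the nullity of the sets
  \<open>\<bar>F k\<bar> = 1\<close> all come from one formula, a substitute for polar coordinates (lemma
  \<open>cone_integral\<close>): the \<open>k\<close>-integral of
  \<open>norm_of_ball K k powr (- a) * u k\<close> is the integral over \<open>k\<close> in the interior of
  \<open>K\<close> and over \<open>t > 0\<close> of \<open>a * t powr (- m p - 1) * u (t k)\<close>.
  Since \<open>F (t k) x = t ^ m * F k x\<close>, the \<open>t\<close>-integral is elementary (lemma
  \<open>power_weight_integral\<close>): it turns the condition \<open>\<bar>F k x\<bar> > 1\<close> into the
  power \<open>\<bar>F k x\<bar> powr p\<close>, with the factor \<open>a / (m p)\<close> of the theorem.
\<close>

section \<open>Volume and changes of variable\<close>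

abbreviation vol :: "'a::euclidean_space set \<Rightarrow> ennreal" where
  "vol A \<equiv> emeasure lborel A"

abbreviation Lp_mass :: "real \<Rightarrow> ('a::euclidean_space \<Rightarrow> real) \<Rightarrow> ennreal" where
  "Lp_mass p F \<equiv> \<integral>\<^sup>+x. ennreal (\<bar>F x\<bar> powr p) \<partial>lborel"

lemma nn_integral_lborel_shift:
  fixes u :: "'a::euclidean_space \<Rightarrow> ennreal"
  assumes [measurable]: "u \<in> borel_measurable borel"
  shows "(\<integral>\<^sup>+x. u (x + v) \<partial>lborel) = (\<integral>\<^sup>+x. u x \<partial>lborel)"
proof -
  have "(\<integral>\<^sup>+x. u x \<partial>lborel) = (\<integral>\<^sup>+x. u x \<partial>distr lborel borel ((+) v))"
    by (simp add: lborel_distr_plus)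
  also have "\<dots> = (\<integral>\<^sup>+x. u (v + x) \<partial>lborel)"
    by (rule nn_integral_distr) auto
  finally show ?thesis by (simp add: add.commute)
qed

lemma nn_integral_lborel_scale:
  fixes u :: "'a::euclidean_space \<Rightarrow> ennreal"
  assumes [measurable]: "u \<in> borel_measurable borel" and c: "c \<noteq> 0"
  shows "(\<integral>\<^sup>+x. u x \<partial>lborel) = ennreal (\<bar>c\<bar> ^ DIM('a)) * (\<integral>\<^sup>+x. u (c *\<^sub>R x) \<partial>lborel)"
proof -
  have "(\<integral>\<^sup>+x. u x \<partial>lborel) = (\<integral>\<^sup>+x. u x \<partial>density (distr lborel borel (\<lambda>x. 0 + c *\<^sub>R x)) (\<lambda>_. \<bar>c\<bar>^DIM('a)))"
    using lborel_affine[OF c, of "0::'a"] by simp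
  also have "\<dots> = (\<integral>\<^sup>+x. ennreal (\<bar>c\<bar>^DIM('a)) * u x \<partial>distr lborel borel (\<lambda>x. 0 + c *\<^sub>R x))"
    by (subst nn_integral_density) auto
  also have "\<dots> = (\<integral>\<^sup>+x. ennreal (\<bar>c\<bar>^DIM('a)) * u (c *\<^sub>R x) \<partial>lborel)"
    by (subst nn_integral_distr) auto
  finally show ?thesis by (simp add: nn_integral_cmult)
qed

section \<open>A one-sided maximal function along rays\<close>

text \<open>
  The positive part of the largest of the sums of \<open>w - l\<close> over the first \<open>j\<close> of the
  points \<open>x\<close>, \<open>x + v\<close>, \<open>x + 2 v\<close>, \<open>\<dots>\<close>, where
  \<open>j \<le> J\<close>. Subtraction of extended nonnegative numbers is truncated at 0, which takes the
  positive part at each step of the recursion.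
\<close>

primrec hopf :: "('a::euclidean_space \<Rightarrow> ennreal) \<Rightarrow> 'a \<Rightarrow> ennreal \<Rightarrow> nat \<Rightarrow> 'a \<Rightarrow> ennreal" where
  "hopf w v l 0 x = 0"
| "hopf w v l (Suc J) x = (w x + hopf w v l J (x + v)) - l"

lemma measurable_hopf [measurable]:
  assumes [measurable]: "w \<in> borel_measurable borel"
  shows "hopf w v l J \<in> borel_measurable borel"
proof (induction J)
  case (Suc J)
  note Suc [measurable]
  show ?case by simp
qed simp

lemma le_diff_add_ennreal: "(a::ennreal) \<le> (a - b) + b"
  by (metis add.commute diff_add_self_ennreal le_iff_add linorder_le_cases order_refl add_increasing zero_le)

lemma sum_le_hopf:
  assumes "j \<le> J"
  shows "(\<Sum>i<j. w (x + real i *\<^sub>R v)) \<le> hopf w v l J x + of_nat j * l"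
  using assms
proof (induction J arbitrary: j x)
  case (Suc J)
  show ?case
  proof (cases j)
    case (Suc j')
    have "(\<Sum>i<j. w (x + real i *\<^sub>R v)) = w x + (\<Sum>i<j'. w ((x + v) + real i *\<^sub>R v))"
      unfolding Suc by (subst sum.lessThan_Suc_shift) (simp add: algebra_simps)
    also have "\<dots> \<le> w x + (hopf w v l J (x + v) + of_nat j' * l)"
      using Suc.IH[of j' "x + v"] Suc.prems Suc by (intro add_left_mono) auto
    also have "\<dots> = (w x + hopf w v l J (x + v)) + of_nat j' * l" by (simp add: ac_simps)
    also have "\<dots> \<le> (hopf w v l (Suc J) x + l) + of_nat j' * l"
      by (intro add_right_mono) (simp add: le_diff_add_ennreal)
    finally show ?thesis unfolding Suc by (simp add: algebra_simps)
  qed simp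
qed simp

lemma hopf_mono: "hopf w v l J x \<le> hopf w v l (Suc J) x"
proof (induction J arbitrary: x)
  case (Suc J)
  show ?case using Suc[of "x + v"] by (auto intro!: ennreal_minus_mono add_left_mono)
qed simp

text \<open>
  The heart of Hopf's argument. Where \<open>hopf\<close> is positive, no truncation took place in the last
  subtraction, so the recursion loses nothing and \<open>l\<close> can be moved to the left; elsewhere the left side
  is 0.
\<close>

lemma hopf_step:
  "hopf w v l J x + l * indicator {x. hopf w v l J x > 0} x \<le> w x + hopf w v l J (x + v)"
proof (cases "hopf w v l J x > 0")
  case True
  then obtain J' where J: "J = Suc J'" by (cases J) auto
  have "l \<le> w x + hopf w v l J' (x + v)"
    using True unfolding J by (auto simp: diff_gt_0_iff_gt_ennreal)
  then have "hopf w v l J x + l = w x + hopf w v l J' (x + v)"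
    unfolding J by (simp add: diff_add_cancel_ennreal)
  also have "\<dots> \<le> w x + hopf w v l J (x + v)"
    unfolding J by (intro add_left_mono hopf_mono)
  finally show ?thesis using True by simp
qed auto

text \<open>
  Only finiteness matters here: it permits cancelling the integral of \<open>hopf\<close> below.
\<close>

lemma hopf_integral_le:
  assumes [measurable]: "w \<in> borel_measurable borel"
  shows "(\<integral>\<^sup>+x. hopf w v l J x \<partial>lborel) \<le> of_nat J * (\<integral>\<^sup>+x. w x \<partial>lborel)"
proof (induction J)
  case (Suc J)
  have "(\<integral>\<^sup>+x. hopf w v l (Suc J) x \<partial>lborel) \<le> (\<integral>\<^sup>+x. w x + hopf w v l J (x + v) \<partial>lborel)"
    by (intro nn_integral_mono) (simp add: diff_le_self_ennreal)
  also have "\<dots> = (\<integral>\<^sup>+x. w x \<partial>lborel) + (\<integral>\<^sup>+x. hopf w v l J x \<partial>lborel)"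
    by (subst nn_integral_add) (simp_all add: nn_integral_lborel_shift)
  also have "\<dots> \<le> (\<integral>\<^sup>+x. w x \<partial>lborel) + of_nat J * (\<integral>\<^sup>+x. w x \<partial>lborel)"
    by (intro add_left_mono Suc)
  finally show ?case by (simp add: algebra_simps)
qed simp

text \<open>
  Integrate \<open>hopf_step\<close>: translation by \<open>v\<close> preserves volume, so the two integrals of
  \<open>hopf\<close> cancel, and \<open>hopf\<close> is positive wherever some average exceeds \<open>l\<close>
  because of \<open>sum_le_hopf\<close>.
\<close>

lemma hopf_maximal:
  assumes [measurable]: "w \<in> borel_measurable borel" and l: "l < top"
  shows "l * vol {x. \<exists>j<J. (\<Sum>i<Suc j. w (x + real i *\<^sub>R v)) > of_nat (Suc j) * l}
    \<le> (\<integral>\<^sup>+x. w x \<partial>lborel)"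
proof (cases "(\<integral>\<^sup>+x. w x \<partial>lborel) = top")
  case False
  let ?N = "hopf w v l J"
  have fin: "(\<integral>\<^sup>+x. ?N x \<partial>lborel) \<noteq> top"
    using hopf_integral_le[of w v l J] False
    by (auto simp: top_unique ennreal_mult_eq_top_iff)
  have "{x. \<exists>j<J. (\<Sum>i<Suc j. w (x + real i *\<^sub>R v)) > of_nat (Suc j) * l} \<subseteq> {x. ?N x > 0}"
  proof clarify
    fix x j assume j: "j < J" and "(\<Sum>i<Suc j. w (x + real i *\<^sub>R v)) > of_nat (Suc j) * l"
    moreover have "(\<Sum>i<Suc j. w (x + real i *\<^sub>R v)) \<le> ?N x + of_nat (Suc j) * l"
      using j by (intro sum_le_hopf) auto
    ultimately show "?N x > 0" by (auto simp: zero_less_iff_neq_zero)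
  qed
  then have "l * vol {x. \<exists>j<J. (\<Sum>i<Suc j. w (x + real i *\<^sub>R v)) > of_nat (Suc j) * l}
     \<le> l * vol {x. ?N x > 0}"
    by (intro mult_left_mono emeasure_mono) auto
  also have "\<dots> = (\<integral>\<^sup>+x. l * indicator {x. ?N x > 0} x \<partial>lborel)"
    by (subst nn_integral_cmult_indicator) auto
  finally have 1: "l * vol {x. \<exists>j<J. (\<Sum>i<Suc j. w (x + real i *\<^sub>R v)) > of_nat (Suc j) * l}
     \<le> (\<integral>\<^sup>+x. l * indicator {x. ?N x > 0} x \<partial>lborel)" .
  have "(\<integral>\<^sup>+x. ?N x \<partial>lborel) + (\<integral>\<^sup>+x. l * indicator {x. ?N x > 0} x \<partial>lborel)
     = (\<integral>\<^sup>+x. ?N x + l * indicator {x. ?N x > 0} x \<partial>lborel)"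
    by (subst nn_integral_add) auto
  also have "\<dots> \<le> (\<integral>\<^sup>+x. w x + ?N (x + v) \<partial>lborel)"
    by (intro nn_integral_mono hopf_step)
  also have "\<dots> = (\<integral>\<^sup>+x. ?N x \<partial>lborel) + (\<integral>\<^sup>+x. w x \<partial>lborel)"
    by (subst nn_integral_add) (simp_all add: nn_integral_lborel_shift add.commute)
  finally have "(\<integral>\<^sup>+x. l * indicator {x. ?N x > 0} x \<partial>lborel) \<le> (\<integral>\<^sup>+x. w x \<partial>lborel)"
    using fin by (subst (asm) ennreal_add_left_cancel_le) (auto simp: top_unique)
  with 1 show ?thesis by simp
qed simp

text \<open>
  The interval is half-open so that segments of length 1 tile longer ones without overlap.
\<close>

definition ray :: "'a::euclidean_space \<Rightarrow> ('a \<Rightarrow> ennreal) \<Rightarrow> real \<Rightarrow> 'a \<Rightarrow> ennreal" where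
  "ray h u L x = (\<integral>\<^sup>+s. u (x + s *\<^sub>R h) * indicator {0..<L} s \<partial>lborel)"

lemma measurable_ray_pair:
  assumes [measurable]: "(\<lambda>(k, x). U k x) \<in> borel_measurable (borel \<Otimes>\<^sub>M borel)"
  shows "(\<lambda>(k, x). ray (k::'a::euclidean_space) (U k) L x) \<in> borel_measurable (borel \<Otimes>\<^sub>M borel)"
  unfolding ray_def by measurable

lemma measurable_ray [measurable]:
  assumes [measurable]: "u \<in> borel_measurable borel"
  shows "ray h u L \<in> borel_measurable borel"
  unfolding ray_def by measurable

lemma ray_scale:
  assumes [measurable]: "u \<in> borel_measurable borel" and c: "c > 0"
  shows "ray h u (c * L) x = ennreal c * ray (c *\<^sub>R h) u L x"
proof -
  have "ray h u (c * L) x = ennreal c * (\<integral>\<^sup>+s. u (x + (c * s) *\<^sub>R h) * indicator {0..<c * L} (c * s) \<partial>lborel)"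
    unfolding ray_def using c by (subst nn_integral_lborel_scale[of _ c]) auto
  also have "(\<lambda>s. indicator {0..<c * L} (c * s) :: ennreal) = indicator {0..<L}"
    using c by (auto simp: indicator_def fun_eq_iff zero_le_mult_iff)
  finally show ?thesis unfolding ray_def by (simp add: mult.commute)
qed

lemma ray_integral:
  assumes [measurable]: "u \<in> borel_measurable borel" and L: "0 \<le> L"
  shows "(\<integral>\<^sup>+x. ray h u L x \<partial>lborel) = ennreal L * (\<integral>\<^sup>+x. u x \<partial>lborel)"
proof -
  have "(\<integral>\<^sup>+x. ray h u L x \<partial>lborel) = (\<integral>\<^sup>+s. \<integral>\<^sup>+x. u (x + s *\<^sub>R h) * indicator {0..<L} s \<partial>lborel \<partial>lborel)"
    unfolding ray_def by (rule lborel_pair.Fubini') measurable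
  also have "\<dots> = (\<integral>\<^sup>+s. (\<integral>\<^sup>+x. u x \<partial>lborel) * indicator {0..<L} s \<partial>lborel)"
    by (simp add: nn_integral_multc nn_integral_lborel_shift)
  also have "\<dots> = ennreal L * (\<integral>\<^sup>+x. u x \<partial>lborel)"
    using L by (subst nn_integral_cmult) (simp_all add: mult.commute)
  finally show ?thesis .
qed

lemma ray_sum:
  assumes [measurable]: "u \<in> borel_measurable borel"
  shows "ray h u (real j) x = (\<Sum>i<j. ray h u 1 (x + real i *\<^sub>R h))"
proof (induction j)
  case 0 show ?case by (simp add: ray_def)
next
  case (Suc j)
  have "ray h u (real (Suc j)) x = (\<integral>\<^sup>+s. u (x + s *\<^sub>R h) * indicator {0..<real j} s
      + u (x + s *\<^sub>R h) * indicator {real j..<real j + 1} s \<partial>lborel)"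
    unfolding ray_def by (intro nn_integral_cong) (auto simp: indicator_def)
  also have "\<dots> = ray h u (real j) x + (\<integral>\<^sup>+s. u (x + s *\<^sub>R h) * indicator {real j..<real j + 1} s \<partial>lborel)"
    unfolding ray_def by (subst nn_integral_add) auto
  also have "(\<integral>\<^sup>+s. u (x + s *\<^sub>R h) * indicator {real j..<real j + 1} s \<partial>lborel)
    = (\<integral>\<^sup>+s. u (x + (s + real j) *\<^sub>R h) * indicator {real j..<real j + 1} (s + real j) \<partial>lborel)"
    by (rule nn_integral_lborel_shift[symmetric]) measurable
  also have "\<dots> = ray h u 1 (x + real j *\<^sub>R h)"
    unfolding ray_def by (intro nn_integral_cong) (auto simp: indicator_def algebra_simps)
  finally show ?case by (simp add: Suc)
qed

text \<open>
  The supremum of the averages of \<open>u\<close> over the segments from \<open>x\<close> to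
  \<open>x + t k\<close>, for dyadic \<open>t\<close> only. This makes it a countable supremum, hence measurable,
  also jointly in \<open>k\<close> and \<open>x\<close>, and it lets finitely many lengths be written as multiples
  of one step. By \<open>ray_le_maxf\<close> all other lengths cost a factor 2.
\<close>

definition maxf :: "('a::euclidean_space \<Rightarrow> ennreal) \<Rightarrow> 'a \<Rightarrow> 'a \<Rightarrow> ennreal" where
  "maxf u k x = (SUP n. SUP j. ennreal (2 ^ n / real (Suc j)) * ray k u (real (Suc j) / 2 ^ n) x)"

lemma measurable_maxf_pair:
  assumes [measurable]: "(\<lambda>(k, x). U k x) \<in> borel_measurable (borel \<Otimes>\<^sub>M borel)"
  shows "(\<lambda>(k, x). maxf (U k) (k::'a::euclidean_space) x) \<in> borel_measurable (borel \<Otimes>\<^sub>M borel)"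
proof -
  note measurable_ray_pair[OF assms, measurable]
  show ?thesis unfolding maxf_def by measurable
qed

lemma measurable_maxf [measurable]:
  assumes [measurable]: "u \<in> borel_measurable borel"
  shows "maxf u k \<in> borel_measurable borel"
  unfolding maxf_def by measurable

text \<open>
  Averages over lengths with denominator \<open>2 ^ n\<close> are discrete averages, with step
  \<open>k / 2 ^ n\<close>, of the integral \<open>W\<close> of \<open>w\<close> over one step. The discrete
  inequality \<open>hopf_maximal\<close> thus applies with a bound that does not depend on \<open>n\<close>, and the
  level set is an increasing union over \<open>n\<close>.
\<close>

lemma maximal_weak_type:
  assumes [measurable]: "w \<in> borel_measurable borel" and l: "0 < l" "l < top"
  shows "l * vol {x. maxf w k x > l} \<le> (\<integral>\<^sup>+x. w x \<partial>lborel)"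
proof -
  define E where "E n J = {x. \<exists>j<J. ennreal (2 ^ n / real (Suc j)) * ray k w (real (Suc j) / 2 ^ n) x > l}" for n J :: nat
  have [measurable]: "E n J \<in> sets borel" for n J unfolding E_def by measurable
  have E: "l * vol (E n J) \<le> (\<integral>\<^sup>+x. w x \<partial>lborel)" for n J
  proof -
    define v where "v = (1 / 2 ^ n) *\<^sub>R k"
    define W where "W = ray v w 1"
    have [measurable]: "W \<in> borel_measurable borel" unfolding W_def by simp
    have *: "ennreal (2 ^ n / real (Suc j)) * ray k w (real (Suc j) / 2 ^ n) x
      = ennreal (1 / real (Suc j)) * (\<Sum>i<Suc j. W (x + real i *\<^sub>R v))" for j x
    proof -
      have "ray k w (real (Suc j) / 2 ^ n) x = ennreal (1 / 2 ^ n) * ray v w (real (Suc j)) x"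
        using ray_scale[of w "1 / 2 ^ n" k "real (Suc j)" x] by (simp add: v_def del: of_nat_Suc)
      then have "ennreal (2 ^ n / real (Suc j)) * ray k w (real (Suc j) / 2 ^ n) x =
         (ennreal (2 ^ n / real (Suc j)) * ennreal (1 / 2 ^ n)) * ray v w (real (Suc j)) x"
        by (simp only: mult.assoc)
      also have "ennreal (2 ^ n / real (Suc j)) * ennreal (1 / 2 ^ n) = ennreal (1 / real (Suc j))"
        by (subst ennreal_mult[symmetric]) auto
      finally show ?thesis by (simp only: ray_sum[OF assms(1)] W_def)
    qed
    have "{x. \<exists>j<J. (\<Sum>i<Suc j. W (x + real i *\<^sub>R v)) > of_nat (Suc j) * l} = E n J"
    proof -
      have "(\<Sum>i<Suc j. W (x + real i *\<^sub>R v)) > of_nat (Suc j) * l \<longleftrightarrow>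
         ennreal (1 / real (Suc j)) * (\<Sum>i<Suc j. W (x + real i *\<^sub>R v)) > l" (is "?A > _ \<longleftrightarrow> _") for j x
      proof -
        have e: "ennreal (1 / real (Suc j)) * (of_nat (Suc j) * l) = l"
        proof -
          have "ennreal (1 / real (Suc j)) * ennreal (real (Suc j)) = 1"
            by (subst ennreal_mult[symmetric]) auto
          then show ?thesis by (metis ennreal_of_nat_eq_real_of_nat mult.assoc mult_1)
        qed
        have "ennreal (1 / real (Suc j)) * (of_nat (Suc j) * l) < ennreal (1 / real (Suc j)) * ?A \<longleftrightarrow> of_nat (Suc j) * l < ?A"
          unfolding not_le[symmetric] by (subst ennreal_mult_le_mult_iff) (auto simp del: of_nat_Suc)
        then show ?thesis using e by simp
      qed
      then show ?thesis unfolding E_def * by blast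
    qed
    then show ?thesis
      using hopf_maximal[of W l J v] l ray_integral[of w 1 v] by (simp add: W_def)
  qed
  have mono2: "E n J \<subseteq> E (Suc n) (Suc (2 * J))" for n J
  proof
    fix x assume "x \<in> E n J"
    then obtain j where j: "j < J" "ennreal (2 ^ n / real (Suc j)) * ray k w (real (Suc j) / 2 ^ n) x > l"
      by (auto simp: E_def)
    have "2 ^ n / real (Suc j) = 2 ^ Suc n / real (Suc (2 * j + 1))" "real (Suc j) / 2 ^ n = real (Suc (2 * j + 1)) / 2 ^ Suc n"
      by (auto simp: field_simps)
    then show "x \<in> E (Suc n) (Suc (2 * J))"
      using j unfolding E_def by (intro CollectI exI[of _ "2 * j + 1"]) (auto simp del: of_nat_Suc power_Suc)
  qed
  have mono1: "J \<le> J' \<Longrightarrow> E n J \<subseteq> E n J'" for n J J' unfolding E_def by force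
  \<comment> \<open>Refining the step doubles the number of steps needed for a given length, so \<open>4 ^ n\<close> steps at
    level \<open>n\<close> cover lengths up to \<open>2 ^ n\<close> and eventually every dyadic length.\<close>
  have "E n (4 ^ n) \<subseteq> E (Suc n) (4 ^ Suc n)" for n
    using mono2[of n "4 ^ n"] mono1[of "Suc (2 * 4 ^ n)" "4 ^ Suc n" "Suc n"]
    by (smt (verit, best) Suc_leI dual_order.trans less_add_same_cancel1 mult_2 mult_less_mono1
        numeral_Bit0_eq_double numeral_less_iff power_Suc semiring_norm(76) semiring_norm(78) zero_less_numeral zero_less_power subset_trans)
  then have inc: "incseq (\<lambda>n. E n (4 ^ n))" by (rule incseq_SucI)
  have "{x. maxf w k x > l} \<subseteq> (\<Union>n. E n (4 ^ n))"
  proof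
    fix x assume "x \<in> {x. maxf w k x > l}"
    then obtain n j where "ennreal (2 ^ n / real (Suc j)) * ray k w (real (Suc j) / 2 ^ n) x > l"
      by (auto simp: maxf_def less_SUP_iff)
    then have x: "x \<in> E n (Suc j)" unfolding E_def by blast
    have "x \<in> E (n + i) (2 ^ i * Suc j + (2 ^ i - 1))" for i
    proof (induction i)
      case (Suc i)
      have "Suc (2 * (2 ^ i * Suc j + (2 ^ i - 1))) = 2 ^ Suc i * Suc j + (2 ^ Suc i - 1)"
      proof -
        obtain q where "(2::nat) ^ i = Suc q" using not0_implies_Suc[of "2 ^ i"] by auto
        then show ?thesis by simp
      qed
      with Suc mono2[of "n + i" "2 ^ i * Suc j + (2 ^ i - 1)"] show ?case by auto
    qed (use x in auto)
    note this[of "Suc j"]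
    moreover have "2 ^ Suc j * Suc j + (2 ^ Suc j - 1) \<le> (4::nat) ^ (n + Suc j)"
    proof -
      have a: "Suc (Suc j) \<le> 2 ^ Suc j" by (induction j) auto
      have "2 ^ Suc j * Suc j + (2 ^ Suc j - 1) \<le> 2 ^ Suc j * Suc (Suc j)" by simp
      also have "\<dots> \<le> 2 ^ Suc j * 2 ^ Suc j" using a by (intro mult_le_mono2)
      also have "\<dots> = 4 ^ Suc j" by (simp only: power_mult_distrib[symmetric]) simp
      also have "\<dots> \<le> 4 ^ (n + Suc j)" by (intro power_increasing) auto
      finally show ?thesis .
    qed
    ultimately have "x \<in> E (n + Suc j) (4 ^ (n + Suc j))" using mono1 by blast
    then show "x \<in> (\<Union>n. E n (4 ^ n))" by blast
  qed
  then have "l * vol {x. maxf w k x > l} \<le> l * vol (\<Union>n. E n (4 ^ n))"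
    by (intro mult_left_mono emeasure_mono) auto
  also have "vol (\<Union>n. E n (4 ^ n)) = (SUP n. vol (E n (4 ^ n)))"
    using inc by (intro SUP_emeasure_incseq[symmetric]) auto
  also have "l * \<dots> = (SUP n. l * vol (E n (4 ^ n)))"
    by (simp add: SUP_mult_left_ennreal)
  also have "\<dots> \<le> (\<integral>\<^sup>+x. w x \<partial>lborel)" by (intro SUP_least E)
  finally show ?thesis .
qed

text \<open>
  There is a dyadic length between \<open>t\<close> and \<open>2 * t\<close>; enlarging the segment to it only
  increases the integral.
\<close>

lemma ray_le_maxf:
  assumes [measurable]: "u \<in> borel_measurable borel" and t: "0 < t"
  shows "ray k u t x \<le> ennreal (2 * t) * maxf u k x"
proof -
  obtain n where n: "1 / 2 ^ n < t"
    using real_arch_pow_inv[of t "1/2"] t by (auto simp: power_divide)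
  define j where "j = nat \<lceil>t * 2 ^ n\<rceil> - 1"
  have "1 < t * 2 ^ n" using n by (simp add: field_simps)
  then have c: "\<lceil>t * 2 ^ n\<rceil> \<ge> 1" by linarith
  then have j: "real (Suc j) = of_int \<lceil>t * 2 ^ n\<rceil>" unfolding j_def by simp
  define d where "d = real (Suc j) / 2 ^ n"
  have d: "t \<le> d" "d \<le> 2 * t" "0 < d"
  proof -
    have "t * 2 ^ n \<le> real (Suc j)" unfolding j by linarith
    then show "t \<le> d" by (simp add: d_def field_simps)
    have "real (Suc j) \<le> t * 2 ^ n + 1" unfolding j by linarith
    also have "\<dots> \<le> 2 * t * 2 ^ n" using \<open>1 < t * 2 ^ n\<close> by simp
    finally show "d \<le> 2 * t" by (simp add: d_def field_simps)
    show "0 < d" by (simp add: d_def)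
  qed
  have "ray k u t x \<le> ray k u d x"
    unfolding ray_def using d by (intro nn_integral_mono mult_left_mono) (auto simp: indicator_def)
  also have "\<dots> = ennreal d * (ennreal (1 / d) * ray k u d x)"
    using d by (simp add: mult.assoc[symmetric] ennreal_mult[symmetric])
  also have "ennreal (1 / d) * ray k u d x \<le> maxf u k x"
    unfolding maxf_def by (rule SUP_upper2[of n], simp, rule SUP_upper2[of j]) (simp_all add: d_def)
  also have "ennreal d * maxf u k x \<le> ennreal (2 * t) * maxf u k x"
    using d by (intro mult_right_mono ennreal_leI) auto
  finally show ?thesis by (simp add: mult_left_mono)
qed

text \<open>
  This replaces homogeneity of degree 0 in \<open>k\<close>, which the restriction to dyadic lengths destroys.
\<close>

lemma maxf_scale:
  assumes [measurable]: "u \<in> borel_measurable borel" and t: "0 < t"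
  shows "maxf u (t *\<^sub>R k) x \<le> 2 * maxf u k x"
  unfolding maxf_def[of u "t *\<^sub>R k"]
proof (intro SUP_least)
  fix n j :: nat
  define d where "d = real (Suc j) / 2 ^ n"
  have d: "0 < d" by (simp add: d_def)
  have "ennreal t * (ennreal (1 / d) * ray (t *\<^sub>R k) u d x) = ennreal (1 / d) * ray k u (t * d) x"
    using t ray_scale[of u t k d x] by (simp add: ac_simps)
  also have "\<dots> \<le> ennreal (1 / d) * (ennreal (2 * (t * d)) * maxf u k x)"
    using t d by (intro mult_left_mono ray_le_maxf) auto
  also have "\<dots> = ennreal t * (2 * maxf u k x)"
    using t d by (simp add: mult.assoc[symmetric] ennreal_mult[symmetric] ennreal_numeral[symmetric] del: ennreal_numeral)
      (simp add: ennreal_mult'' field_simps)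
  finally have "ennreal (1 / d) * ray (t *\<^sub>R k) u d x \<le> 2 * maxf u k x"
    using t by (simp add: ennreal_mult_le_mult_iff)
  then show "ennreal (2 ^ n / real (Suc j)) * ray (t *\<^sub>R k) u (real (Suc j) / 2 ^ n) x \<le> 2 * maxf u k x"
    by (simp add: d_def)
qed

lemma maxf_cmult:
  assumes [measurable]: "u \<in> borel_measurable borel"
  shows "maxf (\<lambda>x. c * u x) k x = c * maxf u k x"
  unfolding maxf_def ray_def
  by (simp add: mult.assoc nn_integral_cmult SUP_mult_left_ennreal mult.left_commute[of _ c])

text \<open>
  The part of \<open>u\<close> below \<open>l\<close> adds at most \<open>l\<close> to every average, so a value
  above \<open>2 * l\<close> must come from the rest. Only the values of \<open>u\<close> above \<open>l\<close>
  remain on the right: integrating this over \<open>l\<close> against a power weight yields an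
  \<open>L\<^sup>p\<close> bound for \<open>p > 1\<close>, as in Marcinkiewicz interpolation.
\<close>

lemma maximal_weak_type_cut:
  assumes [measurable]: "u \<in> borel_measurable borel" and l: "0 < l" "l < top"
  shows "l * vol {x. maxf u k x > 2 * l} \<le> (\<integral>\<^sup>+x. u x * indicator {x. u x > l} x \<partial>lborel)"
proof -
  let ?w = "\<lambda>x. u x * indicator {x. u x > l} x"
  have "maxf u k x \<le> l + maxf ?w k x" for x
    unfolding maxf_def[of u]
  proof (intro SUP_least)
    fix n j :: nat
    define d where "d = real (Suc j) / 2 ^ n"
    have d: "0 < d" by (simp add: d_def)
    have "ray k u d x \<le> (\<integral>\<^sup>+s. l * indicator {0..<d} s + ?w (x + s *\<^sub>R k) * indicator {0..<d} s \<partial>lborel)"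
      unfolding ray_def by (intro nn_integral_mono) (auto simp: indicator_def)
    also have "\<dots> = l * ennreal d + ray k ?w d x"
      unfolding ray_def using d by (subst nn_integral_add) (auto simp: nn_integral_cmult)
    finally have "ennreal (1 / d) * ray k u d x \<le> ennreal (1 / d) * (l * ennreal d + ray k ?w d x)"
      by (intro mult_left_mono) auto
    also have "\<dots> = l + ennreal (1 / d) * ray k ?w d x"
      using d by (simp add: distrib_left mult.left_commute[of _ l] ennreal_mult[symmetric])
    also have "ennreal (1 / d) * ray k ?w d x \<le> maxf ?w k x"
      unfolding maxf_def by (rule SUP_upper2[of n], simp, rule SUP_upper2[of j]) (simp_all add: d_def)
    finally show "ennreal (2 ^ n / real (Suc j)) * ray k u (real (Suc j) / 2 ^ n) x \<le> l + maxf ?w k x"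
      by (simp add: d_def add_left_mono)
  qed
  then have "{x. maxf u k x > 2 * l} \<subseteq> {x. maxf ?w k x > l}"
  proof (intro subsetI CollectI)
    fix x assume *: "\<And>x. maxf u k x \<le> l + maxf ?w k x" and "x \<in> {x. maxf u k x > 2 * l}"
    then have "l + l < maxf u k x" by (auto simp: mult_2)
    then have "l + l < l + maxf ?w k x" using *[of x] by (rule less_le_trans)
    then have "\<not> maxf ?w k x \<le> l" by (meson add_left_mono leD)
    then show "maxf ?w k x > l" by (simp add: not_le)
  qed
  then have "l * vol {x. maxf u k x > 2 * l} \<le> l * vol {x. maxf ?w k x > l}"
    by (intro mult_left_mono emeasure_mono) auto
  also have "\<dots> \<le> (\<integral>\<^sup>+x. ?w x \<partial>lborel)"
    using l by (intro maximal_weak_type) auto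
  finally show ?thesis .
qed

section \<open>Integration in polar form with respect to a convex body\<close>

text \<open>
  The source of all constants: \<open>q = p\<close> gives the value of the limit, \<open>q = p - 1\<close> the
  finiteness of the dominating integral, and \<open>m = 1\<close> writes a negative power of a norm as an
  integral.
\<close>

lemma power_weight_integral:
  fixes c q :: real
  assumes c: "0 \<le> c" and q: "0 < q" and m: "1 \<le> (m::nat)"
  shows "(\<integral>\<^sup>+t. ennreal (t powr (- (real m * q) - 1)) * indicator {t. 0 < t \<and> 1 < t ^ m * c} t \<partial>lborel)
    = ennreal (c powr q / (real m * q))"
proof (cases "c = 0")
  case False
  with c have c: "0 < c" by simp
  define a where "a = c powr (- 1 / real m)"
  have a: "0 < a" using c by (simp add: a_def)
  have am: "a ^ m = 1 / c"
  proof -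
    have "a ^ m = c powr (- 1 / real m * real m)"
      unfolding a_def using a by (simp only: powr_realpow[symmetric] powr_powr a_def)
    also have "\<dots> = 1 / c" using m c by (simp add: powr_minus_divide)
    finally show ?thesis .
  qed
  have iff: "1 < t ^ m * c \<longleftrightarrow> a < t" if "0 < t" for t
  proof -
    have "1 < t ^ m * c \<longleftrightarrow> a ^ m < t ^ m" using c by (simp add: am field_simps)
    also have "\<dots> \<longleftrightarrow> a < t" using a that m by (simp add: power_mono_iff flip: not_le)
    finally show ?thesis .
  qed
  have "(\<integral>\<^sup>+t. ennreal (t powr (- (real m * q) - 1)) * indicator {t. 0 < t \<and> 1 < t ^ m * c} t \<partial>lborel)
    = (\<integral>\<^sup>+t. ennreal (t powr (- (real m * q) - 1)) * indicator {a..} t \<partial>lborel)"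
    using AE_lborel_singleton[of a]
    by (intro nn_integral_cong_AE, elim eventually_mono) (use a in \<open>auto simp: indicator_def iff\<close>)
  also have "\<dots> = ennreal (- (a powr (- (real m * q) - 1 + 1)) / (- (real m * q) - 1 + 1))"
    using a m q by (intro nn_integral_has_integral_lebesgue' has_integral_powr_to_inf) auto
  also have "- (a powr (- (real m * q) - 1 + 1)) / (- (real m * q) - 1 + 1) = c powr q / (real m * q)"
    using m c by (simp add: a_def powr_powr)
  finally show ?thesis .
qed simp

text \<open>
  A substitute for polar coordinates. Write \<open>N x powr (- a)\<close> as the integral of
  \<open>a * t powr (- a - 1)\<close> over \<open>t > N x\<close>, exchange the integrals, and replace
  \<open>x\<close> by \<open>t x\<close>, which turns the condition \<open>N x < t\<close> into
  \<open>N x < 1\<close> and produces the power of \<open>t\<close> equal to the dimension.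
\<close>

lemma cone_integral:
  fixes N :: "'a::euclidean_space \<Rightarrow> real" and g :: "'a \<Rightarrow> ennreal"
  assumes [measurable]: "N \<in> borel_measurable borel" "g \<in> borel_measurable borel"
    and hom: "\<And>t x. 0 < t \<Longrightarrow> N (t *\<^sub>R x) = t * N x"
    and pos: "\<And>x. x \<noteq> 0 \<Longrightarrow> 0 < N x"
    and a: "0 < a"
  shows "(\<integral>\<^sup>+x. ennreal (1 / N x powr a) * g x \<partial>lborel)
    = (\<integral>\<^sup>+x. (\<integral>\<^sup>+t. ennreal (a * t powr (real DIM('a) - a - 1)) * g (t *\<^sub>R x) * indicator {0<..} t \<partial>lborel)
         * indicator {x. N x < 1} x \<partial>lborel)"
proof -
  let ?w = "\<lambda>t. ennreal (a * t powr (- a - 1))"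
  have w: "ennreal (1 / N x powr a) = (\<integral>\<^sup>+t. ?w t * indicator {t. 0 < t \<and> N x < t} t \<partial>lborel)" if "x \<noteq> 0" for x
  proof -
    have "(\<integral>\<^sup>+t. ?w t * indicator {t. 0 < t \<and> N x < t} t \<partial>lborel) =
       (\<integral>\<^sup>+t. ennreal a * (ennreal (t powr (- (real 1 * a) - 1)) * indicator {t. 0 < t \<and> 1 < t ^ 1 * (1 / N x)} t) \<partial>lborel)"
      using pos[OF that] a by (intro nn_integral_cong) (auto simp: indicator_def ennreal_mult)
    also have "\<dots> = ennreal a * ennreal ((1 / N x) powr a / (real 1 * a))"
      using pos[OF that] a by (subst nn_integral_cmult, simp, subst power_weight_integral) auto
    also have "\<dots> = ennreal (1 / N x powr a)"
      using pos[OF that] a by (simp add: ennreal_mult[symmetric] powr_divide)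
    finally show ?thesis by simp
  qed
  have "(\<integral>\<^sup>+x. ennreal (1 / N x powr a) * g x \<partial>lborel)
     = (\<integral>\<^sup>+x. \<integral>\<^sup>+t. ?w t * indicator {t. 0 < t \<and> N x < t} t * g x \<partial>lborel \<partial>lborel)"
    using AE_lborel_singleton[of "0::'a"]
    by (intro nn_integral_cong_AE, eventually_elim) (simp add: w nn_integral_multc)
  also have "\<dots> = (\<integral>\<^sup>+t. \<integral>\<^sup>+x. ?w t * indicator {t. 0 < t \<and> N x < t} t * g x \<partial>lborel \<partial>lborel)"
    by (rule lborel_pair.Fubini') measurable
  also have "\<dots> = (\<integral>\<^sup>+t. \<integral>\<^sup>+x. ennreal (a * t powr (real DIM('a) - a - 1)) * g (t *\<^sub>R x) * indicator {0<..} t * indicator {x. N x < 1} x \<partial>lborel \<partial>lborel)"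
  proof (rule nn_integral_cong)
    fix t :: real
    show "(\<integral>\<^sup>+x. ?w t * indicator {t. 0 < t \<and> N x < t} t * g x \<partial>lborel) =
      (\<integral>\<^sup>+x. ennreal (a * t powr (real DIM('a) - a - 1)) * g (t *\<^sub>R x) * indicator {0<..} t * indicator {x. N x < 1} x \<partial>lborel)"
    proof (cases "0 < t")
      case True
      have "(\<integral>\<^sup>+x. ?w t * indicator {t. 0 < t \<and> N x < t} t * g x \<partial>lborel) =
        ennreal (\<bar>t\<bar> ^ DIM('a)) * (\<integral>\<^sup>+x. ?w t * indicator {s. 0 < s \<and> N (t *\<^sub>R x) < s} t * g (t *\<^sub>R x) \<partial>lborel)"
        using True nn_integral_lborel_scale[of "\<lambda>x. ?w t * indicator {t. 0 < t \<and> N x < t} t * g x" t] by simp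
      also have "\<dots> = (\<integral>\<^sup>+x. ennreal (\<bar>t\<bar> ^ DIM('a)) * (?w t * indicator {s. 0 < s \<and> N (t *\<^sub>R x) < s} t * g (t *\<^sub>R x)) \<partial>lborel)"
        by (subst nn_integral_cmult) auto
      also have "\<dots> = (\<integral>\<^sup>+x. ennreal (a * t powr (real DIM('a) - a - 1)) * g (t *\<^sub>R x) * indicator {0<..} t * indicator {x. N x < 1} x \<partial>lborel)"
      proof (rule nn_integral_cong)
        fix x :: 'a
        show "ennreal (\<bar>t\<bar> ^ DIM('a)) * (?w t * indicator {s. 0 < s \<and> N (t *\<^sub>R x) < s} t * g (t *\<^sub>R x)) =
         ennreal (a * t powr (real DIM('a) - a - 1)) * g (t *\<^sub>R x) * indicator {0<..} t * indicator {x. N x < 1} x"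
        proof -
        have "ennreal (\<bar>t\<bar> ^ DIM('a)) * ?w t = ennreal (a * t powr (real DIM('a) - a - 1))"
          using True a by (simp add: ennreal_mult[symmetric] powr_realpow[symmetric] powr_add[symmetric] mult.left_commute[of _ a])
            (simp add: algebra_simps)
        moreover have "indicator {s. 0 < s \<and> N (t *\<^sub>R x) < s} t = (indicator {x. N x < 1} x :: ennreal)"
          using True by (auto simp: indicator_def hom)
        ultimately show ?thesis using True by (simp add: mult.assoc[symmetric]) (simp add: ac_simps)
        qed
      qed
      finally show ?thesis .
    qed simp
  qed
  also have "\<dots> = (\<integral>\<^sup>+x. \<integral>\<^sup>+t. ennreal (a * t powr (real DIM('a) - a - 1)) * g (t *\<^sub>R x) * indicator {0<..} t * indicator {x. N x < 1} x \<partial>lborel \<partial>lborel)"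
    by (rule lborel_pair.Fubini'[symmetric]) measurable
  also have "\<dots> = (\<integral>\<^sup>+x. (\<integral>\<^sup>+t. ennreal (a * t powr (real DIM('a) - a - 1)) * g (t *\<^sub>R x) * indicator {0<..} t \<partial>lborel)
         * indicator {x. N x < 1} x \<partial>lborel)"
    by (simp add: nn_integral_multc)
  finally show ?thesis .
qed

locale convex_body =
  fixes K :: "(real ^ 'n) set"
  assumes bdd: "bounded K" and conv: "convex K" and symm: "K = uminus ` K"
    and zero: "0 \<in> K" and int: "interior K \<noteq> {}"
begin

lemma zero_interior: "0 \<in> interior K"
proof -
  from int obtain x where x: "x \<in> interior K" by blast
  have "interior K = uminus ` interior K"
    by (subst symm, rule interior_negations)
  with x have "- x \<in> interior K" by blast
  then have "(1/2) *\<^sub>R x + (1/2) *\<^sub>R (- x) \<in> interior K"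
    using x convex_interior[OF conv] by (intro convexD) auto
  then show ?thesis by simp
qed

lemma ex_scale_in: "\<exists>l>0. x /\<^sub>R l \<in> K"
proof -
  obtain e where e: "e > 0" "ball 0 e \<subseteq> K" using zero_interior by (auto simp: mem_interior)
  define l where "l = (norm x + 1) / e"
  have l: "0 < l" using e by (simp add: l_def add_nonneg_pos)
  have "norm (x /\<^sub>R l) < e"
    using e l unfolding l_def by (simp add: field_simps add_nonneg_pos)
  with e l show ?thesis by (intro exI[of _ l]) (auto simp: subset_iff)
qed

text \<open>
  Strict sublevel sets are multiples of the interior of \<open>K\<close>, whichever boundary points \<open>K\<close>
  contains. They are open, which gives measurability of the norm.
\<close>

lemma norm_less_iff:
  assumes t: "0 < t"
  shows "norm_of_ball K x < t \<longleftrightarrow> x /\<^sub>R t \<in> interior K"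
proof
  have bb: "bdd_below {l. 0 < l \<and> x /\<^sub>R l \<in> K}" by (intro bdd_belowI[of _ 0]) auto
  have ne: "{l. 0 < l \<and> x /\<^sub>R l \<in> K} \<noteq> {}" using ex_scale_in by auto
  { assume "norm_of_ball K x < t"
    then obtain l where l: "0 < l" "x /\<^sub>R l \<in> K" "l < t"
      unfolding norm_of_ball_def using cInf_less_iff[OF ne bb] by auto
    have "x /\<^sub>R l - (1 - l / t) *\<^sub>R (x /\<^sub>R l - 0) \<in> interior K"
      using l t conv zero_interior by (intro mem_interior_convex_shrink) (auto simp: field_simps)
    moreover have "x /\<^sub>R l - (1 - l / t) *\<^sub>R (x /\<^sub>R l - 0) = x /\<^sub>R t"
      using l t by (simp add: algebra_simps) (simp add: field_simps)
    ultimately show "x /\<^sub>R t \<in> interior K" by simp }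
  assume "x /\<^sub>R t \<in> interior K"
  then obtain e where e: "e > 0" "ball (x /\<^sub>R t) e \<subseteq> K" by (auto simp: mem_interior)
  \<comment> \<open>A factor slightly above 1 that moves \<open>x /\<^sub>R t\<close> by less than \<open>e\<close>.\<close>
  define c where "c = 1 + e / (2 * (norm (x /\<^sub>R t) + 1))"
  have c: "c > 1" using e by (simp add: c_def add_nonneg_pos)
  have "norm ((c - 1) *\<^sub>R (x /\<^sub>R t)) < e"
  proof -
    have "norm ((c - 1) *\<^sub>R (x /\<^sub>R t)) = e / 2 * (norm (x /\<^sub>R t) / (norm (x /\<^sub>R t) + 1))"
      using c by (simp only: norm_scaleR) (simp add: c_def e(1) less_imp_le)
    also have "\<dots> \<le> e / 2 * 1" using e by (intro mult_left_mono divide_le_eq_1_pos[THEN iffD2]) (auto simp: add_nonneg_pos simp del: norm_scaleR)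
    also have "\<dots> < e" using e by simp
    finally show ?thesis .
  qed
  moreover have "dist (x /\<^sub>R t) (c *\<^sub>R (x /\<^sub>R t)) = norm ((c - 1) *\<^sub>R (x /\<^sub>R t))"
    by (subst dist_commute) (simp only: dist_norm scaleR_left_diff_distrib scaleR_one)
  ultimately have "c *\<^sub>R (x /\<^sub>R t) \<in> K" using e by (auto simp del: scaleR_scaleR)
  moreover have "c *\<^sub>R (x /\<^sub>R t) = x /\<^sub>R (t / c)" by (simp add: inverse_eq_divide)
  ultimately have "x /\<^sub>R (t / c) \<in> K" by (simp only:)
  then have "norm_of_ball K x \<le> t / c"
    unfolding norm_of_ball_def using bb t c by (intro cInf_lower) auto
  also have "\<dots> < t" using t c by (simp add: field_simps)
  finally show "norm_of_ball K x < t" .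
qed

lemma norm_nonneg: "0 \<le> norm_of_ball K x"
  unfolding norm_of_ball_def using ex_scale_in[of x] by (intro cInf_greatest) auto

lemma norm_pos:
  assumes "x \<noteq> 0" shows "0 < norm_of_ball K x"
proof (rule ccontr)
  assume "\<not> 0 < norm_of_ball K x"
  then have *: "x /\<^sub>R t \<in> K" if "0 < t" for t
    using norm_less_iff[OF that, of x] that interior_subset[of K] \<open>\<not> 0 < norm_of_ball K x\<close> by force
  obtain B where B: "B > 0" "\<And>y. y \<in> K \<Longrightarrow> norm y \<le> B" using bdd by (auto simp: bounded_pos)
  have "norm (x /\<^sub>R (norm x / (2 * B))) \<le> B" using assms B by (intro B(2) *) auto
  then show False using assms B by simp
qed

lemma norm_scale:
  assumes t: "0 < t" shows "norm_of_ball K (t *\<^sub>R x) = t * norm_of_ball K x"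
proof -
  have "norm_of_ball K (t *\<^sub>R x) < r \<longleftrightarrow> t * norm_of_ball K x < r" if r: "0 < r" for r
  proof -
    have "norm_of_ball K (t *\<^sub>R x) < r \<longleftrightarrow> norm_of_ball K x < r / t"
      using r t by (simp add: norm_less_iff divide_inverse ac_simps)
    then show ?thesis using t by (simp add: field_simps)
  qed
  note iff = this
  show ?thesis
  proof (rule antisym)
    show "norm_of_ball K (t *\<^sub>R x) \<le> t * norm_of_ball K x"
      using iff[of "norm_of_ball K (t *\<^sub>R x)"] norm_nonneg[of x] norm_nonneg[of "t *\<^sub>R x"] t
      by (cases "norm_of_ball K (t *\<^sub>R x) = 0") auto
    show "t * norm_of_ball K x \<le> norm_of_ball K (t *\<^sub>R x)"
      using iff[of "t * norm_of_ball K x"] norm_nonneg[of x] norm_nonneg[of "t *\<^sub>R x"] t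
      by (cases "norm_of_ball K x = 0") auto
  qed
qed

lemma measurable_norm [measurable]: "norm_of_ball K \<in> borel_measurable borel"
proof (rule borel_measurableI_less)
  fix t
  have "{x. norm_of_ball K x < t} = (if 0 < t then (\<lambda>x. x /\<^sub>R t) -` interior K else {})"
    using norm_less_iff[of t] norm_nonneg by (auto simp: not_less intro: order_trans)
  moreover have "open ((\<lambda>x. x /\<^sub>R t) -` interior K)" by (intro open_vimage continuous_intros) auto
  ultimately show "{x \<in> space borel. norm_of_ball K x < t} \<in> sets borel" by auto
qed

lemma unit_ball_eq: "{x. norm_of_ball K x < 1} = interior K"
  using norm_less_iff[of 1] by auto

lemma AE_interior: "AE x in lebesgue. x \<in> K \<longleftrightarrow> x \<in> interior K"
proof -
  have "frontier K \<in> null_sets lebesgue"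
    using negligible_convex_frontier[OF conv] by (simp add: negligible_iff_null_sets)
  then have "AE x in lebesgue. x \<notin> frontier K" by (rule AE_not_in)
  then show ?thesis
  proof eventually_elim
    case (elim x)
    then show ?case using interior_subset[of K] closure_subset[of K] by (auto simp: frontier_def)
  qed
qed

end

section \<open>Test functions and uniqueness of weak derivatives\<close>

lemma partial_eq:
  assumes "(f has_derivative f') (at x)"
  shows "partial i f x = f' (axis i 1)"
  using frechet_derivative_at[OF assms] by (simp add: partial_def)

lemma partials_snoc: "partials (is @ [i]) f = partials is (partial i f)"
  by (simp add: partials_def)

lemma partial_add:
  assumes "f differentiable at x" "g differentiable at x"
  shows "partial i (\<lambda>x. f x + g x) x = partial i f x + partial i g x"
  using assms unfolding frechet_derivative_works
  by (subst partial_eq[OF has_derivative_add]) (auto simp: partial_def)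

lemma partial_mult:
  assumes "f differentiable at x" "g differentiable at x"
  shows "partial i (\<lambda>x. f x * g x) x = f x * partial i g x + partial i f x * g x"
  using assms unfolding frechet_derivative_works
  by (subst partial_eq[OF has_derivative_mult]) (auto simp: partial_def)

text \<open>
  Differentiability of finite order, so that closure under sums and products can be proved by induction on the
  order.
\<close>

primrec smooth_upto :: "nat \<Rightarrow> (real ^ 'n \<Rightarrow> real) \<Rightarrow> bool" where
  "smooth_upto 0 f \<longleftrightarrow> (\<forall>x. f differentiable at x)"
| "smooth_upto (Suc n) f \<longleftrightarrow> (\<forall>x. f differentiable at x) \<and> (\<forall>i. smooth_upto n (partial i f))"

lemma smooth_upto_Suc: "smooth_upto (Suc n) f \<Longrightarrow> smooth_upto n f"
  by (induction n arbitrary: f) auto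

lemma smooth_upto_partials:
  "smooth_upto (length is) f \<Longrightarrow> partials is f differentiable at x"
proof (induction "is" arbitrary: f rule: rev_induct)
  case Nil
  then show ?case by (simp add: partials_def)
next
  case (snoc i "is")
  then show ?case by (simp add: partials_snoc)
qed

lemma smooth_upto_const: "smooth_upto n (\<lambda>x. c)"
proof (induction n arbitrary: c)
  case (Suc n)
  have "partial i (\<lambda>x. c) = (\<lambda>x. 0)" for i :: 'a
    by (rule ext, subst partial_eq[OF has_derivative_const]) simp
  then show ?case using Suc by simp
qed simp

lemma smooth_upto_add:
  "smooth_upto n f \<Longrightarrow> smooth_upto n g \<Longrightarrow> smooth_upto n (\<lambda>x. f x + g x)"
proof (induction n arbitrary: f g)
  case (Suc n)
  have "partial i (\<lambda>x. f x + g x) = (\<lambda>x. partial i f x + partial i g x)" for i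
    using Suc.prems unfolding smooth_upto.simps by (intro ext partial_add) blast+
  then show ?case using Suc by (simp add: differentiable_add)
qed (simp add: differentiable_add)

lemma smooth_upto_mult:
  "smooth_upto n f \<Longrightarrow> smooth_upto n g \<Longrightarrow> smooth_upto n (\<lambda>x. f x * g x)"
proof (induction n arbitrary: f g)
  case (Suc n)
  have "partial i (\<lambda>x. f x * g x) = (\<lambda>x. f x * partial i g x + partial i f x * g x)" for i
    using Suc.prems unfolding smooth_upto.simps by (intro ext partial_mult) blast+
  moreover have "smooth_upto n (\<lambda>x. f x * partial i g x + partial i f x * g x)" for i
    using Suc.prems smooth_upto_Suc[OF Suc.prems(1)] smooth_upto_Suc[OF Suc.prems(2)]
    by (intro smooth_upto_add Suc.IH) auto
  ultimately show ?case using Suc.prems by (simp add: differentiable_mult)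
qed (simp add: differentiable_mult)

lemma smooth_upto_prod:
  assumes "finite I" "\<And>i. i \<in> I \<Longrightarrow> smooth_upto n (f i)"
  shows "smooth_upto n (\<lambda>x. \<Prod>i\<in>I. f i x)"
  using assms by (induction I) (auto intro: smooth_upto_mult smooth_upto_const)

text \<open>
  Smoothness of functions of one coordinate, reduced to a class \<open>H\<close> of functions of one real variable
  that is closed under differentiation.
\<close>

lemma smooth_upto_coordinate:
  assumes H: "\<And>h. h \<in> H \<Longrightarrow> \<exists>h'\<in>H. \<forall>t. (h has_real_derivative h' t) (at t)"
  shows "h \<in> H \<Longrightarrow> smooth_upto n (\<lambda>x. h (c * x $ i + d))"
proof (induction n arbitrary: h)
  have der: "((\<lambda>x. h (c * x $ i + d)) has_derivative (\<lambda>v. h' (c * x $ i + d) * (c * v $ i))) (at x)"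
    if "\<forall>t. (h has_real_derivative h' t) (at t)" for h h' and x :: "real ^ 'a"
  proof -
    have "((\<lambda>x. c * x $ i + d) has_derivative (\<lambda>v. c * v $ i)) (at x)"
      by (auto intro!: derivative_eq_intros bounded_linear.has_derivative[OF bounded_linear_vec_nth])
    moreover have "(h has_derivative (*) (h' (c * x $ i + d))) (at (c * x $ i + d))"
      using that by (simp add: has_field_derivative_def)
    ultimately show ?thesis by (rule has_derivative_compose)
  qed
  { case 0
    then obtain h' where "\<forall>t. (h has_real_derivative h' t) (at t)" using H by blast
    from der[OF this] show ?case unfolding smooth_upto.simps differentiable_def by blast }
  { case (Suc n)
    then obtain h' where h': "h' \<in> H" "\<forall>t. (h has_real_derivative h' t) (at t)" using H by blast
    have "partial j (\<lambda>x. h (c * x $ i + d)) = (\<lambda>x. h' (c * x $ i + d) * (c * axis j 1 $ i))" for j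
      by (intro ext partial_eq der h')
    moreover have "smooth_upto n (\<lambda>x. h' (c * x $ i + d) * (c * axis j 1 $ i))" for j
      by (intro smooth_upto_mult smooth_upto_const Suc.IH h')
    ultimately show ?case using der[OF h'(2)] unfolding smooth_upto.simps differentiable_def by metis }
qed

text \<open>
  The functions \<open>P(1/t) exp(-1/t)\<close> for \<open>t > 0\<close>, extended by 0. As \<open>P\<close>
  ranges over all polynomials this class is closed under differentiation, and \<open>flat 1\<close> is the
  classical smooth function vanishing for \<open>t \<le> 0\<close>.
\<close>

definition flat :: "real poly \<Rightarrow> real \<Rightarrow> real" where
  "flat P t = (if 0 < t then poly P (1 / t) * exp (- 1 / t) else 0)"

text \<open>
  Used with \<open>y = 1 / h\<close> for the derivative of \<open>flat\<close> at 0; the power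
  \<open>y ^ k\<close> is there for the induction.
\<close>

lemma poly_exp_limit: "((\<lambda>y. y ^ k * poly P y / exp y) \<longlongrightarrow> (0::real)) at_top"
proof (induction P arbitrary: k)
  case (pCons a P)
  have "((\<lambda>y. a * (y ^ k / exp y) + y ^ Suc k * poly P y / exp y) \<longlongrightarrow> a * 0 + 0) at_top"
    by (intro tendsto_intros tendsto_power_div_exp_0 pCons.IH)
  moreover have "a * (y ^ k / exp y) + y ^ Suc k * poly P y / exp y = y ^ k * poly (pCons a P) y / exp y" for y
    by (simp add: field_simps)
  ultimately show ?case by simp
qed simp

lemma flat_derivative:
  "(flat P has_real_derivative flat (monom 1 2 * (P - pderiv P)) t) (at t)"
proof -
  consider "t < 0" | "t = 0" | "t > 0" by linarith
  then show ?thesis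
  proof cases
    case 1
    have "((\<lambda>_. 0) has_real_derivative 0) (at t)" by simp
    then have "(flat P has_real_derivative 0) (at t)"
      by (rule has_field_derivative_transform_within_open[where S = "{..<0}"]) (use 1 in \<open>auto simp: flat_def\<close>)
    then show ?thesis using 1 by (simp add: flat_def)
  next
    case 2
    have lim: "((\<lambda>h. poly P (1 / h) * exp (- 1 / h) / h) \<longlongrightarrow> 0) (at_right (0::real))"
    proof -
      have "((\<lambda>y. y ^ 1 * poly P y / exp y) \<longlongrightarrow> (0::real)) at_top" by (rule poly_exp_limit)
      then have "((\<lambda>h. (inverse h) ^ 1 * poly P (inverse h) / exp (inverse h)) \<longlongrightarrow> 0) (at_right (0::real))"
        by (rule filterlim_compose[OF _ filterlim_inverse_at_top_right])
      then show ?thesis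
        by (rule tendsto_cong[THEN iffD1, rotated]) (simp add: divide_simps exp_minus inverse_eq_divide)
    qed
    have "((\<lambda>h. flat P h / h) \<longlongrightarrow> 0) (at 0)"
    proof (rule filterlim_split_at)
      have "eventually (\<lambda>h. flat P h / h = 0) (at_left 0)"
        by (auto simp: eventually_at_filter flat_def)
      then show "((\<lambda>h. flat P h / h) \<longlongrightarrow> 0) (at_left 0)" by (rule tendsto_eventually)
      have "eventually (\<lambda>h. poly P (1 / h) * exp (- 1 / h) / h = flat P h / h) (at_right 0)"
        by (auto simp: eventually_at_filter flat_def)
      then show "((\<lambda>h. flat P h / h) \<longlongrightarrow> 0) (at_right 0)"
        using lim by (rule tendsto_cong[THEN iffD1])
    qed
    then show ?thesis using 2 by (simp add: has_field_derivative_iff flat_def)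
  next
    case 3
    have "((\<lambda>t. poly P (1 / t) * exp (- 1 / t)) has_real_derivative
       poly (pderiv P) (1 / t) * (- 1 / t\<^sup>2) * exp (- 1 / t) + poly P (1 / t) * (exp (- 1 / t) * (1 / t\<^sup>2))) (at t)"
      using 3 by (auto intro!: derivative_eq_intros DERIV_chain'[OF _ poly_DERIV] simp: power2_eq_square)
    moreover have "poly (pderiv P) (1 / t) * (- 1 / t\<^sup>2) * exp (- 1 / t) + poly P (1 / t) * (exp (- 1 / t) * (1 / t\<^sup>2))
       = flat (monom 1 2 * (P - pderiv P)) t"
      using 3 by (simp add: flat_def poly_monom field_simps)
    ultimately have "((\<lambda>t. poly P (1 / t) * exp (- 1 / t)) has_real_derivative flat (monom 1 2 * (P - pderiv P)) t) (at t)"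
      by simp
    then show ?thesis
      by (rule has_field_derivative_transform_within_open[where S = "{0<..}"]) (use 3 in \<open>auto simp: flat_def\<close>)
  qed
qed

text \<open>
  Smooth functions that tend to the indicator of \<open>box a b\<close> as \<open>k\<close> grows, because
  \<open>exp (- 1 / (k t))\<close> tends to 1 for every \<open>t > 0\<close>.
\<close>

definition bump :: "real ^ 'n \<Rightarrow> real ^ 'n \<Rightarrow> nat \<Rightarrow> real ^ 'n \<Rightarrow> real" where
  "bump a b k x = (\<Prod>i\<in>UNIV. flat 1 (real k * (x $ i - a $ i)) * flat 1 (real k * (b $ i - x $ i)))"

lemma flat_1_bounds: "0 \<le> flat 1 t" "flat 1 t \<le> 1"
  by (auto simp: flat_def)

lemma bump_nonneg: "0 \<le> bump a b k x"
  unfolding bump_def by (intro prod_nonneg) (simp add: flat_1_bounds)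

lemma bump_le_1: "bump a b k x \<le> 1"
  unfolding bump_def by (intro prod_le_1) (simp add: flat_1_bounds mult_le_one)

lemma bump_outside:
  assumes "x \<notin> box a b" shows "bump a b k x = 0"
proof -
  obtain i where "x $ i \<le> a $ i \<or> b $ i \<le> x $ i"
    using assms by (auto simp: mem_box_cart not_less)
  then have "flat 1 (real k * (x $ i - a $ i)) * flat 1 (real k * (b $ i - x $ i)) = 0"
    by (auto simp: flat_def zero_less_mult_iff)
  then show ?thesis unfolding bump_def by (intro prod_zero) auto
qed

lemma bump_limit: "(\<lambda>k. bump a b k x) \<longlonglongrightarrow> indicator (box a b) x"
proof (cases "x \<in> box a b")
  case True
  have lim: "(\<lambda>k. flat 1 (real k * t)) \<longlonglongrightarrow> 1" if "0 < t" for t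
  proof -
    have "(\<lambda>k. exp (- 1 / (real k * t))) \<longlonglongrightarrow> exp (- 0)"
    proof (intro tendsto_exp)
      have "(\<lambda>k. (- 1 / t) * (1 / real k)) \<longlonglongrightarrow> (- 1 / t) * 0"
        by (intro tendsto_mult tendsto_const lim_1_over_n)
      then show "(\<lambda>k. - 1 / (real k * t)) \<longlonglongrightarrow> - 0" by (simp add: mult.commute)
    qed
    moreover have "eventually (\<lambda>k. exp (- 1 / (real k * t)) = flat 1 (real k * t)) sequentially"
      using eventually_gt_at_top[of 0] by eventually_elim (use that in \<open>auto simp: flat_def\<close>)
    ultimately show ?thesis by (auto intro: tendsto_cong[THEN iffD1])
  qed
  have "(\<lambda>k. bump a b k x) \<longlonglongrightarrow> (\<Prod>i\<in>(UNIV::'a set). 1 * 1)"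
    unfolding bump_def using True by (intro tendsto_prod tendsto_mult lim) (auto simp: mem_box_cart)
  then show ?thesis using True by simp
qed (simp add: bump_outside)

lemma test_function_bump: "test_function (bump a b k)"
proof -
  let ?H = "range flat"
  have H: "\<exists>h'\<in>?H. \<forall>t. (h has_real_derivative h' t) (at t)" if "h \<in> ?H" for h
    using that flat_derivative by blast
  have "smooth_upto n (bump a b k)" for n
  proof -
    have *: "smooth_upto n (\<lambda>x. flat 1 (c * x $ i + d))" for c d and i :: 'a
      by (rule smooth_upto_coordinate[of ?H, OF H]) auto
    have "smooth_upto n (\<lambda>x. \<Prod>i\<in>UNIV. flat 1 (real k * x $ i + (- real k * a $ i)) * flat 1 ((- real k) * x $ i + real k * b $ i))"
      by (intro smooth_upto_prod smooth_upto_mult *) auto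
    also have "(\<lambda>x. \<Prod>i\<in>UNIV. flat 1 (real k * x $ i + (- real k * a $ i)) * flat 1 ((- real k) * x $ i + real k * b $ i)) = bump a b k"
      by (rule ext) (simp add: bump_def algebra_simps)
    finally show ?thesis .
  qed
  then have "\<forall>is. partials is (bump a b k) differentiable_on UNIV"
    using smooth_upto_partials by (auto simp: differentiable_on_def)
  moreover have "closure {x. bump a b k x \<noteq> 0} \<subseteq> cbox a b"
    using bump_outside box_subset_cbox by (intro closure_minimal) blast+
  then have "compact (closure {x. bump a b k x \<noteq> 0})"
    by (meson bounded_cbox bounded_subset closed_closure compact_eq_bounded_closed)
  ultimately show ?thesis by (simp add: test_function_def)
qed

lemma bump_measurable [measurable]: "bump a b k \<in> borel_measurable borel"
proof -
  have "flat 1 \<in> borel_measurable borel"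
    using flat_derivative by (intro borel_measurable_continuous_onI continuous_at_imp_continuous_on) (metis DERIV_isCont)
  then have [measurable]: "flat 1 \<in> borel_measurable borel" .
  show ?thesis unfolding bump_def by measurable
qed

text \<open>
  Testing against \<open>bump\<close> and passing to the limit shows that \<open>u\<close> integrates to 0 over
  every box; the Lebesgue differentiation theorem then gives \<open>u x = 0\<close> at almost every point.
\<close>

lemma weak_zero_imp_AE_zero:
  fixes u :: "real ^ 'n \<Rightarrow> real"
  assumes u: "locally_integrable u"
    and zero: "\<And>\<phi>. test_function \<phi> \<Longrightarrow> (\<integral>x. u x * \<phi> x \<partial>lebesgue) = 0"
  shows "AE x in lebesgue. u x = 0"
proof -
  have ai: "u absolutely_integrable_on cbox a b" for a b
    using u by (auto simp: locally_integrable_def)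
  have int0: "integral (cbox a b) u = 0" for a b
  proof -
    have "u absolutely_integrable_on box a b"
      using ai[of a b] by (rule set_integrable_subset) (auto simp: box_subset_cbox)
    then have i: "integrable lebesgue (\<lambda>x. u x * indicator (box a b) x)"
      by (simp add: set_integrable_def mult.commute)
    have ic: "integrable lebesgue (\<lambda>x. u x * indicator (cbox a b) x)"
      using ai[of a b] by (simp add: set_integrable_def mult.commute)
    have eq: "u x * bump a b k x = (u x * indicator (box a b) x) * bump a b k x" for k x
      by (cases "x \<in> box a b") (auto simp: bump_outside)
    have "(\<lambda>k. \<integral>x. u x * bump a b k x \<partial>lebesgue) \<longlonglongrightarrow> (\<integral>x. u x * indicator (box a b) x \<partial>lebesgue)"
    proof (rule integral_dominated_convergence[where w = "\<lambda>x. \<bar>u x * indicator (box a b) x\<bar>"])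
      show "(\<lambda>x. u x * indicator (box a b) x) \<in> borel_measurable lebesgue"
        using i by (rule borel_measurable_integrable)
      show "(\<lambda>x. u x * bump a b k x) \<in> borel_measurable lebesgue" for k
        unfolding eq by (intro borel_measurable_times[OF borel_measurable_integrable[OF i]] measurable_completion) simp
      show "integrable lebesgue (\<lambda>x. \<bar>u x * indicator (box a b) x\<bar>)" using i by simp
      show "AE x in lebesgue. (\<lambda>k. u x * bump a b k x) \<longlonglongrightarrow> u x * indicator (box a b) x"
        by (intro always_eventually allI tendsto_mult tendsto_const bump_limit)
      show "AE x in lebesgue. norm (u x * bump a b k x) \<le> \<bar>u x * indicator (box a b) x\<bar>" for k
        unfolding eq using bump_nonneg[of a b k] bump_le_1[of a b k]
        by (intro always_eventually allI) (simp add: abs_mult mult_left_le)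
    qed
    moreover have "(\<integral>x. u x * bump a b k x \<partial>lebesgue) = 0" for k
      by (intro zero test_function_bump)
    ultimately have "(\<integral>x. u x * indicator (box a b) x \<partial>lebesgue) = 0"
      by (simp add: LIMSEQ_const_iff)
    then have "(\<integral>x\<in>box a b. u x \<partial>lebesgue) = 0"
      by (simp add: set_lebesgue_integral_def mult.commute)
    then have "integral (box a b) u = 0"
      using set_lebesgue_integral_eq_integral(2)[OF \<open>u absolutely_integrable_on box a b\<close>] by simp
    then show ?thesis by (simp add: integral_open_interval)
  qed
  have "u integrable_on cbox a b" for a b
    using ai set_lebesgue_integral_eq_integral(1) by blast
  from integrable_ccontinuous_explicit[OF this] obtain N where N: "negligible N"
    "\<And>x e. \<lbrakk>x \<notin> N; 0 < e\<rbrakk> \<Longrightarrow> \<exists>d>0. \<forall>h. 0 < h \<and> h < d \<longrightarrow>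
        norm (integral (cbox x (x + h *\<^sub>R One)) u /\<^sub>R h ^ DIM(real^'n) - u x) < e"
    by blast
  have "u x = 0" if x: "x \<notin> N" for x
  proof (rule ccontr)
    assume "u x \<noteq> 0"
    then obtain d where "d > 0" "\<forall>h. 0 < h \<and> h < d \<longrightarrow>
        norm (integral (cbox x (x + h *\<^sub>R One)) u /\<^sub>R h ^ DIM(real^'n) - u x) < \<bar>u x\<bar>"
      using N(2)[OF x, of "\<bar>u x\<bar>"] by auto
    then show False by (auto simp: int0 dest: spec[of _ "d/2"])
  qed
  then show ?thesis using N(1) by (auto simp: negligible_iff_null_sets intro!: AE_I'[of N])
qed

lemma partials_Cons: "partials (i # is) f = partial i (partials is f)"
  by (simp add: partials_def)

text \<open>
  The complement of the closed support is open, so all derivatives vanish there too.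
\<close>

lemma test_function_support:
  assumes "test_function \<phi>"
  obtains C where "compact C" "\<And>is x. x \<notin> C \<Longrightarrow> partials is \<phi> x = 0"
proof
  let ?C = "closure {x. \<phi> x \<noteq> 0}"
  show "compact ?C" using assms by (simp add: test_function_def)
  show "partials is \<phi> x = 0" if "x \<notin> ?C" for "is" x
    using that
  proof (induction "is" arbitrary: x)
    case Nil
    then show ?case using closure_subset by (force simp: partials_def)
  next
    case (Cons i "is")
    have "((\<lambda>_. 0) has_derivative (\<lambda>_. 0)) (at x)" by simp
    then have "(partials is \<phi> has_derivative (\<lambda>_. 0)) (at x)"
      by (rule has_derivative_transform_within_open[where s = "- ?C"]) (use Cons in auto)
    then show ?case by (simp add: partials_Cons partial_eq)
  qed
qed

lemma test_function_continuous:
  assumes "test_function \<phi>"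
  shows "continuous_on UNIV (partials is \<phi>)"
  using assms by (auto simp: test_function_def intro: differentiable_imp_continuous_on)

lemma test_function_bounded:
  assumes "test_function \<phi>"
  obtains B where "\<And>x. \<bar>partials is \<phi> x\<bar> \<le> B" "0 \<le> B"
proof -
  obtain C where C: "compact C" "\<And>is x. x \<notin> C \<Longrightarrow> partials is \<phi> x = 0"
    using test_function_support[OF assms] by metis
  have "bounded (partials is \<phi> ` C)"
    using compact_continuous_image[OF continuous_on_subset[OF test_function_continuous[OF assms]] C(1)]
    by (auto intro: compact_imp_bounded)
  then obtain B where "B > 0" "\<forall>y\<in>partials is \<phi> ` C. norm y \<le> B" by (auto simp: bounded_pos)
  then have "\<bar>partials is \<phi> x\<bar> \<le> B" for x using C(2)[of x "is"] by (cases "x \<in> C") auto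
  then show thesis using that[of B] \<open>B > 0\<close> by auto
qed

lemma test_function_measurable:
  assumes "test_function \<phi>"
  shows "partials is \<phi> \<in> borel_measurable borel"
  using test_function_continuous[OF assms] by (rule borel_measurable_continuous_onI)

lemma locally_integrable_times_test:
  assumes h: "locally_integrable h" and \<phi>: "test_function \<phi>"
  shows "integrable lebesgue (\<lambda>x. h x * partials is \<phi> x)"
proof -
  obtain C where C: "compact C" "\<And>is x. x \<notin> C \<Longrightarrow> partials is \<phi> x = 0"
    using test_function_support[OF \<phi>] by metis
  obtain B where B: "\<And>x. \<bar>partials is \<phi> x\<bar> \<le> B" "0 \<le> B"
    using test_function_bounded[OF \<phi>] by metis
  have i: "integrable lebesgue (\<lambda>x. indicator C x * h x)"
    using h C(1) by (auto simp: locally_integrable_def set_integrable_def)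
  have "integrable lebesgue (\<lambda>x. (indicator C x * h x) * partials is \<phi> x)"
  proof (rule Bochner_Integration.integrable_bound)
    show "integrable lebesgue (\<lambda>x. B * (indicator C x * h x))" using i by simp
    show "(\<lambda>x. (indicator C x * h x) * partials is \<phi> x) \<in> borel_measurable lebesgue"
      by (intro borel_measurable_times[OF borel_measurable_integrable[OF i]] measurable_completion)
        (simp add: test_function_measurable[OF \<phi>])
    show "AE x in lebesgue. norm ((indicator C x * h x) * partials is \<phi> x) \<le> norm (B * (indicator C x * h x))"
      using B by (intro always_eventually allI) (auto simp: abs_mult indicator_def mult.commute[of "\<bar>h _\<bar>"] intro!: mult_right_mono)
  qed
  moreover have "(indicator C x * h x) * partials is \<phi> x = h x * partials is \<phi> x" for x
    using C(2)[of x "is"] by (auto simp: indicator_def)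
  ultimately show ?thesis by simp
qed

text \<open>
  The arbitrary representative chosen by \<open>weak_partials\<close> therefore agrees almost everywhere with the
  \<open>L\<^sup>p\<close> derivative that membership in the Sobolev space provides.
\<close>

lemma weak_partials_unique:
  assumes f: "has_weak_partials f is g" and g: "has_weak_partials f is g'"
  shows "AE x in lebesgue. g x = g' x"
proof -
  have li: "locally_integrable (\<lambda>x. g x - g' x)"
    using f g by (auto simp: has_weak_partials_def locally_integrable_def intro: set_integral_diff(1))
  have "AE x in lebesgue. g x - g' x = 0"
  proof (rule weak_zero_imp_AE_zero[OF li])
    fix \<phi> :: "real ^ 'a \<Rightarrow> real" assume \<phi>: "test_function \<phi>"
    have int: "integrable lebesgue (\<lambda>x. h x * \<phi> x)" if h: "locally_integrable h" for h
      using locally_integrable_times_test[OF h \<phi>, of "[]"] by (simp add: partials_def)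
    have "(- 1) ^ length is * (\<integral>x. g x * \<phi> x \<partial>lebesgue) = (- 1) ^ length is * (\<integral>x. g' x * \<phi> x \<partial>lebesgue)"
      using f g \<phi> unfolding has_weak_partials_def by metis
    then have "(\<integral>x. g x * \<phi> x \<partial>lebesgue) = (\<integral>x. g' x * \<phi> x \<partial>lebesgue)" by simp
    then show "(\<integral>x. (g x - g' x) * \<phi> x \<partial>lebesgue) = 0"
      using f g by (simp add: left_diff_distrib int has_weak_partials_def)
  qed
  then show ?thesis by eventually_elim simp
qed

section \<open>The Peano kernel of the m-th difference\<close>

text \<open>
  Pascal's rule: an \<open>(m + 1)\<close>-st difference is an \<open>m\<close>-th difference of first
  differences.
\<close>

lemma alternating_sum_Suc:
  fixes F :: "nat \<Rightarrow> real"
  shows "(\<Sum>j\<le>Suc m. (- 1) ^ j * real (Suc m choose j) * F j)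
    = (\<Sum>j\<le>m. (- 1) ^ j * real (m choose j) * (F j - F (Suc j)))"
proof -
  have 1: "(\<Sum>j\<le>m. (- 1) ^ j * real (m choose j) * F j)
     = F 0 + (\<Sum>j\<le>m. (- 1) ^ Suc j * real (m choose Suc j) * F (Suc j))"
    using sum.atMost_Suc_shift[of "\<lambda>j. (- 1) ^ j * real (m choose j) * F j" m] by (simp add: binomial_eq_0)
  have "(\<Sum>j\<le>Suc m. (- 1) ^ j * real (Suc m choose j) * F j)
     = F 0 + (\<Sum>j\<le>m. (- 1) ^ Suc j * real (m choose Suc j) * F (Suc j))
        - (\<Sum>j\<le>m. (- 1) ^ j * real (m choose j) * F (Suc j))"
  proof -
    have "(- 1) ^ Suc j * real (Suc m choose Suc j) * F (Suc j)
      = (- 1) ^ Suc j * real (m choose Suc j) * F (Suc j) - (- 1) ^ j * real (m choose j) * F (Suc j)" for j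
      by (simp add: algebra_simps)
    then show ?thesis by (subst sum.atMost_Suc_shift) (simp add: sum_subtractf)
  qed
  also have "\<dots> = (\<Sum>j\<le>m. (- 1) ^ j * real (m choose j) * (F j - F (Suc j)))"
    unfolding 1[symmetric] by (simp add: right_diff_distrib sum_subtractf)
  finally show ?thesis .
qed

lemma integrable_bounded_support:
  fixes f :: "'a::euclidean_space \<Rightarrow> real"
  assumes [measurable]: "f \<in> borel_measurable borel"
    and B: "\<And>x. \<bar>f x\<bar> \<le> B" and S: "\<And>x. x \<notin> cbox a b \<Longrightarrow> f x = 0"
  shows "integrable lborel f"
proof (rule Bochner_Integration.integrable_bound)
  show "integrable lborel (\<lambda>x. B * indicator (cbox a b) x :: real)"
    by (intro integrable_mult_right integrable_real_indicator emeasure_lborel_cbox_finite) simp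
  show "AE x in lborel. norm (f x) \<le> norm (B * indicator (cbox a b) x :: real)"
    using B S by (intro always_eventually allI) (auto simp: indicator_def abs_le_iff intro: order_trans[OF _ abs_ge_self])
qed auto

text \<open>
  Fubini's theorem, for the step that convolves a kernel with the indicator of the unit interval.
\<close>

lemma box_spline_convolution:
  fixes b \<psi> :: "real \<Rightarrow> real" and M :: real
  assumes [measurable]: "b \<in> borel_measurable borel"
    and b: "\<And>s. 0 \<le> b s" "\<And>s. b s \<le> 1" "\<And>s. s \<notin> {0..M} \<Longrightarrow> b s = 0"
    and \<psi>: "continuous_on UNIV \<psi>"
  shows "(\<integral>s. b s * (\<integral>t. indicator {0..1} t * \<psi> (s + t) \<partial>lborel) \<partial>lborel)
    = (\<integral>r. (\<integral>t. b (r - t) * indicator {0..1} t \<partial>lborel) * \<psi> r \<partial>lborel)"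
proof -
  have [measurable]: "\<psi> \<in> borel_measurable borel" using \<psi> by (rule borel_measurable_continuous_onI)
  have "bounded (\<psi> ` {0..M+1})"
    using compact_continuous_image[OF continuous_on_subset[OF \<psi>], of "{0..M+1}"] by (auto intro: compact_imp_bounded)
  then obtain C where C: "C > 0" "\<And>r. 0 \<le> r \<Longrightarrow> r \<le> M + 1 \<Longrightarrow> \<bar>\<psi> r\<bar> \<le> C"
    by (auto simp: bounded_pos)
  have i1: "integrable (lborel \<Otimes>\<^sub>M lborel) (\<lambda>(s, t). b s * (indicator {0..1} t * \<psi> (s + t)))"
    unfolding lborel_prod
  proof (rule integrable_bounded_support[where B = C and a = "(0, 0)" and b = "(M, 1)"])
    fix z :: "real \<times> real"
    show "\<bar>case z of (s, t) \<Rightarrow> b s * (indicator {0..1} t * \<psi> (s + t))\<bar> \<le> C"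
    proof (cases "fst z \<in> {0..M} \<and> snd z \<in> {0..1}")
      case True
      then have "b (fst z) * \<bar>\<psi> (fst z + snd z)\<bar> \<le> 1 * C" using b C by (intro mult_mono) auto
      then show ?thesis using True b by (auto simp: abs_mult case_prod_beta)
    qed (use b C in \<open>auto simp: case_prod_beta\<close>)
    show "z \<notin> cbox (0, 0) (M, 1) \<Longrightarrow> (case z of (s, t) \<Rightarrow> b s * (indicator {0..1} t * \<psi> (s + t))) = 0"
      using b(3)[of "fst z"] by (cases z) (auto simp: cbox_Pair_eq indicator_def split: if_splits)
  qed (simp add: borel_prod[symmetric])
  have i2: "integrable (lborel \<Otimes>\<^sub>M lborel) (\<lambda>(r, t). b (r - t) * indicator {0..1} t * \<psi> r)"
    unfolding lborel_prod
  proof (rule integrable_bounded_support[where B = C and a = "(0, 0)" and b = "(M + 1, 1)"])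
    fix z :: "real \<times> real"
    show "\<bar>case z of (r, t) \<Rightarrow> b (r - t) * indicator {0..1} t * \<psi> r\<bar> \<le> C"
    proof (cases "fst z - snd z \<in> {0..M} \<and> snd z \<in> {0..1}")
      case True
      then have "b (fst z - snd z) * \<bar>\<psi> (fst z)\<bar> \<le> 1 * C" using b C by (intro mult_mono) auto
      then show ?thesis using True b by (auto simp: abs_mult case_prod_beta)
    qed (use b C in \<open>auto simp: case_prod_beta\<close>)
    show "z \<notin> cbox (0, 0) (M + 1, 1) \<Longrightarrow> (case z of (r, t) \<Rightarrow> b (r - t) * indicator {0..1} t * \<psi> r) = 0"
      using b(3)[of "fst z - snd z"] by (cases z) (auto simp: cbox_Pair_eq indicator_def split: if_splits)
  qed (simp add: borel_prod[symmetric])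
  have "(\<integral>s. b s * (\<integral>t. indicator {0..1} t * \<psi> (s + t) \<partial>lborel) \<partial>lborel)
     = (\<integral>s. \<integral>t. b s * (indicator {0..1} t * \<psi> (s + t)) \<partial>lborel \<partial>lborel)"
    by simp
  also have "\<dots> = (\<integral>t. \<integral>s. b s * (indicator {0..1} t * \<psi> (s + t)) \<partial>lborel \<partial>lborel)"
    using lborel_pair.Fubini_integral[OF i1] by simp
  also have "\<dots> = (\<integral>t. \<integral>r. b (r - t) * indicator {0..1} t * \<psi> r \<partial>lborel \<partial>lborel)"
  proof (rule Bochner_Integration.integral_cong[OF refl])
    fix t :: real
    show "(\<integral>s. b s * (indicator {0..1} t * \<psi> (s + t)) \<partial>lborel) = (\<integral>r. b (r - t) * indicator {0..1} t * \<psi> r \<partial>lborel)"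
      by (subst (2) lborel_integral_real_affine[where c = 1 and t = t]) (auto simp: ac_simps)
  qed
  also have "\<dots> = (\<integral>r. \<integral>t. b (r - t) * indicator {0..1} t * \<psi> r \<partial>lborel \<partial>lborel)"
    using lborel_pair.Fubini_integral[OF i2] by simp
  finally show ?thesis by simp
qed

text \<open>
  The kernel constructed below is the cardinal B-spline of order \<open>m\<close>, the \<open>m\<close>-fold
  convolution of the indicator of \<open>{0..1}\<close>. The sign \<open>(- 1) ^ m\<close> appears because the
  alternating sum gives \<open>\<psi> 0 0\<close> the sign plus, unlike the forward difference. The functions
  \<open>\<psi> j\<close> are the successive derivatives of \<open>\<psi> 0\<close>.
\<close>

definition peano_kernel :: "nat \<Rightarrow> (real \<Rightarrow> real) \<Rightarrow> bool" where
  "peano_kernel m b \<longleftrightarrow> b \<in> borel_measurable borel \<and> (\<forall>s. 0 \<le> b s \<and> b s \<le> 1) \<and>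
     (\<forall>s. s \<notin> {0..real m} \<longrightarrow> b s = 0) \<and> (\<integral>s. b s \<partial>lborel) = 1 \<and>
     (\<forall>\<psi>. (\<forall>j<m. \<forall>s. (\<psi> j has_real_derivative \<psi> (Suc j) s) (at s)) \<and> continuous_on UNIV (\<psi> m) \<longrightarrow>
        (\<Sum>j\<le>m. (- 1) ^ j * real (m choose j) * \<psi> 0 (real j)) = (- 1) ^ m * (\<integral>s. b s * \<psi> m s \<partial>lborel))"

lemma ftc_unit:
  fixes \<psi> :: "real \<Rightarrow> real"
  assumes "\<And>s. (\<Psi> has_real_derivative \<psi> s) (at s)" "continuous_on UNIV \<psi>"
  shows "(\<integral>t. indicator {0..1} t * \<psi> (s + t) \<partial>lborel) = \<Psi> (s + 1) - \<Psi> s"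
proof -
  have "(\<integral>t. \<psi> (s + t) * indicator {0..1} t \<partial>lborel) = \<Psi> (s + 1) - \<Psi> (s + 0)"
  proof (rule integral_FTC_Icc_real)
    show "((\<lambda>t. \<Psi> (s + t)) has_real_derivative \<psi> (s + t)) (at t)" for t
    proof -
      have "((\<lambda>t. s + t) has_real_derivative 1) (at t)" by (auto intro!: derivative_eq_intros)
      from DERIV_chain2[OF assms(1) this] show ?thesis by simp
    qed
    show "isCont (\<lambda>t. \<psi> (s + t)) t" for t
    proof (rule isCont_o2[where g = \<psi>])
      show "isCont (\<lambda>t. s + t) t" by (intro continuous_intros)
      show "isCont \<psi> (s + t)" using assms(2) by (auto simp: continuous_on_eq_continuous_at)
    qed
  qed simp
  then show ?thesis by (simp add: mult.commute)
qed

text \<open>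
  Induction on \<open>m\<close>. By \<open>alternating_sum_Suc\<close> the sum for \<open>m + 1\<close> is the sum
  for \<open>m\<close> of \<open>\<xi> s = \<psi> s - \<psi> (s + 1)\<close>. The \<open>m\<close>-th
  derivative of \<open>\<xi>\<close> is minus the integral of the \<open>(m + 1)\<close>-st derivative of
  \<open>\<psi>\<close> over the interval from \<open>s\<close> to \<open>s + 1\<close>, and this integration is
  moved onto the kernel.
\<close>

lemma peano_kernel_exists:
  assumes "1 \<le> m" shows "\<exists>b. peano_kernel m b"
  using assms
proof (induction m rule: dec_induct)
  case base
  have "peano_kernel 1 (indicator {0..1})"
    unfolding peano_kernel_def
  proof (intro conjI allI impI; (elim conjE)?)
    fix \<psi> :: "nat \<Rightarrow> real \<Rightarrow> real"
    assume 1: "\<forall>j<1. \<forall>s. (\<psi> j has_real_derivative \<psi> (Suc j) s) (at s)" "continuous_on UNIV (\<psi> 1)"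
    then have "(\<integral>t. indicator {0..1} t * \<psi> 1 (0 + t) \<partial>lborel) = \<psi> 0 (0 + 1) - \<psi> 0 0"
      by (intro ftc_unit) auto
    then show "(\<Sum>j\<le>1. (- 1) ^ j * real (1 choose j) * \<psi> 0 (real j)) = (- 1) ^ 1 * (\<integral>s. indicator {0..1} s * \<psi> 1 s \<partial>lborel)"
      by simp
  qed (auto simp: indicator_def)
  then show ?case by blast
next
  case (step m)
  then obtain b where b: "peano_kernel m b" by blast
  have [measurable]: "b \<in> borel_measurable borel" using b by (simp add: peano_kernel_def)
  have b01: "0 \<le> b s" "b s \<le> 1" "s \<notin> {0..real m} \<Longrightarrow> b s = 0" and b1: "(\<integral>s. b s \<partial>lborel) = 1" for s
    using b by (auto simp: peano_kernel_def)
  define b' where "b' r = (\<integral>t. b (r - t) * indicator {0..1} t \<partial>lborel)" for r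
  have conv: "(\<integral>s. b s * (\<integral>t. indicator {0..1} t * \<psi> (s + t) \<partial>lborel) \<partial>lborel) = (\<integral>r. b' r * \<psi> r \<partial>lborel)"
    if "continuous_on UNIV \<psi>" for \<psi>
    unfolding b'_def by (rule box_spline_convolution[where M = "real m"]) (use b01 that in auto)
  have "peano_kernel (Suc m) b'"
    unfolding peano_kernel_def
  proof (intro conjI allI impI; (elim conjE)?)
    show "b' \<in> borel_measurable borel" unfolding b'_def by measurable
    have i: "integrable lborel (\<lambda>t. b (r - t) * indicator {0..1} t)" for r
      by (rule integrable_bounded_support[where B = 1 and a = 0 and b = 1])
        (use b01 in \<open>auto simp: indicator_def abs_le_iff intro: order_trans[of _ 0]\<close>)
    show "0 \<le> b' r" for r unfolding b'_def using b01 by (intro integral_nonneg_AE) auto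
    have "b' r \<le> (\<integral>t. indicator {0..1::real} t \<partial>lborel)" for r
      
      unfolding b'_def
    proof (rule Bochner_Integration.integral_mono)
      show "integrable lborel (\<lambda>t. b (r - t) * indicator {0..1} t)" by (rule i)
      show "integrable lborel (\<lambda>t. indicator {0..1::real} t :: real)" by simp
    qed (use b01 in \<open>auto simp: indicator_def\<close>)
    then show "b' r \<le> 1" for r by simp
    show "b' r = 0" if "r \<notin> {0..real (Suc m)}" for r
    proof -
      have "b (r - t) * indicator {0..1} t = 0" for t using that by (auto simp: indicator_def intro!: b01(3))
      then show ?thesis unfolding b'_def by (simp only: Bochner_Integration.integral_zero)
    qed
    show "(\<integral>r. b' r \<partial>lborel) = 1" using conv[of "\<lambda>_. 1"] b1 by simp
    fix \<psi> :: "nat \<Rightarrow> real \<Rightarrow> real"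
    assume der: "\<forall>j<Suc m. \<forall>s. (\<psi> j has_real_derivative \<psi> (Suc j) s) (at s)" and cont: "continuous_on UNIV (\<psi> (Suc m))"
    define \<xi> where "\<xi> j s = \<psi> j s - \<psi> j (s + 1)" for j s
    have "(\<xi> j has_real_derivative \<xi> (Suc j) s) (at s)" if "j < Suc m" for j s
      unfolding \<xi>_def using der that DERIV_shift[of "\<psi> j" "\<psi> (Suc j) (s + 1)" s 1]
      by (intro DERIV_diff) auto
    moreover from this[of m] have "continuous_on UNIV (\<xi> m)"
      by (intro continuous_at_imp_continuous_on ballI DERIV_isCont) auto
    ultimately have fd: "(\<Sum>j\<le>m. (- 1) ^ j * real (m choose j) * \<xi> 0 (real j)) = (- 1) ^ m * (\<integral>s. b s * \<xi> m s \<partial>lborel)"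
      using b unfolding peano_kernel_def by auto
    have xi: "\<xi> m s = - (\<integral>t. indicator {0..1} t * \<psi> (Suc m) (s + t) \<partial>lborel)" for s
      using ftc_unit[of "\<psi> m" "\<psi> (Suc m)" s] der cont by (simp add: \<xi>_def)
    note fd
    also have "(\<integral>s. b s * \<xi> m s \<partial>lborel) = (\<integral>s. b s * - (\<integral>t. indicator {0..1} t * \<psi> (Suc m) (s + t) \<partial>lborel) \<partial>lborel)"
      by (simp only: xi)
    also have "(\<integral>s. b s * - (\<integral>t. indicator {0..1} t * \<psi> (Suc m) (s + t) \<partial>lborel) \<partial>lborel) = - (\<integral>r. b' r * \<psi> (Suc m) r \<partial>lborel)"
      using conv[OF cont] by simp
    also have "(\<Sum>j\<le>m. (- 1) ^ j * real (m choose j) * \<xi> 0 (real j)) = (\<Sum>j\<le>Suc m. (- 1) ^ j * real (Suc m choose j) * \<psi> 0 (real j))"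
      unfolding alternating_sum_Suc[of m "\<lambda>j. \<psi> 0 (real j)"] by (simp add: \<xi>_def add.commute)
    finally show "(\<Sum>j\<le>Suc m. (- 1) ^ j * real (Suc m choose j) * \<psi> 0 (real j)) = (- 1) ^ Suc m * (\<integral>s. b' s * \<psi> (Suc m) s \<partial>lborel)"
      by simp
  qed
  then show ?case by blast
qed

section \<open>Differences as averages of the weak derivative\<close>

lemma finite_lists_of_length: "finite {is :: 'n::finite list. length is = m}"
  using finite_lists_length_eq[of "UNIV :: 'n set" m] by simp

lemma sum_lists_Suc:
  fixes G :: "'n::finite list \<Rightarrow> real"
  shows "(\<Sum>is\<in>{is. length is = Suc m}. G is) = (\<Sum>i\<in>UNIV. \<Sum>is\<in>{is. length is = m}. G (i # is))"
proof -
  have "{is :: 'n list. length is = Suc m} = (\<lambda>(i, is). i # is) ` (UNIV \<times> {is. length is = m})"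
    by (auto simp: length_Suc_conv image_iff)
  then have "(\<Sum>is\<in>{is. length is = Suc m}. G is) = (\<Sum>p\<in>UNIV \<times> {is. length is = m}. G (fst p # snd p))"
    by (simp add: sum.reindex inj_on_def case_prod_beta prod_eq_iff)
  then show ?thesis by (simp add: sum.cartesian_product case_prod_beta)
qed

text \<open>
  The monomial \<open>h\<^bsub>i\<^sub>1\<^esub> \<cdots> h\<^bsub>i\<^sub>m\<^esub>\<close>, so that
  \<open>D\<^sup>m f(x)(h, \<dots>, h)\<close> is the sum over all lists \<open>is\<close> of length
  \<open>m\<close> of \<open>dir_power h is\<close> times the corresponding iterated partial derivative.
\<close>

definition dir_power :: "real ^ 'n \<Rightarrow> 'n list \<Rightarrow> real" where
  "dir_power h is = (\<Prod>i\<leftarrow>is. h $ i)"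

lemma has_derivative_partials:
  fixes f :: "real ^ 'n \<Rightarrow> real"
  assumes "f differentiable at x"
  shows "(f has_derivative (\<lambda>v. \<Sum>i\<in>UNIV. v $ i * partial i f x)) (at x)"
proof -
  let ?D = "frechet_derivative f (at x)"
  have D: "(f has_derivative ?D) (at x)" using assms by (simp add: frechet_derivative_works)
  have "?D v = (\<Sum>i\<in>UNIV. v $ i * partial i f x)" for v
  proof -
    have "?D v = ?D (\<Sum>i\<in>UNIV. v $ i *\<^sub>R axis i 1)"
      using basis_expansion[of v] by (simp add: scalar_mult_eq_scaleR)
    also have "\<dots> = (\<Sum>i\<in>UNIV. v $ i * partial i f x)"
      using has_derivative_linear[OF D] by (simp add: linear_sum linear_cmul partial_def)
    finally show ?thesis .
  qed
  then have "?D = (\<lambda>v. \<Sum>i\<in>UNIV. v $ i * partial i f x)" by (rule ext)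
  with D show ?thesis by (simp only:)
qed

lemma test_function_differentiable:
  "test_function \<phi> \<Longrightarrow> partials is \<phi> differentiable at x"
  unfolding test_function_def differentiable_on_def by blast

text \<open>
  Successive derivatives of a test function along the line \<open>y - s h\<close>, in the form required by
  \<open>peano_kernel\<close>. Each differentiation in \<open>s\<close> contributes the factor \<open>- 1\<close>.
\<close>

lemma line_derivative:
  fixes \<phi> :: "real ^ 'n \<Rightarrow> real" and h y
  assumes "test_function \<phi>"
  defines "\<psi> j s \<equiv> (- 1) ^ j * (\<Sum>is\<in>{is. length is = j}. dir_power h is * partials is \<phi> (y - s *\<^sub>R h))"
  shows "(\<psi> j has_real_derivative \<psi> (Suc j) s) (at s)"
proof -
  have 1: "((\<lambda>s. partials is \<phi> (y - s *\<^sub>R h)) has_real_derivative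
      - (\<Sum>i\<in>UNIV. h $ i * partials (i # is) \<phi> (y - s *\<^sub>R h))) (at s)" for "is" s
  proof -
    have "((\<lambda>s. y - s *\<^sub>R h) has_derivative (\<lambda>t. - t *\<^sub>R h)) (at s)"
      by (auto intro!: derivative_eq_intros)
    from has_derivative_compose[OF this has_derivative_partials[OF test_function_differentiable[OF assms(1)]]]
    show ?thesis
      unfolding has_field_derivative_def
      by (rule has_derivative_eq_rhs) (simp add: fun_eq_iff partials_Cons sum_negf sum_distrib_left mult_ac)
  qed
  have "(\<psi> j has_real_derivative (- 1) ^ j * (\<Sum>is\<in>{is. length is = j}. dir_power h is *
      - (\<Sum>i\<in>UNIV. h $ i * partials (i # is) \<phi> (y - s *\<^sub>R h)))) (at s)"
    unfolding \<psi>_def by (intro DERIV_cmult DERIV_sum 1)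
  also have "(- 1) ^ j * (\<Sum>is\<in>{is. length is = j}. dir_power h is *
      - (\<Sum>i\<in>UNIV. h $ i * partials (i # is) \<phi> (y - s *\<^sub>R h))) = \<psi> (Suc j) s"
    unfolding \<psi>_def sum_lists_Suc
    by (subst sum.swap) (simp add: dir_power_def sum_negf sum_distrib_left mult_ac)
  finally show ?thesis .
qed

lemma test_function_shift:
  assumes "test_function \<phi>"
  shows "test_function (\<lambda>x. \<phi> (x - v))" "partials is (\<lambda>x. \<phi> (x - v)) x = partials is \<phi> (x - v)"
proof -
  have *: "partials is (\<lambda>x. \<phi> (x - v)) = (\<lambda>x. partials is \<phi> (x - v))" for "is"
  proof (induction "is")
    case (Cons i "is")
    show ?case
    proof
      fix x
      have s: "((\<lambda>x. x - v) has_derivative (\<lambda>t. t)) (at x)" by (auto intro!: derivative_eq_intros)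
      from has_derivative_compose[OF s has_derivative_partials[OF test_function_differentiable[OF assms]]]
      have "((\<lambda>x. partials is \<phi> (x - v)) has_derivative (\<lambda>t. \<Sum>i\<in>UNIV. t $ i * partial i (partials is \<phi>) (x - v))) (at x)" .
      then have "partial i (\<lambda>x. partials is \<phi> (x - v)) x = (\<Sum>j\<in>UNIV. axis i 1 $ j * partial j (partials is \<phi>) (x - v))"
        by (rule partial_eq)
      also have "\<dots> = partial i (partials is \<phi>) (x - v)"
        by (simp add: axis_def if_distrib if_distribR cong: if_cong)
      finally show "partials (i # is) (\<lambda>x. \<phi> (x - v)) x = partials (i # is) \<phi> (x - v)"
        by (simp add: partials_Cons Cons)
    qed
  qed (simp add: partials_def)
  then show "partials is (\<lambda>x. \<phi> (x - v)) x = partials is \<phi> (x - v)" by simp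
  have "(\<lambda>x. partials is \<phi> (x - v)) differentiable at x" for "is" x
    by (rule differentiable_compose[where f = "partials is \<phi>" and g = "\<lambda>x. x - v"])
      (auto intro!: test_function_differentiable[OF assms])
  moreover have "compact (closure {x. \<phi> (x - v) \<noteq> 0})"
  proof -
    have "{x. \<phi> (x - v) \<noteq> 0} = (+) v ` {x. \<phi> x \<noteq> 0}"
      by (auto simp: image_iff intro!: exI[of _ "_ - v"])
    then show ?thesis
      using assms by (simp add: closure_translation compact_translation test_function_def)
  qed
  ultimately show "test_function (\<lambda>x. \<phi> (x - v))"
    unfolding test_function_def * by (auto simp: differentiable_on_def intro: differentiable_at_withinI)
qed

lemma integral_lborel_shift:
  fixes u :: "'a::euclidean_space \<Rightarrow> real"
  assumes [measurable]: "u \<in> borel_measurable borel"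
  shows "(\<integral>x. u (x + v) \<partial>lborel) = (\<integral>x. u x \<partial>lborel)"
    and "integrable lborel (\<lambda>x. u (x + v)) \<longleftrightarrow> integrable lborel u"
proof -
  have "(\<integral>x. u x \<partial>lborel) = (\<integral>x. u x \<partial>distr lborel borel ((+) v))"
    by (simp add: lborel_distr_plus)
  also have "\<dots> = (\<integral>x. u (v + x) \<partial>lborel)"
    by (rule integral_distr) auto
  finally show "(\<integral>x. u (x + v) \<partial>lborel) = (\<integral>x. u x \<partial>lborel)" by (simp add: add.commute)
  have "integrable lborel u \<longleftrightarrow> integrable (distr lborel borel ((+) v)) u"
    by (simp add: lborel_distr_plus)
  also have "\<dots> \<longleftrightarrow> integrable lborel (\<lambda>x. u (v + x))"
    by (rule integrable_distr_eq) auto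
  finally show "integrable lborel (\<lambda>x. u (x + v)) \<longleftrightarrow> integrable lborel u" by (simp add: add.commute)
qed

text \<open>
  A working form of \<open>locally_integrable\<close> for Borel functions, with integrals over balls only.
\<close>

definition loc_int :: "(real ^ 'n \<Rightarrow> real) \<Rightarrow> bool" where
  "loc_int u \<longleftrightarrow> u \<in> borel_measurable borel \<and> (\<forall>R. integrable lborel (\<lambda>x. u x * indicator (cball 0 R) x))"

lemma loc_int_measurable: "loc_int u \<Longrightarrow> u \<in> borel_measurable borel"
  by (simp add: loc_int_def)

lemma loc_int_iff:
  assumes [measurable]: "u \<in> borel_measurable borel"
  shows "loc_int u \<longleftrightarrow> locally_integrable u"
proof
  have eq: "integrable lborel (\<lambda>x. u x * indicator C x) \<longleftrightarrow> u absolutely_integrable_on C"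
    if [measurable]: "C \<in> sets borel" for C
    unfolding set_integrable_def by (subst integrable_completion) (auto simp: mult.commute)
  { assume "locally_integrable u"
    then show "loc_int u" unfolding loc_int_def locally_integrable_def using eq by auto }
  { assume u: "loc_int u"
    show "locally_integrable u"
      unfolding locally_integrable_def
    proof (intro allI impI)
      fix C :: "(real ^ 'a) set" assume C: "compact C"
      obtain R where R: "C \<subseteq> cball 0 R"
        using compact_imp_bounded[OF C] unfolding bounded_iff by (auto simp: subset_iff)
      have "u absolutely_integrable_on cball 0 R"
        using u eq[of "cball 0 R"] by (simp add: loc_int_def)
      then show "u absolutely_integrable_on C"
        using fmeasurableD[OF lmeasurable_compact[OF C]] R by (rule set_integrable_subset)
    qed }
qed

lemma loc_int_shift:
  fixes u :: "real ^ 'n \<Rightarrow> real"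
  assumes u: "loc_int u" shows "loc_int (\<lambda>x. u (x + v))"
proof -
  note loc_int_measurable[OF u, measurable]
  have [measurable]: "cball (0 :: real ^ 'n) R \<in> sets borel" for R by (rule borel_closed) simp
  have "integrable lborel (\<lambda>x. u (x + v) * indicator (cball 0 R) x)" for R
  proof (rule Bochner_Integration.integrable_bound)
    show "integrable lborel (\<lambda>x. u (x + v) * indicator (cball 0 (R + norm v)) (x + v))"
    proof (rule integral_lborel_shift(2)[of "\<lambda>x. u x * indicator (cball 0 (R + norm v)) x" v, THEN iffD2])
      show "integrable lborel (\<lambda>x. u x * indicator (cball 0 (R + norm v)) x)"
        using u unfolding loc_int_def by blast
    qed (intro borel_measurable_times loc_int_measurable[OF u] borel_measurable_indicator, simp)
    show "AE x in lborel. norm (u (x + v) * indicator (cball 0 R) x) \<le> norm (u (x + v) * indicator (cball 0 (R + norm v)) (x + v))"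
    proof (intro always_eventually allI)
      fix x
      show "norm (u (x + v) * indicator (cball 0 R) x) \<le> norm (u (x + v) * indicator (cball 0 (R + norm v)) (x + v))"
        using norm_triangle_ineq[of x v] by (auto simp: indicator_def)
    qed
  qed measurable
  then show ?thesis by (simp add: loc_int_def)
qed

lemma loc_int_cmult: "loc_int u \<Longrightarrow> loc_int (\<lambda>x. c * u x)"
  by (auto simp: loc_int_def mult.assoc)

lemma loc_int_sum:
  "finite I \<Longrightarrow> (\<And>i. i \<in> I \<Longrightarrow> loc_int (u i)) \<Longrightarrow> loc_int (\<lambda>x. \<Sum>i\<in>I. u i x)"
  unfolding loc_int_def sum_distrib_right by (intro conjI allI borel_measurable_sum Bochner_Integration.integrable_sum) blast+

lemma loc_int_diff: "loc_int u \<Longrightarrow> loc_int v \<Longrightarrow> loc_int (\<lambda>x. u x - v x)"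
  by (auto simp: loc_int_def left_diff_distrib)

text \<open>
  Fubini's criterion when one variable is confined to a bounded interval.
\<close>

lemma integrable_pair_bounded:
  fixes H :: "real \<Rightarrow> 'a::euclidean_space \<Rightarrow> real"
  assumes [measurable]: "(\<lambda>(s, x). H s x) \<in> borel_measurable (lborel \<Otimes>\<^sub>M lborel)"
    and i: "\<And>s. integrable lborel (H s)" and Q: "\<And>s. (\<integral>x. \<bar>H s x\<bar> \<partial>lborel) \<le> Q"
    and supp: "\<And>s x. s \<notin> {0..M} \<Longrightarrow> H s x = 0"
  shows "integrable (lborel \<Otimes>\<^sub>M lborel) (\<lambda>(s, x). H s x)"
proof (rule lborel_pair.Fubini_integrable)
  show "AE s in lborel. integrable lborel (\<lambda>x. case (s, x) of (s, x) \<Rightarrow> H s x)" using i by simp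
  show "integrable lborel (\<lambda>s. \<integral>x. norm (case (s, x) of (s, x) \<Rightarrow> H s x) \<partial>lborel)"
  proof (rule integrable_bounded_support[where B = Q and a = 0 and b = M])
    show "\<bar>\<integral>x. norm (case (s, x) of (s, x) \<Rightarrow> H s x) \<partial>lborel\<bar> \<le> Q" for s
      using Q[of s] by (simp add: abs_of_nonneg)
    show "(\<integral>x. norm (case (s, x) of (s, x) \<Rightarrow> H s x) \<partial>lborel) = 0" if "s \<notin> cbox 0 M" for s
    proof -
      have "H s x = 0" for x using that supp by auto
      then show ?thesis by simp
    qed
  qed measurable
qed measurable

text \<open>
  Weighted averages along a line in direction \<open>h\<close>. Below, averaging forward along \<open>h\<close> is
  adjoint to averaging backward; this carries an average of a weak derivative over to the test function.
\<close>

locale line_average =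
  fixes b :: "real \<Rightarrow> real" and M :: real and h :: "real ^ 'n"
  assumes b_meas [measurable]: "b \<in> borel_measurable borel"
    and b01: "0 \<le> b s" "b s \<le> 1" and b_supp: "s \<notin> {0..M} \<Longrightarrow> b s = 0"
begin

abbreviation forward :: "(real ^ 'n \<Rightarrow> real) \<Rightarrow> real ^ 'n \<Rightarrow> real" where
  "forward F x \<equiv> \<integral>s. b s * F (x + s *\<^sub>R h) \<partial>lborel"

abbreviation backward :: "(real ^ 'n \<Rightarrow> real) \<Rightarrow> real ^ 'n \<Rightarrow> real" where
  "backward \<theta> y \<equiv> \<integral>s. b s * \<theta> (y - s *\<^sub>R h) \<partial>lborel"

lemma integrable_back:
  assumes F: "loc_int F" and [measurable]: "\<theta> \<in> borel_measurable borel"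
    and B: "\<And>x. \<bar>\<theta> x\<bar> \<le> B" and R: "\<And>x. x \<notin> cball 0 R \<Longrightarrow> \<theta> x = 0"
  shows "integrable (lborel \<Otimes>\<^sub>M lborel) (\<lambda>(s, y). b s * (F y * \<theta> (y - s *\<^sub>R h)))"
    and "integrable (lborel \<Otimes>\<^sub>M lborel) (\<lambda>(s, x). b s * (F (x + s *\<^sub>R h) * \<theta> x))"
proof -
  note loc_int_measurable[OF F, measurable]
  let ?D = "\<lambda>y. B * \<bar>F y * indicator (cball 0 (R + M * norm h)) y\<bar>"
  have D: "integrable lborel ?D" using F by (auto simp: loc_int_def)
  have le: "\<bar>b s * (F y * \<theta> (y - s *\<^sub>R h))\<bar> \<le> ?D y" for s y
  proof (cases "s \<in> {0..M} \<and> y - s *\<^sub>R h \<in> cball 0 R")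
    case True
    have "norm y \<le> norm (y - s *\<^sub>R h) + norm (s *\<^sub>R h)"
      by (metis norm_triangle_sub add.commute)
    also have "\<dots> \<le> R + M * norm h" using True by (intro add_mono) (auto intro: mult_right_mono)
    finally have "y \<in> cball 0 (R + M * norm h)" by simp
    moreover have "b s * (\<bar>F y\<bar> * \<bar>\<theta> (y - s *\<^sub>R h)\<bar>) \<le> 1 * (\<bar>F y\<bar> * B)"
      using b01[of s] B[of "y - s *\<^sub>R h"] by (intro mult_mono) auto
    ultimately show ?thesis using b01[of s] by (simp add: abs_mult mult.commute)
  next
    case False
    then have "b s * (F y * \<theta> (y - s *\<^sub>R h)) = 0" using b_supp R by auto
    moreover have "0 \<le> B" using B[of 0] by linarith
    ultimately show ?thesis by (simp only: abs_zero mult_nonneg_nonneg abs_ge_zero)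
  qed
  have i: "integrable lborel (\<lambda>y. b s * (F y * \<theta> (y - s *\<^sub>R h)))" for s
    by (rule Bochner_Integration.integrable_bound[OF D]) (auto intro!: always_eventually order_trans[OF le])
  have q: "(\<integral>y. \<bar>b s * (F y * \<theta> (y - s *\<^sub>R h))\<bar> \<partial>lborel) \<le> (\<integral>y. ?D y \<partial>lborel)" for s
    using i by (intro Bochner_Integration.integral_mono D integrable_abs le) auto
  show "integrable (lborel \<Otimes>\<^sub>M lborel) (\<lambda>(s, y). b s * (F y * \<theta> (y - s *\<^sub>R h)))"
    by (rule integrable_pair_bounded[where M = M, OF _ i q]) (use b_supp in auto)
  have i': "integrable lborel (\<lambda>x. b s * (F (x + s *\<^sub>R h) * \<theta> x))" for s
    using i[of s] integral_lborel_shift(2)[of "\<lambda>y. b s * (F y * \<theta> (y - s *\<^sub>R h))" "s *\<^sub>R h"] by simp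
  have q': "(\<integral>x. \<bar>b s * (F (x + s *\<^sub>R h) * \<theta> x)\<bar> \<partial>lborel) \<le> (\<integral>y. ?D y \<partial>lborel)" for s
    using q[of s] integral_lborel_shift(1)[of "\<lambda>y. \<bar>b s * (F y * \<theta> (y - s *\<^sub>R h))\<bar>" "s *\<^sub>R h"] by simp
  show "integrable (lborel \<Otimes>\<^sub>M lborel) (\<lambda>(s, x). b s * (F (x + s *\<^sub>R h) * \<theta> x))"
    by (rule integrable_pair_bounded[where M = M, OF _ i' q']) (use b_supp in auto)
qed

text \<open>
  Together with \<open>swap_forward\<close> this is the adjointness: both pairings equal the same double integral.
\<close>

lemma swap_back:
  assumes F: "loc_int F" and [measurable]: "\<theta> \<in> borel_measurable borel"
    and B: "\<And>x. \<bar>\<theta> x\<bar> \<le> B" and R: "\<And>x. x \<notin> cball 0 R \<Longrightarrow> \<theta> x = 0"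
  shows "integrable lborel (\<lambda>y. F y * backward \<theta> y)"
    and "(\<integral>y. F y * backward \<theta> y \<partial>lborel)
      = (\<integral>s. b s * (\<integral>y. F y * \<theta> (y - s *\<^sub>R h) \<partial>lborel) \<partial>lborel)"
proof -
  note i = integrable_back(1)[OF F assms(2) B R]
  have eq: "(\<integral>s. b s * (F y * \<theta> (y - s *\<^sub>R h)) \<partial>lborel) = F y * backward \<theta> y" for y
    by (subst mult.left_commute) simp
  show "integrable lborel (\<lambda>y. F y * backward \<theta> y)"
    using lborel_pair.integrable_snd[OF i] by (simp add: eq)
  show "(\<integral>y. F y * backward \<theta> y \<partial>lborel)
      = (\<integral>s. b s * (\<integral>y. F y * \<theta> (y - s *\<^sub>R h) \<partial>lborel) \<partial>lborel)"
    using lborel_pair.Fubini_integral[OF i] by (simp add: eq)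
qed

lemma swap_forward:
  assumes F: "loc_int F" and [measurable]: "\<theta> \<in> borel_measurable borel"
    and B: "\<And>x. \<bar>\<theta> x\<bar> \<le> B" and R: "\<And>x. x \<notin> cball 0 R \<Longrightarrow> \<theta> x = 0"
  shows "integrable lborel (\<lambda>x. \<theta> x * forward F x)"
    and "(\<integral>x. \<theta> x * forward F x \<partial>lborel)
      = (\<integral>s. b s * (\<integral>y. F y * \<theta> (y - s *\<^sub>R h) \<partial>lborel) \<partial>lborel)"
proof -
  note loc_int_measurable[OF F, measurable]
  note i = integrable_back(2)[OF F assms(2) B R]
  have eq: "(\<integral>s. b s * (F (x + s *\<^sub>R h) * \<theta> x) \<partial>lborel) = \<theta> x * forward F x" for x
    by (simp add: mult.assoc[symmetric])
  have sh: "(\<integral>x. F (x + s *\<^sub>R h) * \<theta> x \<partial>lborel) = (\<integral>y. F y * \<theta> (y - s *\<^sub>R h) \<partial>lborel)" for s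
    using integral_lborel_shift(1)[of "\<lambda>y. F y * \<theta> (y - s *\<^sub>R h)" "s *\<^sub>R h"] by simp
  show "integrable lborel (\<lambda>x. \<theta> x * forward F x)"
    using lborel_pair.integrable_snd[OF i] by (simp add: eq)
  show "(\<integral>x. \<theta> x * forward F x \<partial>lborel)
      = (\<integral>s. b s * (\<integral>y. F y * \<theta> (y - s *\<^sub>R h) \<partial>lborel) \<partial>lborel)"
    using lborel_pair.Fubini_integral[OF i] by (simp add: eq sh)
qed

lemma loc_int_average:
  assumes F: "loc_int F"
  shows "loc_int (\<lambda>x. forward F x)"
proof -
  note loc_int_measurable[OF F, measurable]
  have "integrable lborel (\<lambda>x. indicator (cball 0 R) x * forward F x)" for R
    by (rule swap_forward(1)[OF F, where B = 1 and R = R]) (auto simp: indicator_def)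
  moreover have "(\<lambda>x. forward F x) \<in> borel_measurable borel" by measurable
  ultimately show ?thesis by (simp add: loc_int_def mult.commute)
qed

lemma AE_integrable_line:
  assumes F: "loc_int F"
  shows "AE x in lborel. integrable lborel (\<lambda>s. b s * F (x + s *\<^sub>R h))"
proof -
  note loc_int_measurable[OF F, measurable]
  have "AE x in lborel. integrable lborel (\<lambda>s. b s * (F (x + s *\<^sub>R h) * indicator (cball 0 (real n)) x))" for n
  proof -
    have "integrable (lborel \<Otimes>\<^sub>M lborel) (\<lambda>(s, x). b s * (F (x + s *\<^sub>R h) * indicator (cball 0 (real n)) x))"
      by (rule integrable_back(2)[OF F, where B = 1 and R = "real n"]) (auto simp: indicator_def)
    from lborel_pair.AE_integrable_snd[OF this] show ?thesis by simp
  qed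
  then have "AE x in lborel. \<forall>n. integrable lborel (\<lambda>s. b s * (F (x + s *\<^sub>R h) * indicator (cball 0 (real n)) x))"
    by (simp add: AE_all_countable)
  then show ?thesis
  proof eventually_elim
    case (elim x)
    obtain n where "norm x \<le> real n" using real_arch_simple by blast
    with elim[rule_format, of n] show ?case by simp
  qed
qed

text \<open>
  For each \<open>s\<close> the function \<open>y \<mapsto> \<phi> (y - s h)\<close> is again a test function,
  so the definition of the weak derivative applies under the integral over \<open>s\<close>.
\<close>

lemma weak_pairing:
  assumes w: "has_weak_partials f is g" and f: "loc_int f" and g: "loc_int g" and \<phi>: "test_function \<phi>"
  shows "integrable lborel (\<lambda>y. f y * backward (partials is \<phi>) y)"
    and "integrable lborel (\<lambda>x. \<phi> x * forward g x)"
    and "(\<integral>y. f y * backward (partials is \<phi>) y \<partial>lborel)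
      = (- 1) ^ length is * (\<integral>x. \<phi> x * forward g x \<partial>lborel)"
proof -
  note loc_int_measurable[OF f, measurable] loc_int_measurable[OF g, measurable]
  have [measurable]: "partials is \<phi> \<in> borel_measurable borel" for "is"
    using test_function_measurable[OF \<phi>] .
  have p0: "partials [] \<phi> = \<phi>" for \<phi> :: "real ^ 'n \<Rightarrow> real" by (simp add: partials_def)
  have [measurable]: "\<phi> \<in> borel_measurable borel" using test_function_measurable[OF \<phi>, of "[]"] by (simp add: p0)
  obtain C where C: "compact C" "\<And>is x. x \<notin> C \<Longrightarrow> partials is \<phi> x = 0"
    using test_function_support[OF \<phi>] by metis
  obtain R where R: "C \<subseteq> cball 0 R"
    using compact_imp_bounded[OF C(1)] unfolding bounded_iff by (auto simp: subset_iff)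
  have supp: "x \<notin> cball 0 R \<Longrightarrow> partials is \<phi> x = 0" for x "is" using C R by blast
  obtain B where B: "\<And>x. \<bar>partials is \<phi> x\<bar> \<le> B" using test_function_bounded[OF \<phi>] by metis
  obtain B0 where B0: "\<And>x. \<bar>\<phi> x\<bar> \<le> B0" using test_function_bounded[OF \<phi>, of "[]"] by (metis p0)
  have supp0: "x \<notin> cball 0 R \<Longrightarrow> \<phi> x = 0" for x using supp[of x "[]"] by (simp add: p0)
  show "integrable lborel (\<lambda>y. f y * backward (partials is \<phi>) y)"
    by (rule swap_back(1)[OF f _ B supp]) auto
  show "integrable lborel (\<lambda>x. \<phi> x * forward g x)"
    by (rule swap_forward(1)[OF g _ B0 supp0]) auto
  have pair: "(\<integral>y. f y * partials is \<phi> (y - s *\<^sub>R h) \<partial>lborel) = (- 1) ^ length is * (\<integral>y. g y * \<phi> (y - s *\<^sub>R h) \<partial>lborel)" for s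
  proof -
    have "(\<integral>y. f y * partials is (\<lambda>x. \<phi> (x - s *\<^sub>R h)) y \<partial>lebesgue)
      = (- 1) ^ length is * (\<integral>y. g y * \<phi> (y - s *\<^sub>R h) \<partial>lebesgue)"
      using w test_function_shift(1)[OF \<phi>] by (auto simp: has_weak_partials_def)
    then show ?thesis by (simp add: test_function_shift(2)[OF \<phi>] integral_completion)
  qed
  have "(\<integral>y. f y * backward (partials is \<phi>) y \<partial>lborel)
      = (\<integral>s. b s * (\<integral>y. f y * partials is \<phi> (y - s *\<^sub>R h) \<partial>lborel) \<partial>lborel)"
    by (rule swap_back(2)[OF f _ B supp]) auto
  also have "\<dots> = (- 1) ^ length is * (\<integral>s. b s * (\<integral>y. g y * \<phi> (y - s *\<^sub>R h) \<partial>lborel) \<partial>lborel)"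
    unfolding pair by (subst mult.left_commute) simp
  also have "(\<integral>s. b s * (\<integral>y. g y * \<phi> (y - s *\<^sub>R h) \<partial>lborel) \<partial>lborel)
      = (\<integral>x. \<phi> x * forward g x \<partial>lborel)"
    by (rule swap_forward(2)[OF g _ B0 supp0, symmetric]) auto
  finally show "(\<integral>y. f y * backward (partials is \<phi>) y \<partial>lborel)
      = (- 1) ^ length is * (\<integral>x. \<phi> x * forward g x \<partial>lborel)" .
qed

end

text \<open>
  For smooth functions this is the kernel formula along a line. For weak derivatives it is proved by duality: paired
  with a test function, the differences move to the test function, where the kernel formula holds pointwise, and
  \<open>weak_pairing\<close> moves the derivatives back. The exceptional null set depends on \<open>h\<close>.
\<close>

lemma difference_eq_average:
  fixes f :: "real ^ 'n \<Rightarrow> real" and g :: "'n list \<Rightarrow> real ^ 'n \<Rightarrow> real" and h :: "real ^ 'n"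
  assumes b: "peano_kernel m b" and f: "loc_int f" and g: "\<And>is. length is = m \<Longrightarrow> loc_int (g is)"
    and w: "\<And>is. length is = m \<Longrightarrow> has_weak_partials f is (g is)"
  shows "AE x in lborel. (\<Sum>j\<le>m. (- 1) ^ j * real (m choose j) * f (x + real j *\<^sub>R h))
    = (- 1) ^ m * (\<integral>s. b s * (\<Sum>is\<in>{is. length is = m}. dir_power h is * g is (x + s *\<^sub>R h)) \<partial>lborel)"
proof -
  interpret line_average b "real m" h
    using b by unfold_locales (auto simp: peano_kernel_def)
  let ?L = "{is :: 'n list. length is = m}"
  have fin: "finite ?L" by (rule finite_lists_of_length)
  let ?d = "\<lambda>x. \<Sum>j\<le>m. ((- 1) ^ j * real (m choose j)) * f (x + real j *\<^sub>R h)"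
  let ?r = "\<lambda>x. ?d x - (- 1) ^ m * (\<Sum>is\<in>?L. dir_power h is * forward (g is) x)"
  have "loc_int ?r"
    using fin by (intro loc_int_diff loc_int_sum loc_int_cmult loc_int_shift loc_int_average f g) auto
  then have r: "locally_integrable ?r" and [measurable]: "?r \<in> borel_measurable borel"
    using loc_int_iff loc_int_measurable by blast+
  have "AE x in lebesgue. ?r x = 0"
  proof (rule weak_zero_imp_AE_zero[OF r])
    fix \<phi> :: "real ^ 'n \<Rightarrow> real" assume \<phi>: "test_function \<phi>"
    have p0: "partials [] \<phi> = \<phi>" by (simp add: partials_def)
    have \<phi>m [measurable]: "\<phi> \<in> borel_measurable borel" using test_function_measurable[OF \<phi>, of "[]"] by (simp add: p0)
    note loc_int_measurable[OF f, measurable]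
    have [measurable]: "partials is \<phi> \<in> borel_measurable borel" for "is"
      using test_function_measurable[OF \<phi>] .
    have fs: "integrable lborel (\<lambda>x. f (x + v) * \<phi> x)" for v
    proof -
      have "integrable lebesgue (\<lambda>x. f (x + v) * partials [] \<phi> x)"
        using loc_int_shift[OF f, of v] by (intro locally_integrable_times_test \<phi>) (simp add: loc_int_iff)
      then show ?thesis by (simp add: p0 integrable_completion)
    qed
    have fs': "integrable lborel (\<lambda>y. f y * \<phi> (y - v))"
      and fe: "(\<integral>x. f (x + v) * \<phi> x \<partial>lborel) = (\<integral>y. f y * \<phi> (y - v) \<partial>lborel)" for v
      using fs[of v] integral_lborel_shift[of "\<lambda>y. f y * \<phi> (y - v)" v] by simp_all
    have pk: "(\<Sum>j\<le>m. ((- 1) ^ j * real (m choose j)) * \<phi> (y - real j *\<^sub>R h))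
      = (\<Sum>is\<in>?L. dir_power h is * backward (partials is \<phi>) y)" for y
    proof -
      define \<psi> where "\<psi> j s = (- 1) ^ j * (\<Sum>is\<in>{is. length is = j}. dir_power h is * partials is \<phi> (y - s *\<^sub>R h))" for j s
      have der: "(\<psi> j has_real_derivative \<psi> (Suc j) s) (at s)" for j s
        unfolding \<psi>_def by (rule line_derivative[OF \<phi>])
      then have "continuous_on UNIV (\<psi> m)"
        by (intro continuous_at_imp_continuous_on ballI DERIV_isCont) auto
      then have "(\<Sum>j\<le>m. (- 1) ^ j * real (m choose j) * \<psi> 0 (real j)) = (- 1) ^ m * (\<integral>s. b s * \<psi> m s \<partial>lborel)"
        using b der unfolding peano_kernel_def by blast
      moreover have "\<psi> 0 s = \<phi> (y - s *\<^sub>R h)" for s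
        by (simp add: \<psi>_def dir_power_def p0)
      moreover have "(\<integral>s. b s * \<psi> m s \<partial>lborel)
        = (- 1) ^ m * (\<Sum>is\<in>?L. dir_power h is * backward (partials is \<phi>) y)"
      proof -
        have int: "integrable lborel (\<lambda>s. b s * partials is \<phi> (y - s *\<^sub>R h))" for "is"
        proof -
          obtain B where B: "\<And>x. \<bar>partials is \<phi> x\<bar> \<le> B" using test_function_bounded[OF \<phi>] by metis
          have "\<bar>b s * partials is \<phi> (y - s *\<^sub>R h)\<bar> \<le> 1 * B" for s
            unfolding abs_mult using b01[of s] B by (intro mult_mono) auto
          then show ?thesis
            by (intro integrable_bounded_support[where B = B and a = 0 and b = "real m"]) (use b_supp in auto)
        qed
        have "(\<integral>s. b s * \<psi> m s \<partial>lborel)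
          = (\<integral>s. (\<Sum>is\<in>?L. ((- 1) ^ m * dir_power h is) * (b s * partials is \<phi> (y - s *\<^sub>R h))) \<partial>lborel)"
          by (intro Bochner_Integration.integral_cong refl) (simp add: \<psi>_def sum_distrib_left mult_ac)
        also have "\<dots> = (\<Sum>is\<in>?L. ((- 1) ^ m * dir_power h is) * backward (partials is \<phi>) y)"
          by (subst Bochner_Integration.integral_sum) (auto intro: int)
        finally show ?thesis by (simp add: sum_distrib_left mult.assoc)
      qed
      ultimately show ?thesis by (simp add: mult.assoc[symmetric] power_mult_distrib[symmetric])
    qed
    have "(\<integral>x. ?d x * \<phi> x \<partial>lborel) = (\<Sum>j\<le>m. ((- 1) ^ j * real (m choose j)) * (\<integral>x. f (x + real j *\<^sub>R h) * \<phi> x \<partial>lborel))"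
      by (simp only: sum_distrib_right mult.assoc, subst Bochner_Integration.integral_sum) (auto intro!: fs)
    also have "\<dots> = (\<Sum>j\<le>m. (\<integral>y. ((- 1) ^ j * real (m choose j)) * (f y * \<phi> (y - real j *\<^sub>R h)) \<partial>lborel))"
      by (simp add: fe)
    also have "\<dots> = (\<integral>y. (\<Sum>j\<le>m. ((- 1) ^ j * real (m choose j)) * (f y * \<phi> (y - real j *\<^sub>R h))) \<partial>lborel)"
      by (subst Bochner_Integration.integral_sum) (auto intro!: fs')
    also have "\<dots> = (\<integral>y. f y * (\<Sum>j\<le>m. ((- 1) ^ j * real (m choose j)) * \<phi> (y - real j *\<^sub>R h)) \<partial>lborel)"
      by (simp only: sum_distrib_left mult.left_commute)
    also have "\<dots> = (\<integral>y. (\<Sum>is\<in>?L. dir_power h is * (f y * backward (partials is \<phi>) y)) \<partial>lborel)"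
      unfolding pk by (simp only: sum_distrib_left mult.left_commute)
    also have "\<dots> = (\<Sum>is\<in>?L. dir_power h is * (\<integral>y. f y * backward (partials is \<phi>) y \<partial>lborel))"
      by (subst Bochner_Integration.integral_sum) (auto intro!: weak_pairing(1)[OF w f g \<phi>])
    also have "\<dots> = (\<Sum>is\<in>?L. dir_power h is * ((- 1) ^ m * (\<integral>x. \<phi> x * forward (g is) x \<partial>lborel)))"
      by (intro sum.cong refl) (simp add: weak_pairing(3)[OF w f g \<phi>])
    also have "\<dots> = (\<integral>x. (\<Sum>is\<in>?L. ((- 1) ^ m * dir_power h is) * (\<phi> x * forward (g is) x)) \<partial>lborel)"
      by (subst Bochner_Integration.integral_sum) (auto intro!: weak_pairing(2)[OF w f g \<phi>] sum.cong)
    also have "\<dots> = (\<integral>x. (- 1) ^ m * (\<Sum>is\<in>?L. dir_power h is * forward (g is) x) * \<phi> x \<partial>lborel)"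
      by (simp only: sum_distrib_left sum_distrib_right mult_ac)
    finally have eq: "(\<integral>x. ?d x * \<phi> x \<partial>lborel) = (\<integral>x. (- 1) ^ m * (\<Sum>is\<in>?L. dir_power h is * forward (g is) x) * \<phi> x \<partial>lborel)" .
    have "integrable lborel (\<lambda>x. ?d x * \<phi> x)"
      unfolding sum_distrib_right mult.assoc by (intro Bochner_Integration.integrable_sum integrable_mult_right fs)
    moreover have "integrable lborel (\<lambda>x. (- 1) ^ m * (\<Sum>is\<in>?L. dir_power h is * forward (g is) x) * \<phi> x)"
    proof -
      have "integrable lborel (\<lambda>x. \<Sum>is\<in>?L. ((- 1) ^ m * dir_power h is) * (\<phi> x * forward (g is) x))"
        by (intro Bochner_Integration.integrable_sum integrable_mult_right weak_pairing(2)[OF w f g \<phi>]) auto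
      then show ?thesis by (simp only: sum_distrib_left sum_distrib_right mult_ac)
    qed
    ultimately have "(\<integral>x. ?r x * \<phi> x \<partial>lborel) = 0"
      unfolding left_diff_distrib by (simp only: Bochner_Integration.integral_diff eq diff_self)
    then show "(\<integral>x. ?r x * \<phi> x \<partial>lebesgue) = 0"
      by (subst integral_completion) auto
  qed
  then have "AE x in lborel. ?r x = 0" by (simp add: AE_completion_iff)
  moreover have "AE x in lborel. \<forall>is\<in>?L. integrable lborel (\<lambda>s. b s * g is (x + s *\<^sub>R h))"
    using fin by (intro AE_finite_allI AE_integrable_line g) auto
  ultimately show ?thesis
  proof eventually_elim
    case (elim x)
    have "(\<integral>s. b s * (\<Sum>is\<in>?L. dir_power h is * g is (x + s *\<^sub>R h)) \<partial>lborel)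
      = (\<integral>s. (\<Sum>is\<in>?L. dir_power h is * (b s * g is (x + s *\<^sub>R h))) \<partial>lborel)"
      by (simp only: sum_distrib_left mult.left_commute)
    also have "\<dots> = (\<Sum>is\<in>?L. dir_power h is * forward (g is) x)"
      using elim by (subst Bochner_Integration.integral_sum) auto
    finally show ?case using elim by simp
  qed
qed

section \<open>Convergence in measure of averages along short segments\<close>

text \<open>
  The integrated deviation of \<open>F\<close> from \<open>F x\<close> along the segment from \<open>x\<close> to
  \<open>x + M v\<close>. As a nonnegative integral it is subadditive in \<open>F\<close> for all Borel
  functions, integrable along the segment or not, so \<open>F\<close> can be replaced by approximations.
\<close>

definition osc :: "real \<Rightarrow> ('a::euclidean_space \<Rightarrow> real) \<Rightarrow> 'a \<Rightarrow> 'a \<Rightarrow> ennreal" where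
  "osc M F v x = (\<integral>\<^sup>+s. ennreal \<bar>F (x + s *\<^sub>R v) - F x\<bar> * indicator {0..M} s \<partial>lborel)"

lemma measurable_osc [measurable]:
  assumes [measurable]: "F \<in> borel_measurable borel"
  shows "osc M F v \<in> borel_measurable borel"
  unfolding osc_def by measurable

text \<open>
  The kernel has total mass 1 and values at most 1. If the right side is finite, the integrand is integrable;
  otherwise there is nothing to show.
\<close>

lemma kernel_average_minus_le_osc:
  assumes b: "peano_kernel m b" and [measurable]: "F \<in> borel_measurable borel"
  shows "ennreal \<bar>(\<integral>s. b s * F (x + s *\<^sub>R v) \<partial>lborel) - F x\<bar> \<le> osc (real m) F v x"
proof (cases "osc (real m) F v x = \<infinity>")
  case False
  have [measurable]: "b \<in> borel_measurable borel" and b01: "0 \<le> b s" "b s \<le> 1"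
    and supp: "s \<notin> {0..real m} \<Longrightarrow> b s = 0" and b1: "(\<integral>s. b s \<partial>lborel) = 1" for s
    using b by (auto simp: peano_kernel_def)
  let ?g = "\<lambda>s. b s * (F (x + s *\<^sub>R v) - F x)"
  have le: "(\<integral>\<^sup>+s. ennreal (norm (?g s)) \<partial>lborel) \<le> osc (real m) F v x"
    unfolding osc_def
  proof (rule nn_integral_mono)
    fix s
    have "b s * \<bar>F (x + s *\<^sub>R v) - F x\<bar> \<le> 1 * \<bar>F (x + s *\<^sub>R v) - F x\<bar>"
      using b01[of s] by (intro mult_right_mono) auto
    then show "ennreal (norm (?g s)) \<le> ennreal \<bar>F (x + s *\<^sub>R v) - F x\<bar> * indicator {0..real m} s"
      using b01[of s] supp[of s] by (auto simp: abs_mult indicator_def intro!: ennreal_leI)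
  qed
  have i: "integrable lborel ?g"
    using le False by (intro integrableI_bounded) (auto simp: less_top[symmetric] top_unique)
  have ib: "integrable lborel b"
    using b1 not_integrable_integral_eq[of lborel b] by fastforce
  then have "integrable lborel (\<lambda>s. ?g s + b s * F x)"
    using i by (intro Bochner_Integration.integrable_add) auto
  then have iF: "integrable lborel (\<lambda>s. b s * F (x + s *\<^sub>R v))" by (simp add: algebra_simps)
  have "(\<integral>s. ?g s \<partial>lborel) = (\<integral>s. b s * F (x + s *\<^sub>R v) \<partial>lborel) - (\<integral>s. b s * F x \<partial>lborel)"
    unfolding right_diff_distrib using iF ib by (intro Bochner_Integration.integral_diff) auto
  then have "\<bar>(\<integral>s. b s * F (x + s *\<^sub>R v) \<partial>lborel) - F x\<bar> = norm (\<integral>s. ?g s \<partial>lborel)"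
    by (simp add: b1)
  also have "ennreal \<dots> \<le> (\<integral>\<^sup>+s. ennreal (norm (?g s)) \<partial>lborel)"
    using i by (intro integral_norm_bound_ennreal)
  finally show ?thesis using le by (rule order_trans)
qed simp

text \<open>
  Lets a first moment be controlled by a \<open>q\<close>-th moment up to the small additive error
  \<open>\<tau>\<close>, so that one Markov estimate serves for all \<open>q \<ge> 1\<close>.
\<close>

lemma le_weighted_power:
  fixes y :: real
  assumes "0 < \<tau>" "1 \<le> q" "0 \<le> y"
  shows "y \<le> \<tau> + \<tau> powr (1 - q) * y powr q"
proof (cases "y \<le> \<tau>")
  case True
  then show ?thesis by (simp add: add_increasing2)
next
  case False
  then have y: "0 < y" using assms by simp
  have "y = y powr (1 - q) * y powr q" using y by (simp add: powr_add[symmetric])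
  also have "\<dots> \<le> \<tau> powr (1 - q) * y powr q"
    using False assms by (intro mult_right_mono powr_mono2') auto
  finally show ?thesis using assms by simp
qed

text \<open>
  A weak type bound uniform in the direction and length of \<open>v\<close>, obtained from Markov's inequality for
  the \<open>q\<close>-th powers.
\<close>

lemma osc_markov:
  assumes q: "1 \<le> q" and M: "0 < M" and \<eta>: "0 < \<eta>"
  obtains C where "\<And>F v. F \<in> borel_measurable borel \<Longrightarrow>
    vol {x. osc M F v x > ennreal \<eta>} \<le> ennreal C * (\<integral>\<^sup>+x. ennreal (\<bar>F (x::'a::euclidean_space)\<bar> powr q) \<partial>lborel)"
    "0 \<le> C"
proof
  \<comment> \<open>Chosen so that the additive errors of two terms, integrated over \<open>{0..M}\<close>, sum to
    \<open>\<eta> / 2\<close>.\<close>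
  define \<tau> where "\<tau> = \<eta> / (4 * M)"
  have \<tau>: "0 < \<tau>" using M \<eta> by (simp add: \<tau>_def)
  define w where "w = \<tau> powr (1 - q)"
  have w: "0 < w" using \<tau> by (simp add: w_def)
  show "0 \<le> (2 * w / \<eta>) * (2 * M)" using w M \<eta> by simp
  fix F :: "'a \<Rightarrow> real" and v :: 'a
  assume [measurable]: "F \<in> borel_measurable borel"
  define P where "P x = (\<integral>\<^sup>+s. (ennreal (\<bar>F (x + s *\<^sub>R v)\<bar> powr q) + ennreal (\<bar>F x\<bar> powr q)) * indicator {0..M} s \<partial>lborel)" for x
  have [measurable]: "P \<in> borel_measurable borel" unfolding P_def by measurable
  have P: "(\<integral>\<^sup>+x. P x \<partial>lborel) = ennreal (2 * M) * Lp_mass q F"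
  proof -
    let ?I = "\<integral>\<^sup>+x. ennreal (\<bar>F x\<bar> powr q) \<partial>lborel"
    have "(\<integral>\<^sup>+x. P x \<partial>lborel) = (\<integral>\<^sup>+s. \<integral>\<^sup>+x. (ennreal (\<bar>F (x + s *\<^sub>R v)\<bar> powr q) + ennreal (\<bar>F x\<bar> powr q)) * indicator {0..M} s \<partial>lborel \<partial>lborel)"
      unfolding P_def by (rule lborel_pair.Fubini') measurable
    also have "\<dots> = (\<integral>\<^sup>+s. (?I + ?I) * indicator {0..M} s \<partial>lborel)"
    proof (rule nn_integral_cong)
      fix s :: real
      have "(\<integral>\<^sup>+x. (ennreal (\<bar>F (x + s *\<^sub>R v)\<bar> powr q) + ennreal (\<bar>F x\<bar> powr q)) * indicator {0..M} s \<partial>lborel)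
        = ((\<integral>\<^sup>+x. ennreal (\<bar>F (x + s *\<^sub>R v)\<bar> powr q) \<partial>lborel) + ?I) * indicator {0..M} s"
        by (subst nn_integral_multc, measurable, subst nn_integral_add) auto
      also have "(\<integral>\<^sup>+x. ennreal (\<bar>F (x + s *\<^sub>R v)\<bar> powr q) \<partial>lborel) = ?I"
        by (rule nn_integral_lborel_shift) measurable
      finally show "(\<integral>\<^sup>+x. (ennreal (\<bar>F (x + s *\<^sub>R v)\<bar> powr q) + ennreal (\<bar>F x\<bar> powr q)) * indicator {0..M} s \<partial>lborel)
        = (?I + ?I) * indicator {0..M} s" .
    qed
    also have "\<dots> = (?I + ?I) * ennreal M"
      using M by (subst nn_integral_cmult) auto
    also have "\<dots> = ennreal (2 * M) * ?I"
      using M by (simp add: mult_2[symmetric] ennreal_mult mult_ac)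
    finally show ?thesis .
  qed
  have le: "osc M F v x \<le> ennreal (\<eta> / 2) + ennreal w * P x" for x
  proof -
    have "osc M F v x \<le> (\<integral>\<^sup>+s. ennreal (2 * \<tau>) * indicator {0..M} s + ennreal w * ((ennreal (\<bar>F (x + s *\<^sub>R v)\<bar> powr q) + ennreal (\<bar>F x\<bar> powr q)) * indicator {0..M} s) \<partial>lborel)"
      unfolding osc_def
    proof (rule nn_integral_mono)
      fix s
      have "\<bar>F (x + s *\<^sub>R v) - F x\<bar> \<le> \<bar>F (x + s *\<^sub>R v)\<bar> + \<bar>F x\<bar>" by simp
      also have "\<dots> \<le> (\<tau> + w * \<bar>F (x + s *\<^sub>R v)\<bar> powr q) + (\<tau> + w * \<bar>F x\<bar> powr q)"
        unfolding w_def using \<tau> q by (intro add_mono le_weighted_power) auto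
      finally have "\<bar>F (x + s *\<^sub>R v) - F x\<bar> \<le> 2 * \<tau> + w * (\<bar>F (x + s *\<^sub>R v)\<bar> powr q + \<bar>F x\<bar> powr q)"
        by (simp add: algebra_simps)
      then have "ennreal \<bar>F (x + s *\<^sub>R v) - F x\<bar> \<le> ennreal (2 * \<tau>) + ennreal w * (ennreal (\<bar>F (x + s *\<^sub>R v)\<bar> powr q) + ennreal (\<bar>F x\<bar> powr q))"
        using \<tau> w by (simp add: ennreal_plus[symmetric] ennreal_mult[symmetric] ennreal_leI del: ennreal_plus)
      then show "ennreal \<bar>F (x + s *\<^sub>R v) - F x\<bar> * indicator {0..M} s \<le> ennreal (2 * \<tau>) * indicator {0..M} s + ennreal w * ((ennreal (\<bar>F (x + s *\<^sub>R v)\<bar> powr q) + ennreal (\<bar>F x\<bar> powr q)) * indicator {0..M} s)"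
        by (auto simp: indicator_def)
    qed
    also have "\<dots> = ennreal (2 * \<tau>) * ennreal M + ennreal w * P x"
    proof -
      let ?P = "\<lambda>s. (ennreal (\<bar>F (x + s *\<^sub>R v)\<bar> powr q) + ennreal (\<bar>F x\<bar> powr q)) * indicator {0..M} s :: ennreal"
      have "(\<integral>\<^sup>+s. ennreal (2 * \<tau>) * indicator {0..M} s + ennreal w * ?P s \<partial>lborel)
        = (\<integral>\<^sup>+s. ennreal (2 * \<tau>) * indicator {0..M} s \<partial>lborel) + (\<integral>\<^sup>+s. ennreal w * ?P s \<partial>lborel)"
        by (rule nn_integral_add) measurable
      also have "(\<integral>\<^sup>+s. ennreal w * ?P s \<partial>lborel) = ennreal w * (\<integral>\<^sup>+s. ?P s \<partial>lborel)"
        by (rule nn_integral_cmult) measurable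
      also have "(\<integral>\<^sup>+s. ennreal (2 * \<tau>) * indicator {0..M} s \<partial>lborel) = ennreal (2 * \<tau>) * ennreal M"
        using M by (subst nn_integral_cmult_indicator) auto
      finally show ?thesis unfolding P_def .
    qed
    also have "ennreal (2 * \<tau>) * ennreal M = ennreal (\<eta> / 2)"
      using M \<eta> by (simp add: ennreal_mult[symmetric] \<tau>_def)
    finally show ?thesis .
  qed
  have "{x. osc M F v x > ennreal \<eta>} \<subseteq> {x. 1 \<le> ennreal (2 * w / \<eta>) * P x}"
  proof clarify
    fix x assume "ennreal \<eta> < osc M F v x"
    then have "ennreal \<eta> \<le> ennreal (\<eta> / 2) + ennreal w * P x"
      using le[of x] by (meson less_imp_le order_trans)
    moreover have "ennreal \<eta> = ennreal (\<eta> / 2) + ennreal (\<eta> / 2)"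
      using \<eta> by (subst ennreal_plus[symmetric]) auto
    ultimately have "ennreal (\<eta> / 2) + ennreal (\<eta> / 2) \<le> ennreal (\<eta> / 2) + ennreal w * P x" by simp
    then have "ennreal (\<eta> / 2) \<le> ennreal w * P x"
      by (subst (asm) ennreal_add_left_cancel_le) auto
    then have "ennreal (2 / \<eta>) * ennreal (\<eta> / 2) \<le> ennreal (2 / \<eta>) * (ennreal w * P x)" by (intro mult_left_mono) auto
    then show "1 \<le> ennreal (2 * w / \<eta>) * P x"
      using \<eta> w by (simp add: mult.assoc[symmetric] ennreal_mult[symmetric])
  qed
  then have "vol {x. osc M F v x > ennreal \<eta>} \<le> vol {x \<in> space lborel. 1 \<le> ennreal (2 * w / \<eta>) * P x}"
    by (intro emeasure_mono) auto
  also have "\<dots> \<le> ennreal (2 * w / \<eta>) * (\<integral>\<^sup>+x. P x * indicator UNIV x \<partial>lborel)"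
    using nn_integral_Markov_inequality[of P UNIV lborel "ennreal (2 * w / \<eta>)"] by simp
  also have "\<dots> = ennreal ((2 * w / \<eta>) * (2 * M)) * Lp_mass q F"
    using w \<eta> M by (simp add: P mult.assoc[symmetric] ennreal_mult[symmetric])
  finally show "vol {x. osc M F v x > ennreal \<eta>} \<le> ennreal ((2 * w / \<eta>) * (2 * M)) * Lp_mass q F" .
qed

lemma osc_diff_le:
  assumes [measurable]: "F \<in> borel_measurable borel" "G \<in> borel_measurable borel"
  shows "osc M F v x \<le> osc M (\<lambda>x. F x - G x) v x + osc M G v x"
proof -
  have "osc M F v x \<le> (\<integral>\<^sup>+s. ennreal \<bar>(F (x + s *\<^sub>R v) - G (x + s *\<^sub>R v)) - (F x - G x)\<bar> * indicator {0..M} s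
      + ennreal \<bar>G (x + s *\<^sub>R v) - G x\<bar> * indicator {0..M} s \<partial>lborel)"
    unfolding osc_def
    by (intro nn_integral_mono) (auto simp: indicator_def ennreal_plus[symmetric] simp del: ennreal_plus intro!: ennreal_leI)
  also have "\<dots> = osc M (\<lambda>x. F x - G x) v x + osc M G v x"
    unfolding osc_def by (rule nn_integral_add) measurable
  finally show ?thesis .
qed

lemma truncation_dense:
  fixes F :: "'a::euclidean_space \<Rightarrow> real"
  assumes [measurable]: "F \<in> borel_measurable borel" and p: "0 < p"
    and fin: "Lp_mass p F < \<infinity>" and e: "0 < (e::ennreal)"
  obtains n :: nat and F0 where "F0 \<in> borel_measurable borel" "\<And>x. \<bar>F0 x\<bar> \<le> real n" "\<And>x. norm x > real n \<Longrightarrow> F0 x = 0"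
    "Lp_mass p (\<lambda>x. F x - F0 x) < e"
proof -
  define T where "T n x = (if norm x \<le> real n \<and> \<bar>F x\<bar> \<le> real n then F x else 0)" for n :: nat and x
  have [measurable]: "T n \<in> borel_measurable borel" for n unfolding T_def by measurable
  have "(\<lambda>n. \<integral>\<^sup>+x. ennreal (\<bar>F x - T n x\<bar> powr p) \<partial>lborel) \<longlonglongrightarrow> (\<integral>\<^sup>+x. 0 \<partial>(lborel :: 'a measure))"
  proof (rule nn_integral_dominated_convergence[where w = "\<lambda>x. ennreal (\<bar>F x\<bar> powr p)"])
    show "AE x in lborel. ennreal (\<bar>F x - T n x\<bar> powr p) \<le> ennreal (\<bar>F x\<bar> powr p)" for n
      by (intro always_eventually allI) (auto simp: T_def)
    show "AE x in lborel. (\<lambda>n. ennreal (\<bar>F x - T n x\<bar> powr p)) \<longlonglongrightarrow> 0"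
    proof (rule always_eventually, rule allI, rule tendsto_eventually)
      fix x
      obtain n0 :: nat where "max (norm x) \<bar>F x\<bar> \<le> real n0" using real_arch_simple by blast
      then show "\<forall>\<^sub>F n in sequentially. ennreal (\<bar>F x - T n x\<bar> powr p) = 0"
        using eventually_ge_at_top[of n0] by (elim eventually_mono) (auto simp: T_def)
    qed
  qed (use fin in auto)
  then have "\<forall>\<^sub>F n in sequentially. Lp_mass p (\<lambda>x. F x - T n x) < e"
    using e by (intro order_tendstoD) auto
  then obtain n where "Lp_mass p (\<lambda>x. F x - T n x) < e"
    by (auto simp: eventually_sequentially)
  then show thesis by (intro that[of "T n" n]) (auto simp: T_def)
qed

text \<open>
  A measurable function is almost everywhere a limit of continuous functions. Clamping these to
  \<open>{- n..n}\<close> and cutting them off outside the ball of radius \<open>n + 1\<close> makes the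
  convergence dominated.
\<close>

lemma continuous_dense:
  fixes F :: "'a::euclidean_space \<Rightarrow> real"
  assumes [measurable]: "F \<in> borel_measurable borel" and bd: "\<And>x. \<bar>F x\<bar> \<le> real n"
    and supp: "\<And>x. norm x > real n \<Longrightarrow> F x = 0" and e: "0 < (e::ennreal)"
  obtains g where "continuous_on UNIV g" "\<And>x. norm x > real n + 1 \<Longrightarrow> g x = 0"
    "(\<integral>\<^sup>+x. ennreal \<bar>F x - g x\<bar> \<partial>lborel) < e"
proof -
  have "F \<in> borel_measurable lebesgue" by (simp add: measurable_completion)
  then have "F measurable_on UNIV" by (intro lebesgue_measurable_imp_measurable_on) auto
  then obtain N g where N: "negligible N" and g: "\<And>k. continuous_on UNIV (g k)"
    and lim: "\<And>x. x \<notin> N \<Longrightarrow> (\<lambda>k::nat. g k x) \<longlonglongrightarrow> F x"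
    unfolding measurable_on_def by auto
  define h where "h k x = max (- real n) (min (real n) (g k x)) * max 0 (min 1 (real n + 1 - norm x))" for k x
  have h: "continuous_on UNIV (h k)" for k
    unfolding h_def by (intro continuous_intros g)
  then have [measurable]: "h k \<in> borel_measurable borel" for k by (rule borel_measurable_continuous_onI)
  have h0: "h k x = 0" if "norm x > real n + 1" for k x using that by (simp add: h_def)
  have [measurable]: "cball (0::'a) (real n + 1) \<in> sets borel" by (rule borel_closed) simp
  have hb: "\<bar>h k x\<bar> \<le> real n" for k x
  proof -
    have "\<bar>h k x\<bar> = \<bar>max (- real n) (min (real n) (g k x))\<bar> * \<bar>max 0 (min 1 (real n + 1 - norm x))\<bar>"
      by (simp add: h_def abs_mult)
    also have "\<dots> \<le> real n * 1" by (intro mult_mono) auto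
    finally show ?thesis by simp
  qed
  have hl: "(\<lambda>k. h k x) \<longlonglongrightarrow> F x" if "x \<notin> N" for x
  proof -
    have "(\<lambda>k. h k x) \<longlonglongrightarrow> max (- real n) (min (real n) (F x)) * max 0 (min 1 (real n + 1 - norm x))"
      unfolding h_def by (intro tendsto_intros lim that)
    also have "max (- real n) (min (real n) (F x)) * max 0 (min 1 (real n + 1 - norm x)) = F x"
      using bd[of x] supp[of x] by (cases "norm x > real n") (auto simp: max_def min_def abs_le_iff)
    finally show ?thesis .
  qed
  have "(\<lambda>k. \<integral>\<^sup>+x. ennreal \<bar>F x - h k x\<bar> \<partial>lborel) \<longlonglongrightarrow> (\<integral>\<^sup>+x. 0 \<partial>(lborel :: 'a measure))"
  proof (rule nn_integral_dominated_convergence[where w = "\<lambda>x. ennreal (2 * real n) * indicator (cball (0::'a) (real n + 1)) x"])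
    show "AE x in lborel. ennreal \<bar>F x - h k x\<bar> \<le> ennreal (2 * real n) * indicator (cball (0::'a) (real n + 1)) x" for k
    proof (intro always_eventually allI)
      fix x
      show "ennreal \<bar>F x - h k x\<bar> \<le> ennreal (2 * real n) * indicator (cball (0::'a) (real n + 1)) x"
        using bd[of x] hb[of k x] supp[of x] h0[of x k] by (cases "norm x > real n + 1") (auto simp: indicator_def intro!: ennreal_leI)
    qed
    show "(\<integral>\<^sup>+x. ennreal (2 * real n) * indicator (cball (0::'a) (real n + 1)) x \<partial>lborel) < \<infinity>"
      using emeasure_lborel_cball_finite[of "0::'a" "real n + 1"]
      by (subst nn_integral_cmult_indicator) (auto simp: ennreal_mult_less_top)
    have "AE x in lborel. x \<notin> N"
      using N AE_not_in[of N lebesgue] by (simp add: negligible_iff_null_sets AE_completion_iff)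
    then show "AE x in lborel. (\<lambda>k. ennreal \<bar>F x - h k x\<bar>) \<longlonglongrightarrow> 0"
    proof eventually_elim
      case (elim x)
      have "(\<lambda>k. ennreal \<bar>F x - h k x\<bar>) \<longlonglongrightarrow> ennreal \<bar>F x - F x\<bar>"
        by (intro tendsto_ennrealI tendsto_intros hl elim)
      then show ?case by simp
    qed
  qed auto
  then have "\<forall>\<^sub>F k in sequentially. (\<integral>\<^sup>+x. ennreal \<bar>F x - h k x\<bar> \<partial>lborel) < e"
    using e by (intro order_tendstoD) auto
  then obtain k where "(\<integral>\<^sup>+x. ennreal \<bar>F x - h k x\<bar> \<partial>lborel) < e" by (auto simp: eventually_sequentially)
  then show thesis using h h0 by (intro that[of "h k"]) auto
qed

lemma compact_support_uniform:
  fixes g :: "'a::euclidean_space \<Rightarrow> real"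
  assumes g: "continuous_on UNIV g" and supp: "\<And>x. norm x > R \<Longrightarrow> g x = 0" and e: "0 < e"
  obtains d where "0 < d" "\<And>x v. norm v < d \<Longrightarrow> \<bar>g (x + v) - g x\<bar> \<le> e"
proof -
  have "uniformly_continuous_on (cball 0 (R + 2)) g"
    using g by (intro compact_uniformly_continuous continuous_on_subset[OF g]) auto
  then obtain d where d: "0 < d" "\<And>x y. x \<in> cball 0 (R + 2) \<Longrightarrow> y \<in> cball 0 (R + 2) \<Longrightarrow> dist y x < d \<Longrightarrow> dist (g y) (g x) < e"
    unfolding uniformly_continuous_on_def using e by metis
  show thesis
  proof (rule that[of "min d 1"])
    show "0 < min d 1" using d by simp
    fix x v :: 'a assume v: "norm v < min d 1"
    show "\<bar>g (x + v) - g x\<bar> \<le> e"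
    proof (cases "norm x \<le> R + 1")
      case True
      then have "norm (x + v) \<le> R + 2" using v norm_triangle_ineq[of x v] by simp
      then show ?thesis using d(2)[of x "x + v", unfolded mem_cball_0 dist_norm] True v by auto
    next
      case False
      then have "norm (x + v) > R" using v norm_diff_ineq[of x v] by simp
      then show ?thesis using False supp[of x] supp[of "x + v"] e by simp
    qed
  qed
qed

text \<open>
  Split \<open>F\<close> into a part of small \<open>L\<^sup>p\<close> norm, a part of small
  \<open>L\<^sup>1\<close> norm and a continuous function of compact support. The first two are controlled by
  \<open>osc_markov\<close>, with exponents \<open>p\<close> and 1; the last has uniformly small oscillation on
  short segments.
\<close>

lemma osc_in_measure:
  fixes F :: "'a::euclidean_space \<Rightarrow> real"
  assumes [measurable]: "F \<in> borel_measurable borel" and p: "1 \<le> p" and M: "0 < M"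
    and fin: "Lp_mass p F < \<infinity>" and \<eta>: "0 < \<eta>"
    and \<epsilon>: "\<epsilon> \<longlonglongrightarrow> 0"
  shows "(\<lambda>n. vol {x. osc M F (\<epsilon> n *\<^sub>R k) x > ennreal \<eta>}) \<longlonglongrightarrow> 0"
proof (rule order_tendstoI)
  fix e :: ennreal assume e: "0 < e"
  have \<eta>3: "0 < \<eta> / 3" using \<eta> by simp
  obtain C1 where C1: "0 \<le> C1" "\<And>F v. F \<in> borel_measurable borel \<Longrightarrow>
    vol {x. osc M F v x > ennreal (\<eta> / 3)} \<le> ennreal C1 * (\<integral>\<^sup>+x. ennreal (\<bar>F (x::'a)\<bar> powr p) \<partial>lborel)"
    by (rule osc_markov[OF p M \<eta>3, where 'a='a]) blast
  obtain C2 where C2: "0 \<le> C2" "\<And>F v. F \<in> borel_measurable borel \<Longrightarrow>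
    vol {x. osc M F v x > ennreal (\<eta> / 3)} \<le> ennreal C2 * (\<integral>\<^sup>+x. ennreal (\<bar>F (x::'a)\<bar> powr 1) \<partial>lborel)"
    by (rule osc_markov[OF order_refl M \<eta>3, where 'a='a]) blast
  obtain e' where e': "0 < e'" "e' < e" using e dense by blast
  then have "e' < top" using order.strict_trans2 top_greatest by blast
  then obtain r where r: "e' = ennreal r" "0 < r" using e'(1) by (cases e') auto
  define r1 where "r1 = r / (2 * (C1 + C2 + 1))"
  have r1: "0 < r1" using r C1 C2 by (simp add: r1_def add_nonneg_pos)
  have p0: "0 < p" and er: "0 < ennreal r1" using p r1 by auto
  obtain n F0 where F0 [measurable]: "F0 \<in> borel_measurable borel" "\<And>x. \<bar>F0 x\<bar> \<le> real n" "\<And>x. norm x > real n \<Longrightarrow> F0 x = 0"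
    "Lp_mass p (\<lambda>x. F x - F0 x) < ennreal r1"
    by (rule truncation_dense[OF assms(1) p0 fin er]) blast
  obtain g where g: "continuous_on UNIV g" "\<And>x. norm x > real n + 1 \<Longrightarrow> g x = 0"
    "(\<integral>\<^sup>+x. ennreal \<bar>F0 x - g x\<bar> \<partial>lborel) < ennreal r1"
    by (rule continuous_dense[OF F0(1) F0(2) _ er]) (rule F0(3), assumption, rule that)
  have [measurable]: "g \<in> borel_measurable borel" using g(1) by (rule borel_measurable_continuous_onI)
  have ed: "0 < \<eta> / (3 * M)" using \<eta> M by simp
  obtain d where d: "0 < d" "\<And>x v. norm v < d \<Longrightarrow> \<bar>g (x + v) - g x\<bar> \<le> \<eta> / (3 * M)"
    by (rule compact_support_uniform[OF g(1) _ ed, of "real n + 1"]) (rule g(2), assumption, rule that)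
  have "(\<lambda>n. M * (\<bar>\<epsilon> n\<bar> * norm k)) \<longlonglongrightarrow> M * (\<bar>0\<bar> * norm k)"
    by (intro tendsto_intros \<epsilon>)
  then have "\<forall>\<^sub>F n in sequentially. M * (\<bar>\<epsilon> n\<bar> * norm k) < d"
    using d by (intro order_tendstoD) auto
  then show "\<forall>\<^sub>F n in sequentially. vol {x. osc M F (\<epsilon> n *\<^sub>R k) x > ennreal \<eta>} < e"
  proof eventually_elim
    case (elim n)
    let ?v = "\<epsilon> n *\<^sub>R k"
    have og: "osc M g ?v x \<le> ennreal (\<eta> / 3)" for x
    proof -
      have "osc M g ?v x \<le> (\<integral>\<^sup>+s. ennreal (\<eta> / (3 * M)) * indicator {0..M} s \<partial>lborel)"
        unfolding osc_def
      proof (rule nn_integral_mono)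
        fix s
        have "norm (s *\<^sub>R ?v) < d" if "s \<in> {0..M}"
        proof -
          have "norm (s *\<^sub>R ?v) = s * (\<bar>\<epsilon> n\<bar> * norm k)" using that by (simp add: abs_mult)
          also have "\<dots> \<le> M * (\<bar>\<epsilon> n\<bar> * norm k)" using that by (intro mult_right_mono) auto
          finally show ?thesis using elim by simp
        qed
        then show "ennreal \<bar>g (x + s *\<^sub>R ?v) - g x\<bar> * indicator {0..M} s \<le> ennreal (\<eta> / (3 * M)) * indicator {0..M} s"
          using d(2)[of "s *\<^sub>R ?v" x] by (cases "s \<in> {0..M}") (simp_all del: scaleR_scaleR add: ennreal_leI)
      qed
      also have "\<dots> = ennreal (\<eta> / 3)"
        using M \<eta> by (simp add: nn_integral_cmult ennreal_mult[symmetric])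
      finally show ?thesis .
    qed
    have "{x. osc M F ?v x > ennreal \<eta>} \<subseteq> {x. osc M (\<lambda>x. F x - F0 x) ?v x > ennreal (\<eta> / 3)} \<union> {x. osc M (\<lambda>x. F0 x - g x) ?v x > ennreal (\<eta> / 3)}"
    proof (rule subsetI, rule ccontr)
      fix x assume x: "x \<in> {x. osc M F ?v x > ennreal \<eta>}" and "x \<notin> {x. osc M (\<lambda>x. F x - F0 x) ?v x > ennreal (\<eta> / 3)} \<union> {x. osc M (\<lambda>x. F0 x - g x) ?v x > ennreal (\<eta> / 3)}"
      then have a: "osc M (\<lambda>x. F x - F0 x) ?v x \<le> ennreal (\<eta> / 3)" "osc M (\<lambda>x. F0 x - g x) ?v x \<le> ennreal (\<eta> / 3)"
        by (auto simp: not_less)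
      have "osc M F ?v x \<le> osc M (\<lambda>x. F x - F0 x) ?v x + osc M F0 ?v x" by (rule osc_diff_le) measurable
      also have "osc M F0 ?v x \<le> osc M (\<lambda>x. F0 x - g x) ?v x + osc M g ?v x" by (rule osc_diff_le) measurable
      finally have "osc M F ?v x \<le> osc M (\<lambda>x. F x - F0 x) ?v x + (osc M (\<lambda>x. F0 x - g x) ?v x + osc M g ?v x)"
        by (simp add: add_left_mono)
      also have "\<dots> \<le> ennreal (\<eta> / 3) + (ennreal (\<eta> / 3) + ennreal (\<eta> / 3))"
        by (intro add_mono a og)
      also have "\<dots> = ennreal \<eta>" using \<eta> by (simp add: ennreal_plus[symmetric] del: ennreal_plus)
      finally show False using x by auto
    qed
    then have "vol {x. osc M F ?v x > ennreal \<eta>} \<le>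
        vol ({x. osc M (\<lambda>x. F x - F0 x) ?v x > ennreal (\<eta> / 3)} \<union> {x. osc M (\<lambda>x. F0 x - g x) ?v x > ennreal (\<eta> / 3)})"
      by (intro emeasure_mono) auto
    also have "\<dots> \<le> vol {x. osc M (\<lambda>x. F x - F0 x) ?v x > ennreal (\<eta> / 3)} + vol {x. osc M (\<lambda>x. F0 x - g x) ?v x > ennreal (\<eta> / 3)}"
      by (intro emeasure_subadditive) auto
    also have "\<dots> \<le> ennreal C1 * Lp_mass p (\<lambda>x. F x - F0 x) + ennreal C2 * Lp_mass 1 (\<lambda>x. F0 x - g x)"
      by (intro add_mono C1 C2) measurable
    also have "\<dots> \<le> ennreal C1 * ennreal r1 + ennreal C2 * ennreal r1"
      using F0(4) g(3) by (intro add_mono mult_left_mono) auto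
    also have "\<dots> = ennreal ((C1 + C2) * r1)"
      using C1 C2 r1 by (simp add: ennreal_mult[symmetric] ennreal_plus[symmetric] algebra_simps del: ennreal_plus)
    also have "\<dots> \<le> ennreal r"
    proof (rule ennreal_leI)
      have "(C1 + C2) * r1 = r / 2 * ((C1 + C2) / (C1 + C2 + 1))" by (simp add: r1_def field_simps)
      also have "\<dots> \<le> r / 2 * 1" using C1 C2 r by (intro mult_left_mono) (auto simp: divide_le_eq)
      finally show "(C1 + C2) * r1 \<le> r" using r by simp
    qed
    finally show ?case using e' r by (auto intro: le_less_trans)
  qed
qed auto

text \<open>
  Convergence in measure squeezes the level set between those of \<open>F\<close> at the thresholds
  \<open>1 - t\<close> and \<open>1 + t\<close>, up to sets of vanishing volume. Both volumes tend to that of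
  the level set at 1 as \<open>t\<close> tends to 0, since the value 1 itself is taken only on a null set.
\<close>

lemma level_set_convergence:
  fixes F :: "'a::euclidean_space \<Rightarrow> real"
  assumes b: "peano_kernel m b" and m: "1 \<le> m" and [measurable]: "F \<in> borel_measurable borel" and p: "1 \<le> p"
    and fin: "Lp_mass p F < \<infinity>" and null: "vol {x. \<bar>F x\<bar> = 1} = 0"
    and \<epsilon>: "\<epsilon> \<longlonglongrightarrow> 0"
  shows "(\<lambda>n. vol {x. \<bar>\<integral>s. b s * F (x + s *\<^sub>R (\<epsilon> n *\<^sub>R k)) \<partial>lborel\<bar> > 1}) \<longlonglongrightarrow> vol {x. \<bar>F x\<bar> > 1}"
proof -
  have [measurable]: "b \<in> borel_measurable borel" using b by (simp add: peano_kernel_def)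
  define G where "G n x = (\<integral>s. b s * F (x + s *\<^sub>R (\<epsilon> n *\<^sub>R k)) \<partial>lborel)" for n x
  have [measurable]: "G n \<in> borel_measurable borel" for n unfolding G_def by measurable
  define A where "A t = {x. \<bar>F x\<bar> > t}" for t
  have [measurable]: "A t \<in> sets borel" for t unfolding A_def by measurable
  define E where "E t n = vol {x. osc (real m) F (\<epsilon> n *\<^sub>R k) x > ennreal t}" for t n
  have E: "E t \<longlonglongrightarrow> 0" if "0 < t" for t
    unfolding E_def using osc_in_measure[OF _ p _ fin that \<epsilon>, of "real m" k] m by auto
  have GF: "\<bar>G n x - F x\<bar> \<le> t" if "\<not> osc (real m) F (\<epsilon> n *\<^sub>R k) x > ennreal t" "0 \<le> t" for n x t
    using kernel_average_minus_le_osc[OF b assms(3), of x "\<epsilon> n *\<^sub>R k"] that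
    by (metis G_def ennreal_le_iff leI order_trans)
  have up: "vol {x. \<bar>G n x\<bar> > 1} \<le> vol (A (1 - t)) + E t n" if "0 < t" for t n
  proof -
    have "{x. \<bar>G n x\<bar> > 1} \<subseteq> A (1 - t) \<union> {x. osc (real m) F (\<epsilon> n *\<^sub>R k) x > ennreal t}"
      using GF[of t n] that unfolding A_def by fastforce
    then have "vol {x. \<bar>G n x\<bar> > 1} \<le> vol (A (1 - t) \<union> {x. osc (real m) F (\<epsilon> n *\<^sub>R k) x > ennreal t})"
      by (intro emeasure_mono) auto
    also have "\<dots> \<le> vol (A (1 - t)) + E t n"
      unfolding E_def by (intro emeasure_subadditive) auto
    finally show ?thesis .
  qed
  have lo: "vol (A (1 + t)) \<le> vol {x. \<bar>G n x\<bar> > 1} + E t n" if "0 < t" for t n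
  proof -
    have "A (1 + t) \<subseteq> {x. \<bar>G n x\<bar> > 1} \<union> {x. osc (real m) F (\<epsilon> n *\<^sub>R k) x > ennreal t}"
      using GF[of t n] that unfolding A_def by fastforce
    then have "vol (A (1 + t)) \<le> vol ({x. \<bar>G n x\<bar> > 1} \<union> {x. osc (real m) F (\<epsilon> n *\<^sub>R k) x > ennreal t})"
      by (intro emeasure_mono) auto
    also have "\<dots> \<le> vol {x. \<bar>G n x\<bar> > 1} + E t n"
      unfolding E_def by (intro emeasure_subadditive) auto
    finally show ?thesis .
  qed
  have Afin: "vol (A t) < \<infinity>" if "0 < t" for t
  proof -
    have "A t \<subseteq> {x \<in> space lborel. 1 \<le> ennreal (1 / t powr p) * ennreal (\<bar>F x\<bar> powr p)}"
    proof
      fix x assume "x \<in> A t"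
      then have "t powr p \<le> \<bar>F x\<bar> powr p" using that p by (intro powr_mono2) (auto simp: A_def)
      then have "1 \<le> 1 / t powr p * \<bar>F x\<bar> powr p" using that by (simp add: field_simps)
      then have "ennreal 1 \<le> ennreal (1 / t powr p * \<bar>F x\<bar> powr p)" by (rule ennreal_leI)
      then show "x \<in> {x \<in> space lborel. 1 \<le> ennreal (1 / t powr p) * ennreal (\<bar>F x\<bar> powr p)}"
        by (simp add: ennreal_mult[symmetric])
    qed
    then have "vol (A t) \<le> vol {x \<in> space lborel. 1 \<le> ennreal (1 / t powr p) * ennreal (\<bar>F x\<bar> powr p)}"
      by (intro emeasure_mono) auto
    also have "\<dots> \<le> ennreal (1 / t powr p) * (\<integral>\<^sup>+x. ennreal (\<bar>F x\<bar> powr p) * indicator UNIV x \<partial>lborel)"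
      using nn_integral_Markov_inequality[of "\<lambda>x. ennreal (\<bar>F x\<bar> powr p)" UNIV lborel "ennreal (1 / t powr p)"] by simp
    also have "\<dots> < \<infinity>" using fin by (simp add: ennreal_mult_less_top)
    finally show ?thesis .
  qed
  have ge: "vol {x. \<bar>F x\<bar> \<ge> 1} = vol (A 1)"
  proof -
    have "vol (A 1 \<union> {x. \<bar>F x\<bar> = 1}) = vol (A 1)"
      using null by (intro emeasure_Un_null_set) (auto simp: null_sets_def)
    also have "A 1 \<union> {x. \<bar>F x\<bar> = 1} = {x. \<bar>F x\<bar> \<ge> 1}" unfolding A_def by auto
    finally show ?thesis .
  qed
  have dec: "(\<lambda>i. vol (A (1 - 1 / real (i + 2)))) \<longlonglongrightarrow> vol (A 1)"
  proof -
    have "(\<lambda>i. vol (A (1 - 1 / real (i + 2)))) \<longlonglongrightarrow> vol (\<Inter>i. A (1 - 1 / real (i + 2)))"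
    proof (rule Lim_emeasure_decseq)
      show "decseq (\<lambda>i. A (1 - 1 / real (i + 2)))"
      proof (rule decseq_SucI)
        fix i
        have "1 / real (Suc i + 2) \<le> 1 / real (i + 2)" by (intro divide_left_mono) auto
        then show "A (1 - 1 / real (Suc i + 2)) \<subseteq> A (1 - 1 / real (i + 2))" unfolding A_def by auto
      qed
      show "vol (A (1 - 1 / real (i + 2))) \<noteq> \<infinity>" for i
        using Afin[of "1 - 1 / real (i + 2)"] by (auto simp: field_simps)
    qed auto
    also have "(\<Inter>i. A (1 - 1 / real (i + 2))) = {x. \<bar>F x\<bar> \<ge> 1}"
    proof (intro set_eqI iffI)
      fix x assume x: "x \<in> (\<Inter>i. A (1 - 1 / real (i + 2)))"
      have "(\<lambda>i. 1 - 1 / real (i + 2)) \<longlonglongrightarrow> 1 - 0"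
        by (intro tendsto_intros LIMSEQ_ignore_initial_segment[OF lim_1_over_n])
      then have "1 - 0 \<le> \<bar>F x\<bar>"
        using x by (intro LIMSEQ_le_const2[where X = "\<lambda>i. 1 - 1 / real (i + 2)"]) (auto simp: A_def intro: less_imp_le)
      then show "x \<in> {x. \<bar>F x\<bar> \<ge> 1}" by simp
    qed (auto simp: A_def elim!: less_le_trans[rotated])
    finally show ?thesis using ge by simp
  qed
  have inc: "(\<lambda>i. vol (A (1 + 1 / real (i + 2)))) \<longlonglongrightarrow> vol (A 1)"
  proof -
    have "(\<lambda>i. vol (A (1 + 1 / real (i + 2)))) \<longlonglongrightarrow> vol (\<Union>i. A (1 + 1 / real (i + 2)))"
    proof (rule Lim_emeasure_incseq)
      show "incseq (\<lambda>i. A (1 + 1 / real (i + 2)))"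
      proof (rule incseq_SucI)
        fix i
        have "1 / real (Suc i + 2) \<le> 1 / real (i + 2)" by (intro divide_left_mono) auto
        then show "A (1 + 1 / real (i + 2)) \<subseteq> A (1 + 1 / real (Suc i + 2))" unfolding A_def by auto
      qed
    qed auto
    also have "(\<Union>i. A (1 + 1 / real (i + 2))) = A 1"
    proof (intro set_eqI iffI)
      fix x assume "x \<in> A 1"
      then have x: "1 < \<bar>F x\<bar>" by (simp add: A_def)
      have "(\<lambda>i. 1 + 1 / real (i + 2)) \<longlonglongrightarrow> 1 + 0"
        by (intro tendsto_intros LIMSEQ_ignore_initial_segment[OF lim_1_over_n])
      then have "\<forall>\<^sub>F i in sequentially. 1 + 1 / real (i + 2) < \<bar>F x\<bar>" using x by (intro order_tendstoD) auto
      then show "x \<in> (\<Union>i. A (1 + 1 / real (i + 2)))" by (auto simp: A_def eventually_sequentially)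
    qed (auto simp: A_def elim!: le_less_trans[rotated])
    finally show ?thesis .
  qed
  have "(\<lambda>n. vol {x. \<bar>G n x\<bar> > 1}) \<longlonglongrightarrow> vol (A 1)"
  proof (rule order_tendstoI)
    fix y assume "vol (A 1) < y"
    then obtain i where i: "vol (A (1 - 1 / real (i + 2))) < y"
      using order_tendstoD(2)[OF dec] by (auto simp: eventually_sequentially)
    have "(\<lambda>n. vol (A (1 - 1 / real (i + 2))) + E (1 / real (i + 2)) n) \<longlonglongrightarrow> vol (A (1 - 1 / real (i + 2))) + 0"
      by (intro tendsto_intros E) auto
    then have "\<forall>\<^sub>F n in sequentially. vol (A (1 - 1 / real (i + 2))) + E (1 / real (i + 2)) n < y"
      using i by (intro order_tendstoD) auto
    then show "\<forall>\<^sub>F n in sequentially. vol {x. \<bar>G n x\<bar> > 1} < y"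
    proof eventually_elim
      case (elim n)
      have "vol {x. \<bar>G n x\<bar> > 1} \<le> vol (A (1 - 1 / real (i + 2))) + E (1 / real (i + 2)) n"
        by (rule up) simp
      then show ?case using elim by (rule le_less_trans)
    qed
  next
    fix y assume "y < vol (A 1)"
    then obtain i where i: "y < vol (A (1 + 1 / real (i + 2)))"
      using order_tendstoD(1)[OF inc] by (auto simp: eventually_sequentially)
    have "(\<lambda>n. vol (A (1 + 1 / real (i + 2))) - E (1 / real (i + 2)) n) \<longlonglongrightarrow> vol (A (1 + 1 / real (i + 2))) - 0"
      using Afin[of "1 + 1 / real (i + 2)"] by (intro tendsto_diff_ennreal tendsto_intros E) (auto simp: add_pos_pos)
    then have "\<forall>\<^sub>F n in sequentially. y < vol (A (1 + 1 / real (i + 2))) - E (1 / real (i + 2)) n"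
      using i by (intro order_tendstoD) auto
    then show "\<forall>\<^sub>F n in sequentially. y < vol {x. \<bar>G n x\<bar> > 1}"
    proof eventually_elim
      case (elim n)
      have "vol (A (1 + 1 / real (i + 2))) - E (1 / real (i + 2)) n \<le> vol {x. \<bar>G n x\<bar> > 1}"
        using lo[of "1 / real (i + 2)" n] Afin[of "1 + 1 / real (i + 2)"]
        by (auto simp: ennreal_minus_le_iff add.commute add_pos_pos)
      with elim show ?case by (rule less_le_trans)
    qed
  qed
  then show ?thesis by (simp add: G_def A_def)
qed

section \<open>The rescaled integral and its limit value\<close>

text \<open>
  Each summand is at most the largest one, whose \<open>p\<close>-th power is at most the sum of all
  \<open>p\<close>-th powers.
\<close>

lemma sum_powr_le:
  fixes a :: "'i \<Rightarrow> real"
  assumes "finite I" and a: "\<And>i. i \<in> I \<Longrightarrow> 0 \<le> a i" and p: "0 < p"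
  shows "(\<Sum>i\<in>I. a i) powr p \<le> real (card I) powr p * (\<Sum>i\<in>I. a i powr p)"
proof (cases "I = {}")
  case False
  define M where "M = Max (a ` I)"
  have le: "a i \<le> M" if "i \<in> I" for i using that assms by (simp add: M_def)
  have "M \<in> a ` I" unfolding M_def using False assms by (intro Max_in) auto
  then obtain j where j: "j \<in> I" "a j = M" by blast
  have "(\<Sum>i\<in>I. a i) powr p \<le> (real (card I) * M) powr p"
    using sum_bounded_above[of I a M] le a p by (intro powr_mono2 sum_nonneg) auto
  also have "\<dots> = real (card I) powr p * a j powr p" using j a by (simp add: powr_mult)
  also have "a j powr p \<le> (\<Sum>i\<in>I. a i powr p)" using j assms by (intro member_le_sum) auto
  finally show ?thesis by (simp add: mult_left_mono)
qed simp

lemma dir_power_scale: "dir_power (t *\<^sub>R h) is = t ^ length is * dir_power h is"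
  by (induction "is") (simp_all add: dir_power_def mult_ac)

lemma dir_power_bound: "\<bar>dir_power h is\<bar> \<le> norm h ^ length is"
proof (induction "is")
  case (Cons i "is")
  have "\<bar>h $ i\<bar> * \<bar>dir_power h is\<bar> \<le> norm h * norm h ^ length is"
    using Cons component_le_norm_cart[of h i] by (intro mult_mono) auto
  then show ?case by (simp add: dir_power_def abs_mult)
qed (simp add: dir_power_def)

lemma measurable_dir_power [measurable]: "(\<lambda>h. dir_power h is) \<in> borel_measurable borel"
  unfolding dir_power_def by (induction "is") (simp_all add: borel_measurable_times)

text \<open>
  The situation of the theorem after passing to Borel representatives of \<open>f\<close> and of its weak
  derivatives of order \<open>m\<close>.
\<close>

locale sobolev_setting = convex_body K for K :: "(real ^ 'n) set" +
  fixes m :: nat and p :: real and f :: "real ^ 'n \<Rightarrow> real" and g :: "'n list \<Rightarrow> real ^ 'n \<Rightarrow> real"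
  assumes m: "1 \<le> m" and p: "1 < p" and f: "loc_int f"
    and g: "\<And>is. length is = m \<Longrightarrow> loc_int (g is)"
    and weak: "\<And>is. length is = m \<Longrightarrow> has_weak_partials f is (g is)"
    and g_fin: "\<And>is. length is = m \<Longrightarrow> Lp_mass p (g is) < \<infinity>"
begin

text \<open>
  The value \<open>D\<^sup>m f(x)(h, \<dots>, h)\<close>.
\<close>

definition F :: "real ^ 'n \<Rightarrow> real ^ 'n \<Rightarrow> real" where
  "F h x = (\<Sum>is\<in>{is. length is = m}. dir_power h is * g is x)"

text \<open>
  The exponent of the norm in the weight \<open>w\<close>.
\<close>

definition a :: real where "a = real CARD('n) + real m * p"

definition w :: "real ^ 'n \<Rightarrow> ennreal" where "w k = ennreal (1 / norm_of_ball K k powr a)"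

abbreviation F_level :: "real ^ 'n \<Rightarrow> ennreal" where "F_level k \<equiv> vol {x. \<bar>F k x\<bar> > 1}"

text \<open>
  By homogeneity, \<open>t ^ m * \<bar>F k x\<bar>\<close> is the value of \<open>\<bar>F\<bar>\<close> in
  direction \<open>t k\<close>.
\<close>

abbreviation hit :: "real set \<Rightarrow> real ^ 'n \<Rightarrow> real ^ 'n \<Rightarrow> real \<Rightarrow> ennreal" where
  "hit S k x t \<equiv> indicator {t. 0 < t \<and> t ^ m * \<bar>F k x\<bar> \<in> S} t"

lemma a_pos: "0 < a" using m p by (simp add: a_def add_nonneg_pos)

lemma measurable_interior [measurable]: "interior K \<in> sets borel"
  by (rule borel_open) simp

lemma measurable_w [measurable]: "w \<in> borel_measurable borel"
  unfolding w_def by measurable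

lemma measurable_F_pair [measurable]: "(\<lambda>(h, x). F h x) \<in> borel_measurable (borel \<Otimes>\<^sub>M borel)"
proof -
  have [measurable]: "g is \<in> borel_measurable borel" if "length is = m" for "is"
    using g[OF that] by (rule loc_int_measurable)
  show ?thesis unfolding F_def case_prod_beta
    by (intro borel_measurable_sum borel_measurable_times) (auto intro!: measurable_compose[OF measurable_fst] measurable_compose[OF measurable_snd])
qed

lemma measurable_F_compose [measurable (raw)]:
  assumes [measurable]: "h \<in> borel_measurable M" "u \<in> borel_measurable M"
  shows "(\<lambda>z. F (h z) (u z)) \<in> borel_measurable M"
  using measurable_compose[OF _ measurable_F_pair, of "\<lambda>z. (h z, u z)" M] by simp

lemma F_scale: "F (t *\<^sub>R h) x = t ^ m * F h x"
  by (simp add: F_def dir_power_scale sum_distrib_left mult.assoc)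

text \<open>
  A finite bound for the \<open>p\<close>-th power of the \<open>L\<^sup>p\<close> norm of \<open>F h\<close>,
  uniform over unit vectors \<open>h\<close>.
\<close>

definition total :: ennreal where
  "total = ennreal (real (card {is :: 'n list. length is = m}) powr p) * (\<Sum>is\<in>{is. length is = m}. \<integral>\<^sup>+x. ennreal (\<bar>g is x\<bar> powr p) \<partial>lborel)"

lemma total_finite: "total < \<infinity>"
  using g_fin finite_lists_of_length[of m, where 'n = 'n] by (auto simp: total_def ennreal_mult_less_top)

lemma F_Lp_bound: "Lp_mass p (F h) \<le> ennreal ((norm h ^ m) powr p) * total"
proof -
  let ?L = "{is :: 'n list. length is = m}"
  let ?C = "real (card ?L) powr p"
  have fin: "finite ?L" by (rule finite_lists_of_length)
  have gm: "(\<lambda>x. ennreal (\<bar>g is x\<bar> powr p)) \<in> borel_measurable lborel" if "is \<in> ?L" for "is"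
  proof -
    have [measurable]: "g is \<in> borel_measurable borel" using that g loc_int_measurable by auto
    show ?thesis by measurable
  qed
  have "Lp_mass p (F h) \<le>
    (\<integral>\<^sup>+x. ennreal ((norm h ^ m) powr p) * (ennreal ?C * (\<Sum>is\<in>?L. ennreal (\<bar>g is x\<bar> powr p))) \<partial>lborel)"
  proof (rule nn_integral_mono)
    fix x
    have "\<bar>F h x\<bar> \<le> (\<Sum>is\<in>?L. \<bar>dir_power h is * g is x\<bar>)" unfolding F_def by (rule sum_abs)
    also have "\<dots> \<le> (\<Sum>is\<in>?L. norm h ^ m * \<bar>g is x\<bar>)"
      using dir_power_bound[of h] by (intro sum_mono) (auto simp: abs_mult intro!: mult_right_mono)
    finally have "\<bar>F h x\<bar> powr p \<le> (norm h ^ m * (\<Sum>is\<in>?L. \<bar>g is x\<bar>)) powr p"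
      using p by (intro powr_mono2) (auto simp: sum_distrib_left)
    also have "\<dots> = (norm h ^ m) powr p * (\<Sum>is\<in>?L. \<bar>g is x\<bar>) powr p"
      by (simp add: powr_mult sum_nonneg)
    also have "\<dots> \<le> (norm h ^ m) powr p * (?C * (\<Sum>is\<in>?L. \<bar>g is x\<bar> powr p))"
      using fin p by (intro mult_left_mono sum_powr_le) auto
    finally have "ennreal (\<bar>F h x\<bar> powr p) \<le> ennreal ((norm h ^ m) powr p * (?C * (\<Sum>is\<in>?L. \<bar>g is x\<bar> powr p)))"
      by (rule ennreal_leI)
    also have "\<dots> = ennreal ((norm h ^ m) powr p) * (ennreal ?C * (\<Sum>is\<in>?L. ennreal (\<bar>g is x\<bar> powr p)))"
      by (simp add: ennreal_mult sum_nonneg)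
    finally show "ennreal (\<bar>F h x\<bar> powr p) \<le> ennreal ((norm h ^ m) powr p) * (ennreal ?C * (\<Sum>is\<in>?L. ennreal (\<bar>g is x\<bar> powr p)))" .
  qed
  also have "\<dots> = ennreal ((norm h ^ m) powr p) * total"
    unfolding total_def using gm
    by (subst nn_integral_cmult, simp add: borel_measurable_sum, subst nn_integral_cmult, simp add: borel_measurable_sum, subst nn_integral_sum) auto
  finally show ?thesis .
qed

lemma F_Lp: "Lp_mass p (F h) < \<infinity>"
  using F_Lp_bound[of h] total_finite
  by (auto simp: ennreal_mult_less_top intro: le_less_trans)

lemma cone:
  assumes [measurable]: "u \<in> borel_measurable borel"
  shows "(\<integral>\<^sup>+k. w k * u k \<partial>lborel) = (\<integral>\<^sup>+k. (\<integral>\<^sup>+t. ennreal (a * t powr (- (real m * p) - 1)) * u (t *\<^sub>R k) * indicator {0<..} t \<partial>lborel)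
    * indicator (interior K) k \<partial>lborel)"
  using cone_integral[OF measurable_norm assms norm_scale norm_pos a_pos]
  by (simp add: w_def unit_ball_eq a_def)

text \<open>
  The cone formula for volumes of level sets of \<open>F\<close>: homogeneity turns the integral over the multiple
  \<open>t\<close> of \<open>k\<close> into an elementary integral for each single \<open>x\<close>.
\<close>

lemma level_set_cone:
  assumes [measurable]: "S \<in> sets borel"
  shows "(\<integral>\<^sup>+k. w k * vol {x. \<bar>F k x\<bar> \<in> S} \<partial>lborel)
    = (\<integral>\<^sup>+k. (\<integral>\<^sup>+x. \<integral>\<^sup>+t. ennreal (a * t powr (- (real m * p) - 1)) * hit S k x t \<partial>lborel \<partial>lborel)
    * indicator (interior K) k \<partial>lborel)"
proof -
  have meas: "(\<lambda>k. vol {x. \<bar>F k x\<bar> \<in> S}) \<in> borel_measurable borel"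
    by (rule lborel.measurable_emeasure) measurable
  show ?thesis
    unfolding cone[OF meas]
  proof (rule nn_integral_cong)
    fix k :: "real ^ 'n"
    have "(\<integral>\<^sup>+t. ennreal (a * t powr (- (real m * p) - 1)) * vol {x. \<bar>F (t *\<^sub>R k) x\<bar> \<in> S} * indicator {0<..} t \<partial>lborel)
      = (\<integral>\<^sup>+t. \<integral>\<^sup>+x. ennreal (a * t powr (- (real m * p) - 1)) * hit S k x t \<partial>lborel \<partial>lborel)"
    proof (rule nn_integral_cong)
      fix t :: real
      show "ennreal (a * t powr (- (real m * p) - 1)) * vol {x. \<bar>F (t *\<^sub>R k) x\<bar> \<in> S} * indicator {0<..} t
        = (\<integral>\<^sup>+x. ennreal (a * t powr (- (real m * p) - 1)) * hit S k x t \<partial>lborel)"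
      proof (cases "0 < t")
        case True
        have "(\<integral>\<^sup>+x. ennreal (a * t powr (- (real m * p) - 1)) * hit S k x t \<partial>lborel)
          = (\<integral>\<^sup>+x. ennreal (a * t powr (- (real m * p) - 1)) * indicator {x. \<bar>F (t *\<^sub>R k) x\<bar> \<in> S} x \<partial>lborel)"
          using True by (intro nn_integral_cong) (simp add: indicator_def F_scale abs_mult)
        also have "\<dots> = ennreal (a * t powr (- (real m * p) - 1)) * vol {x. \<bar>F (t *\<^sub>R k) x\<bar> \<in> S}"
          by (rule nn_integral_cmult_indicator) measurable
        finally show ?thesis using True by simp
      qed simp
    qed
    also have "\<dots> = (\<integral>\<^sup>+x. \<integral>\<^sup>+t. ennreal (a * t powr (- (real m * p) - 1)) * hit S k x t \<partial>lborel \<partial>lborel)"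
      by (rule lborel_pair.Fubini') measurable
    finally show "(\<integral>\<^sup>+t. ennreal (a * t powr (- (real m * p) - 1)) * vol {x. \<bar>F (t *\<^sub>R k) x\<bar> \<in> S} * indicator {0<..} t \<partial>lborel) * indicator (interior K) k
      = (\<integral>\<^sup>+x. \<integral>\<^sup>+t. ennreal (a * t powr (- (real m * p) - 1)) * hit S k x t \<partial>lborel \<partial>lborel) * indicator (interior K) k"
      by simp
  qed
qed

text \<open>
  On a ray \<open>t k\<close> the function \<open>t ^ m * \<bar>F k x\<bar>\<close> takes the value 1 at most
  once, so the cone formula gives 0.
\<close>

lemma AE_level_null: "AE k in lborel. w k * vol {x. \<bar>F k x\<bar> = 1} = 0"
proof -
  have z: "(\<integral>\<^sup>+t. ennreal (a * t powr (- (real m * p) - 1)) * hit {1} k x t \<partial>lborel) = 0" for k x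
  proof -
    have "{t. 0 < t \<and> t ^ m * \<bar>F k x\<bar> \<in> {1}} \<subseteq> {(1 / \<bar>F k x\<bar>) powr (1 / real m)}"
    proof
      fix t assume t: "t \<in> {t. 0 < t \<and> t ^ m * \<bar>F k x\<bar> \<in> {1}}"
      then have e: "t ^ m * \<bar>F k x\<bar> = 1" by simp
      then have "\<bar>F k x\<bar> \<noteq> 0" by (metis mult_zero_right zero_neq_one)
      with e have "1 / \<bar>F k x\<bar> = t ^ m" by (metis nonzero_divide_eq_eq)
      also have "\<dots> = t powr real m" using t by (simp add: powr_realpow)
      finally have "(1 / \<bar>F k x\<bar>) powr (1 / real m) = (t powr real m) powr (1 / real m)" by simp
      also have "\<dots> = t" using t m by (simp add: powr_powr)
      finally show "t \<in> {(1 / \<bar>F k x\<bar>) powr (1 / real m)}" by simp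
    qed
    then have sub: "hit {1} k x t \<le> (indicator {(1 / \<bar>F k x\<bar>) powr (1 / real m)} t :: ennreal)" for t
      by (auto simp: indicator_def)
    have "AE t in lborel. ennreal (a * t powr (- (real m * p) - 1)) * hit {1} k x t = 0"
      using AE_lborel_singleton[of "(1 / \<bar>F k x\<bar>) powr (1 / real m)"]
    proof eventually_elim
      case (elim t)
      with sub[of t] show ?case by (simp add: indicator_def split: if_splits)
    qed
    then show ?thesis by (subst nn_integral_0_iff_AE) measurable
  qed
  have "(\<integral>\<^sup>+k. w k * vol {x. \<bar>F k x\<bar> \<in> {1}} \<partial>lborel) = 0"
    by (subst level_set_cone) (simp_all only: z, simp_all)
  moreover have [measurable]: "(\<lambda>k. vol {x. \<bar>F k x\<bar> \<in> {1}}) \<in> borel_measurable borel"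
    by (rule lborel.measurable_emeasure) measurable
  ultimately have "AE k in lborel. w k * vol {x. \<bar>F k x\<bar> \<in> {1}} = 0"
    by (subst (asm) nn_integral_0_iff_AE) simp_all
  then show ?thesis by simp
qed

text \<open>
  The cone formula with \<open>power_weight_integral\<close> for \<open>q = p\<close>.
\<close>

lemma limit_value:
  "(\<integral>\<^sup>+k. w k * F_level k \<partial>lborel)
    = ennreal (a / (real m * p)) * (\<integral>\<^sup>+x. (\<integral>\<^sup>+k. ennreal (\<bar>F k x\<bar> powr p) * indicator (interior K) k \<partial>lborel) \<partial>lborel)"
proof -
  have inner: "(\<integral>\<^sup>+t. ennreal (a * t powr (- (real m * p) - 1)) * hit {1<..} k x t \<partial>lborel)
    = ennreal (a / (real m * p)) * ennreal (\<bar>F k x\<bar> powr p)" for k x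
  proof -
    have "(\<integral>\<^sup>+t. ennreal (a * t powr (- (real m * p) - 1)) * hit {1<..} k x t \<partial>lborel)
      = (\<integral>\<^sup>+t. ennreal a * (ennreal (t powr (- (real m * p) - 1)) * indicator {t. 0 < t \<and> 1 < t ^ m * \<bar>F k x\<bar>} t) \<partial>lborel)"
      using a_pos by (intro nn_integral_cong) (simp add: ennreal_mult mult.assoc)
    also have "\<dots> = ennreal a * ennreal (\<bar>F k x\<bar> powr p / (real m * p))"
      using m p by (subst nn_integral_cmult, measurable, subst power_weight_integral) auto
    also have "\<dots> = ennreal (a / (real m * p)) * ennreal (\<bar>F k x\<bar> powr p)"
      using a_pos m p by (simp add: ennreal_mult[symmetric])
    finally show ?thesis .
  qed
  have "(\<integral>\<^sup>+k. w k * vol {x. \<bar>F k x\<bar> \<in> {1<..}} \<partial>lborel)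
    = (\<integral>\<^sup>+k. (\<integral>\<^sup>+x. ennreal (a / (real m * p)) * ennreal (\<bar>F k x\<bar> powr p) \<partial>lborel) * indicator (interior K) k \<partial>lborel)"
    by (subst level_set_cone) (simp_all only: inner, simp_all)
  also have "\<dots> = (\<integral>\<^sup>+k. \<integral>\<^sup>+x. ennreal (a / (real m * p)) * (ennreal (\<bar>F k x\<bar> powr p) * indicator (interior K) k) \<partial>lborel \<partial>lborel)"
    by (simp add: nn_integral_multc nn_integral_cmult mult.assoc)
  also have "\<dots> = (\<integral>\<^sup>+x. \<integral>\<^sup>+k. ennreal (a / (real m * p)) * (ennreal (\<bar>F k x\<bar> powr p) * indicator (interior K) k) \<partial>lborel \<partial>lborel)"
    by (rule lborel_pair.Fubini') measurable
  also have "\<dots> = ennreal (a / (real m * p)) * (\<integral>\<^sup>+x. (\<integral>\<^sup>+k. ennreal (\<bar>F k x\<bar> powr p) * indicator (interior K) k \<partial>lborel) \<partial>lborel)"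
    by (simp add: nn_integral_cmult)
  finally show ?thesis by simp
qed

end

section \<open>Domination and passage to the limit\<close>

context sobolev_setting
begin

definition absF :: "real ^ 'n \<Rightarrow> real ^ 'n \<Rightarrow> ennreal" where
  "absF k x = ennreal \<bar>F k x\<bar>"

lemma measurable_absF_pair: "(\<lambda>(k, x). absF k x) \<in> borel_measurable (borel \<Otimes>\<^sub>M borel)"
  unfolding absF_def by measurable

lemma measurable_absF [measurable]: "absF k \<in> borel_measurable borel"
  unfolding absF_def by measurable

lemma absF_scale: "0 < t \<Longrightarrow> absF (t *\<^sub>R k) x = ennreal (t ^ m) * absF k x"
  by (simp add: absF_def F_scale abs_mult ennreal_mult)

abbreviation max_level :: "real \<Rightarrow> real ^ 'n \<Rightarrow> ennreal" where
  "max_level c k \<equiv> vol {x. ennreal c * maxf (absF k) k x > 1}"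

lemma measurable_max_levels:
  "(\<lambda>k. max_level c k) \<in> borel_measurable borel"
proof -
  note measurable_maxf_pair[OF measurable_absF_pair, measurable]
  show ?thesis by (rule lborel.measurable_emeasure) measurable
qed

text \<open>
  By homogeneity the level set in direction \<open>t k\<close> lies in a level set in direction \<open>k\<close> at
  a height proportional to \<open>t powr (- m)\<close>, to which the cut weak type inequality applies.
\<close>

lemma max_level_bound:
  assumes c: "0 < c" and t: "0 < t"
  shows "max_level c (t *\<^sub>R k)
    \<le> ennreal (4 * c * t ^ m) * (\<integral>\<^sup>+x. absF k x * indicator {x. 1 < t ^ m * (4 * c * \<bar>F k x\<bar>)} x \<partial>lborel)"
proof -
  \<comment> \<open>Half of the height \<open>1 / (2 * c * t ^ m)\<close>; the factor 2 in it comes from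
    \<open>maxf_scale\<close>.\<close>
  define l where "l = 1 / (4 * c * t ^ m)"
  have l: "0 < l" using c t by (simp add: l_def)
  have cl: "2 * c * t ^ m * (2 * l) = 1" using c t by (simp add: l_def field_simps)
  have "{x. ennreal c * maxf (absF (t *\<^sub>R k)) (t *\<^sub>R k) x > 1} \<subseteq> {x. maxf (absF k) k x > 2 * ennreal l}"
  proof clarify
    fix x assume "1 < ennreal c * maxf (absF (t *\<^sub>R k)) (t *\<^sub>R k) x"
    also have "\<dots> \<le> ennreal c * (2 * maxf (absF (t *\<^sub>R k)) k x)"
      using t by (intro mult_left_mono maxf_scale) auto
    also have "maxf (absF (t *\<^sub>R k)) k x = ennreal (t ^ m) * maxf (absF k) k x"
    proof -
      have "absF (t *\<^sub>R k) = (\<lambda>x. ennreal (t ^ m) * absF k x)" using t by (intro ext absF_scale)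
      then show ?thesis by (simp only: maxf_cmult[OF measurable_absF])
    qed
    also have "ennreal c * (2 * (ennreal (t ^ m) * maxf (absF k) k x)) = ennreal (2 * c * t ^ m) * maxf (absF k) k x"
      using c t by (simp add: ennreal_mult mult_ac)
    finally have *: "1 < ennreal (2 * c * t ^ m) * maxf (absF k) k x" .
    show "2 * ennreal l < maxf (absF k) k x"
    proof (rule ccontr)
      assume "\<not> 2 * ennreal l < maxf (absF k) k x"
      then have "ennreal (2 * c * t ^ m) * maxf (absF k) k x \<le> ennreal (2 * c * t ^ m) * (2 * ennreal l)"
        by (intro mult_left_mono) (auto simp: not_less)
      also have "\<dots> = ennreal (2 * c * t ^ m * (2 * l))"
      proof -
        have "2 * ennreal l = ennreal (2 * l)" using l by (simp add: ennreal_mult)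
        then show ?thesis using c t l by (simp only:) (intro ennreal_mult[symmetric], auto)
      qed
      finally show False using * cl by simp
    qed
  qed
  then have "max_level c (t *\<^sub>R k) \<le> vol {x. maxf (absF k) k x > 2 * ennreal l}"
    by (intro emeasure_mono) auto
  also have "\<dots> = ennreal (1 / l) * (ennreal l * vol {x. maxf (absF k) k x > 2 * ennreal l})"
    using l by (simp add: mult.assoc[symmetric] ennreal_mult[symmetric])
  also have "\<dots> \<le> ennreal (1 / l) * (\<integral>\<^sup>+x. absF k x * indicator {x. absF k x > ennreal l} x \<partial>lborel)"
    using l by (intro mult_left_mono maximal_weak_type_cut) auto
  also have "(\<lambda>x. indicator {x. absF k x > ennreal l} x :: ennreal) = indicator {x. 1 < t ^ m * (4 * c * \<bar>F k x\<bar>)}"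
  proof (intro ext)
    fix x
    have "absF k x > ennreal l \<longleftrightarrow> l < \<bar>F k x\<bar>"
      using l by (simp add: absF_def ennreal_less_iff)
    also have "\<dots> \<longleftrightarrow> 1 < t ^ m * (4 * c * \<bar>F k x\<bar>)" using c t by (simp add: l_def field_simps)
    finally show "indicator {x. absF k x > ennreal l} x = (indicator {x. 1 < t ^ m * (4 * c * \<bar>F k x\<bar>)} x :: ennreal)"
      by (simp add: indicator_def)
  qed
  also have "1 / l = 4 * c * t ^ m" by (simp add: l_def)
  finally show ?thesis .
qed

text \<open>
  By the cone formula and \<open>max_level_bound\<close> the integral reduces to
  \<open>power_weight_integral\<close> with \<open>q = p - 1\<close>, which is positive because
  \<open>p > 1\<close>. One further factor \<open>\<bar>F k x\<bar>\<close> comes from the weak type inequality,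
  so that the \<open>p\<close>-th power appears, and \<open>F_Lp_bound\<close> bounds the rest uniformly on
  \<open>K\<close>.
\<close>

lemma domination:
  assumes c: "0 < c"
  shows "(\<integral>\<^sup>+k. w k * max_level c k \<partial>lborel) < \<infinity>"
proof -
  define C where "C = (4 * c * a) * ((4 * c) powr (p - 1) / (real m * (p - 1)))"
  have C: "0 \<le> C" using c a_pos m p by (simp add: C_def)
  let ?W = "\<lambda>t. ennreal (a * t powr (- (real m * p) - 1))"
  have pw: "ennreal (4 * c * t ^ m) * ?W t = ennreal (4 * c * a) * ennreal (t powr (- (real m * (p - 1)) - 1))" if "0 < t" for t
  proof -
    have "t ^ m * t powr (- (real m * p) - 1) = t powr (- (real m * (p - 1)) - 1)"
      using that by (simp add: powr_realpow[symmetric] powr_add[symmetric] algebra_simps)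
    then show ?thesis using c that a_pos by (simp add: ennreal_mult[symmetric] mult_ac)
  qed
  have inner: "(\<integral>\<^sup>+t. ?W t * max_level c (t *\<^sub>R k) * indicator {0<..} t \<partial>lborel)
    \<le> ennreal C * Lp_mass p (F k)" for k
  proof -
    let ?I = "\<lambda>t x. absF k x * (ennreal (4 * c * a) * (ennreal (t powr (- (real m * (p - 1)) - 1)) * indicator {t. 0 < t \<and> 1 < t ^ m * (4 * c * \<bar>F k x\<bar>)} t))"
    have "(\<integral>\<^sup>+t. ?W t * max_level c (t *\<^sub>R k) * indicator {0<..} t \<partial>lborel)
      \<le> (\<integral>\<^sup>+t. \<integral>\<^sup>+x. ?I t x \<partial>lborel \<partial>lborel)"
    proof (rule nn_integral_mono)
      fix t :: real
      show "?W t * max_level c (t *\<^sub>R k) * indicator {0<..} t \<le> (\<integral>\<^sup>+x. ?I t x \<partial>lborel)"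
      proof (cases "0 < t")
        case True
        have "?W t * max_level c (t *\<^sub>R k)
          \<le> ?W t * (ennreal (4 * c * t ^ m) * (\<integral>\<^sup>+x. absF k x * indicator {x. 1 < t ^ m * (4 * c * \<bar>F k x\<bar>)} x \<partial>lborel))"
          using c True by (intro mult_left_mono max_level_bound) auto
        also have "\<dots> = (ennreal (4 * c * t ^ m) * ?W t) * (\<integral>\<^sup>+x. absF k x * indicator {x. 1 < t ^ m * (4 * c * \<bar>F k x\<bar>)} x \<partial>lborel)"
          by (simp only: mult_ac)
        also have "\<dots> = (\<integral>\<^sup>+x. (ennreal (4 * c * a) * ennreal (t powr (- (real m * (p - 1)) - 1))) * (absF k x * indicator {x. 1 < t ^ m * (4 * c * \<bar>F k x\<bar>)} x) \<partial>lborel)"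
          unfolding pw[OF True] by (rule nn_integral_cmult[symmetric]) measurable
        also have "\<dots> = (\<integral>\<^sup>+x. ?I t x \<partial>lborel)"
          using True by (intro nn_integral_cong) (simp add: indicator_def mult_ac)
        finally show ?thesis using True by simp
      qed simp
    qed
    also have "\<dots> = (\<integral>\<^sup>+x. \<integral>\<^sup>+t. ?I t x \<partial>lborel \<partial>lborel)"
      unfolding absF_def by (rule lborel_pair.Fubini') measurable
    also have "\<dots> = (\<integral>\<^sup>+x. ennreal C * ennreal (\<bar>F k x\<bar> powr p) \<partial>lborel)"
    proof (rule nn_integral_cong)
      fix x
      have "(\<integral>\<^sup>+t. ?I t x \<partial>lborel) = absF k x * (ennreal (4 * c * a) * (\<integral>\<^sup>+t. ennreal (t powr (- (real m * (p - 1)) - 1)) * indicator {t. 0 < t \<and> 1 < t ^ m * (4 * c * \<bar>F k x\<bar>)} t \<partial>lborel))"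
        by (subst nn_integral_cmult, measurable, subst nn_integral_cmult) auto
      also have "\<dots> = absF k x * (ennreal (4 * c * a) * ennreal ((4 * c * \<bar>F k x\<bar>) powr (p - 1) / (real m * (p - 1))))"
        using c p m by (subst power_weight_integral) auto
      also have "\<dots> = ennreal (\<bar>F k x\<bar> * ((4 * c * a) * ((4 * c * \<bar>F k x\<bar>) powr (p - 1) / (real m * (p - 1)))))"
        using c a_pos m p by (simp add: absF_def ennreal_mult[symmetric])
      also have "\<bar>F k x\<bar> * ((4 * c * a) * ((4 * c * \<bar>F k x\<bar>) powr (p - 1) / (real m * (p - 1)))) = C * \<bar>F k x\<bar> powr p"
      proof (cases "F k x = 0")
        case False
        have "\<bar>F k x\<bar> powr p = \<bar>F k x\<bar> powr (1 + (p - 1))" by simp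
        also have "\<dots> = \<bar>F k x\<bar> * \<bar>F k x\<bar> powr (p - 1)" using False by (simp only: powr_add) simp
        finally show ?thesis using c by (simp add: C_def powr_mult)
      qed (use p in simp)
      finally show "(\<integral>\<^sup>+t. ?I t x \<partial>lborel) = ennreal C * ennreal (\<bar>F k x\<bar> powr p)"
        using C by (simp add: ennreal_mult)
    qed
    also have "\<dots> = ennreal C * Lp_mass p (F k)"
      by (rule nn_integral_cmult) measurable
    finally show ?thesis .
  qed
  obtain B where B: "B > 0" "\<And>k. k \<in> K \<Longrightarrow> norm k \<le> B" using bdd by (auto simp: bounded_pos)
  have "(\<integral>\<^sup>+k. w k * max_level c k \<partial>lborel)
    \<le> (\<integral>\<^sup>+k. (ennreal C * (ennreal ((B ^ m) powr p) * total)) * indicator (interior K) k \<partial>lborel)"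
    unfolding cone[OF measurable_max_levels]
  proof (rule nn_integral_mono)
    fix k
    have "(\<integral>\<^sup>+t. ?W t * max_level c (t *\<^sub>R k) * indicator {0<..} t \<partial>lborel)
      \<le> ennreal C * (ennreal ((B ^ m) powr p) * total)" if "k \<in> interior K"
    proof -
      have "norm k \<le> B" using B that interior_subset by blast
      then have "ennreal ((norm k ^ m) powr p) \<le> ennreal ((B ^ m) powr p)"
        using p by (intro ennreal_leI powr_mono2 power_mono) auto
      then show ?thesis
        by (intro order_trans[OF inner] mult_left_mono order_trans[OF F_Lp_bound] mult_right_mono) auto
    qed
    then show "(\<integral>\<^sup>+t. ?W t * max_level c (t *\<^sub>R k) * indicator {0<..} t \<partial>lborel) * indicator (interior K) k
      \<le> ennreal C * (ennreal ((B ^ m) powr p) * total) * indicator (interior K) k"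
      by (cases "k \<in> interior K") auto
  qed
  also have "\<dots> = (ennreal C * (ennreal ((B ^ m) powr p) * total)) * vol (interior K)"
    by (rule nn_integral_cmult_indicator) measurable
  also have "\<dots> < \<infinity>"
  proof -
    have "bounded (interior K)" using bdd interior_subset by (rule bounded_subset)
    then have "vol (interior K) < \<infinity>" by (rule emeasure_bounded_finite)
    then show ?thesis using total_finite by (simp add: ennreal_mult_less_top)
  qed
  finally show ?thesis .
qed

text \<open>
  The alternating sum \<open>R_diff m f\<close> at \<open>x\<close> and \<open>y = x + m h\<close>; see
  \<open>R_diff_eq_diff\<close>.
\<close>

definition diff :: "real ^ 'n \<Rightarrow> real ^ 'n \<Rightarrow> real" where
  "diff h x = (\<Sum>j\<le>m. (- 1) ^ j * real (m choose j) * f (x + real j *\<^sub>R h))"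

lemma measurable_diff_compose [measurable (raw)]:
  assumes [measurable]: "h \<in> borel_measurable M" "u \<in> borel_measurable M"
  shows "(\<lambda>z. diff (h z) (u z)) \<in> borel_measurable M"
proof -
  note loc_int_measurable[OF f, measurable]
  show ?thesis unfolding diff_def by measurable
qed

abbreviation diff_level :: "real \<Rightarrow> real ^ 'n \<Rightarrow> ennreal" where
  "diff_level e k \<equiv> vol {x. \<bar>diff (e *\<^sub>R k) x\<bar> > e ^ m}"

abbreviation seg_avg :: "(real \<Rightarrow> real) \<Rightarrow> real \<Rightarrow> real ^ 'n \<Rightarrow> real ^ 'n \<Rightarrow> real" where
  "seg_avg b e k x \<equiv> \<integral>s. b s * F k (x + s *\<^sub>R (e *\<^sub>R k)) \<partial>lborel"

text \<open>
  The kernel is at most 1 and lives on \<open>{0..m}\<close>, so the average is at most \<open>m\<close> times the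
  mean of \<open>\<bar>F k\<bar>\<close> over the segment from \<open>x\<close> to \<open>x + m e k\<close>.
  The bound does not depend on \<open>e\<close>.
\<close>

lemma average_le_maxf:
  assumes b: "peano_kernel m b" and e: "0 < e"
  shows "ennreal \<bar>seg_avg b e k x\<bar> \<le> ennreal (2 * real m) * maxf (absF k) k x"
proof -
  have [measurable]: "b \<in> borel_measurable borel" using b by (simp add: peano_kernel_def)
  have "ennreal \<bar>seg_avg b e k x\<bar> \<le> (\<integral>\<^sup>+s. ennreal (norm (b s * F k (x + s *\<^sub>R (e *\<^sub>R k)))) \<partial>lborel)"
  proof (cases "integrable lborel (\<lambda>s. b s * F k (x + s *\<^sub>R (e *\<^sub>R k)))")
    case True
    from integral_norm_bound_ennreal[OF this] show ?thesis by simp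
  qed (simp add: not_integrable_integral_eq)
  also have "\<dots> \<le> ray (e *\<^sub>R k) (absF k) (real m) x"
    unfolding ray_def
  proof (rule nn_integral_mono_AE)
    show "AE s in lborel. ennreal (norm (b s * F k (x + s *\<^sub>R (e *\<^sub>R k)))) \<le> absF k (x + s *\<^sub>R e *\<^sub>R k) * indicator {0..<real m} s"
      using AE_lborel_singleton[of "real m"]
    proof eventually_elim
      case (elim s)
      have b01: "0 \<le> b s" "b s \<le> 1" "s \<notin> {0..real m} \<Longrightarrow> b s = 0" using b by (auto simp: peano_kernel_def)
      then have "b s * \<bar>F k (x + s *\<^sub>R (e *\<^sub>R k))\<bar> \<le> 1 * \<bar>F k (x + s *\<^sub>R (e *\<^sub>R k))\<bar>" by (intro mult_right_mono) auto
      then show ?case using b01 elim by (auto simp: indicator_def absF_def abs_mult intro!: ennreal_leI)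
    qed
  qed
  also have "ray (e *\<^sub>R k) (absF k) (real m) x = ennreal (1 / e) * ray k (absF k) (e * real m) x"
    using ray_scale[of "absF k" e k "real m" x] e by (simp add: mult.assoc[symmetric] ennreal_mult[symmetric])
  also have "\<dots> \<le> ennreal (1 / e) * (ennreal (2 * (e * real m)) * maxf (absF k) k x)"
    using e m by (intro mult_left_mono ray_le_maxf) auto
  also have "\<dots> = ennreal (2 * real m) * maxf (absF k) k x"
    using e by (simp add: mult.assoc[symmetric] ennreal_mult[symmetric])
  finally show ?thesis .
qed

text \<open>
  The difference with step \<open>e k\<close> is an average of \<open>F (e k)\<close>, which is
  \<open>e ^ m\<close> times \<open>F k\<close>; the factor cancels against the threshold.
\<close>

lemma diff_levels:
  assumes b: "peano_kernel m b" and e: "0 < e"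
  shows "diff_level e k
    = vol {x. \<bar>seg_avg b e k x\<bar> > 1}"
proof -
  have [measurable]: "b \<in> borel_measurable borel" using b by (simp add: peano_kernel_def)
  have "AE x in lborel. diff (e *\<^sub>R k) x = (- 1) ^ m * (\<integral>s. b s * F (e *\<^sub>R k) (x + s *\<^sub>R (e *\<^sub>R k)) \<partial>lborel)"
    unfolding diff_def F_def using b f g weak by (rule difference_eq_average)
  then show ?thesis
  proof (intro emeasure_eq_AE, elim eventually_mono)
    fix x assume "diff (e *\<^sub>R k) x = (- 1) ^ m * (\<integral>s. b s * F (e *\<^sub>R k) (x + s *\<^sub>R (e *\<^sub>R k)) \<partial>lborel)"
    also have "\<dots> = (- 1) ^ m * e ^ m * seg_avg b e k x"
      by (simp add: F_scale mult.left_commute[of _ "e ^ m"])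
    finally have "\<bar>diff (e *\<^sub>R k) x\<bar> = e ^ m * \<bar>seg_avg b e k x\<bar>"
      using e by (simp add: abs_mult power_abs)
    then show "(x \<in> {x. \<bar>diff (e *\<^sub>R k) x\<bar> > e ^ m}) = (x \<in> {x. \<bar>seg_avg b e k x\<bar> > 1})"
      using e by simp
  qed measurable
qed

text \<open>
  Dominated convergence in \<open>k\<close>. Sequences suffice, so that \<open>diff_levels\<close> is needed only
  for one \<open>e\<close> and one \<open>k\<close> at a time.
\<close>

lemma rescaled_limit:
  assumes e: "\<And>n. 0 < \<epsilon> n" "\<epsilon> \<longlonglongrightarrow> 0"
  shows "(\<lambda>n. \<integral>\<^sup>+k. w k * diff_level (\<epsilon> n) k \<partial>lborel)
    \<longlonglongrightarrow> (\<integral>\<^sup>+k. w k * F_level k \<partial>lborel)"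
proof -
  obtain b where b: "peano_kernel m b" using peano_kernel_exists[OF m] by blast
  have m0: "0 < 2 * real m" using m by simp
  show ?thesis
  proof (rule nn_integral_dominated_convergence[where w = "\<lambda>k. w k * max_level (2 * real m) k"])
    show "(\<lambda>k. w k * diff_level (\<epsilon> n) k) \<in> borel_measurable lborel" for n
      by (intro borel_measurable_times_ennreal lborel.measurable_emeasure) measurable
    show "(\<lambda>k. w k * F_level k) \<in> borel_measurable lborel"
      by (intro borel_measurable_times_ennreal lborel.measurable_emeasure) measurable
    show "(\<lambda>k. w k * max_level (2 * real m) k) \<in> borel_measurable lborel"
      using measurable_max_levels by (intro borel_measurable_times_ennreal) auto
    show "(\<integral>\<^sup>+k. w k * max_level (2 * real m) k \<partial>lborel) < \<infinity>"
      by (rule domination[OF m0])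
    show "AE k in lborel. w k * diff_level (\<epsilon> n) k \<le> w k * max_level (2 * real m) k" for n
    proof (intro always_eventually allI mult_left_mono)
      fix k
      show "diff_level (\<epsilon> n) k \<le> max_level (2 * real m) k"
        unfolding diff_levels[OF b e(1)]
      proof (rule emeasure_mono)
        show "{x. \<bar>seg_avg b (\<epsilon> n) k x\<bar> > 1} \<subseteq> {x. ennreal (2 * real m) * maxf (absF k) k x > 1}"
        proof clarify
          fix x assume "1 < \<bar>seg_avg b (\<epsilon> n) k x\<bar>"
          then have "ennreal 1 < ennreal \<bar>seg_avg b (\<epsilon> n) k x\<bar>" by (simp add: ennreal_less_iff)
          also have "\<dots> \<le> ennreal (2 * real m) * maxf (absF k) k x" by (rule average_le_maxf[OF b e(1)])
          finally show "1 < ennreal (2 * real m) * maxf (absF k) k x" by simp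
        qed
      qed measurable
    qed auto
    show "AE k in lborel. (\<lambda>n. w k * diff_level (\<epsilon> n) k) \<longlonglongrightarrow> w k * F_level k"
      using AE_level_null
    proof eventually_elim
      case (elim k)
      show ?case
      proof (cases "w k = 0")
        case False
        then have null: "vol {x. \<bar>F k x\<bar> = 1} = 0" using elim by simp
        have "w k \<noteq> top" by (simp add: w_def)
        moreover have "(\<lambda>n. diff_level (\<epsilon> n) k) \<longlonglongrightarrow> F_level k"
          unfolding diff_levels[OF b e(1)]
          using level_set_convergence[OF b m _ _ F_Lp null e(2), of k] p by simp
        ultimately show ?thesis by (intro ennreal_tendsto_cmult) (auto simp: less_top)
      qed simp
    qed
  qed
qed

end

section \<open>Reduction of the double integral to the rescaled one\<close>

lemma AE_lborel_affine:
  fixes P :: "'a::euclidean_space \<Rightarrow> bool"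
  assumes c: "c \<noteq> 0" and P: "AE x in lborel. P x"
  shows "AE y in lborel. P (v + c *\<^sub>R y)"
proof -
  obtain N where N: "{x \<in> space lborel. \<not> P x} \<subseteq> N" "vol N = 0" "N \<in> sets lborel"
    using P by (rule AE_E)
  have [measurable]: "N \<in> sets borel" using N(3) by simp
  have "ennreal (\<bar>c\<bar> ^ DIM('a)) * (\<integral>\<^sup>+y. indicator N (v + c *\<^sub>R y) \<partial>lborel) = (\<integral>\<^sup>+y. indicator N (v + y) \<partial>lborel)"
    using c by (subst nn_integral_lborel_scale[of "\<lambda>y. indicator N (v + y)" c]) auto
  also have "\<dots> = (\<integral>\<^sup>+y. indicator N y \<partial>lborel)"
    using nn_integral_lborel_shift[of "indicator N" v] by (simp add: add.commute)
  also have "\<dots> = 0" using N(2) by simp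
  finally have "(\<integral>\<^sup>+y. indicator N (v + c *\<^sub>R y) \<partial>lborel) = 0" using c by simp
  then have "AE y in lborel. indicator N (v + c *\<^sub>R y) = (0::ennreal)"
    by (subst (asm) nn_integral_0_iff_AE) auto
  then show ?thesis
    by eventually_elim (use N(1) in \<open>auto simp: indicator_def split: if_splits\<close>)
qed

text \<open>
  Preimages of null sets under a nonzero linear combination of the two variables are null. This allows
  \<open>f\<close> to be replaced by a Borel function inside \<open>R_diff\<close>.
\<close>

lemma AE_lborel_linear_pair:
  fixes P :: "'a::euclidean_space \<Rightarrow> bool"
  assumes ab: "\<alpha> \<noteq> 0 \<or> \<beta> \<noteq> 0" and P: "AE x in lborel. P x"
  shows "AE z in lborel \<Otimes>\<^sub>M lborel. P (\<alpha> *\<^sub>R fst z + \<beta> *\<^sub>R snd z)"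
proof -
  obtain N where N: "{x \<in> space lborel. \<not> P x} \<subseteq> N" "vol N = 0" "N \<in> sets lborel"
    using P by (rule AE_E)
  have [measurable]: "N \<in> sets borel" using N(3) by simp
  have PN: "AE x in lborel. x \<notin> N" using N by (intro AE_not_in) auto
  have "AE z in lborel \<Otimes>\<^sub>M lborel. \<alpha> *\<^sub>R fst z + \<beta> *\<^sub>R snd z \<notin> N"
  proof (rule lborel_pair.AE_pair_measure)
    show "{z \<in> space (lborel \<Otimes>\<^sub>M lborel). \<alpha> *\<^sub>R fst z + \<beta> *\<^sub>R snd z \<notin> N} \<in> sets (lborel \<Otimes>\<^sub>M lborel)" by measurable
    show "AE x in lborel. AE y in lborel. \<alpha> *\<^sub>R fst (x, y) + \<beta> *\<^sub>R snd (x, y) \<notin> N"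
    proof (cases "\<beta> = 0")
      case True
      then have "AE x in lborel. 0 + \<alpha> *\<^sub>R x \<notin> N" using ab PN by (intro AE_lborel_affine[where P = "\<lambda>x. x \<notin> N"]) auto
      then show ?thesis by (rule eventually_mono) (simp add: True)
    next
      case False
      show ?thesis
        using AE_lborel_affine[where P = "\<lambda>x. x \<notin> N", OF False PN] by simp
    qed
  qed
  then show ?thesis by eventually_elim (use N(1) in auto)
qed

lemma R_diff_AE:
  assumes m: "1 \<le> m" and ae: "AE x in lborel. f x = f' x"
  shows "AE z in lborel \<Otimes>\<^sub>M lborel. R_diff m f (fst z) (snd z) = R_diff m f' (fst z) (snd z)"
proof -
  have "AE z in lborel \<Otimes>\<^sub>M lborel. \<forall>j\<in>{0..m}.
      f ((real (m - j) / real m) *\<^sub>R fst z + (real j / real m) *\<^sub>R snd z) = f' ((real (m - j) / real m) *\<^sub>R fst z + (real j / real m) *\<^sub>R snd z)"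
  proof (rule AE_finite_allI)
    fix j assume "j \<in> {0..m}"
    then have "real (m - j) / real m \<noteq> 0 \<or> real j / real m \<noteq> 0" using m by auto
    then show "AE z in lborel \<Otimes>\<^sub>M lborel.
      f ((real (m - j) / real m) *\<^sub>R fst z + (real j / real m) *\<^sub>R snd z) = f' ((real (m - j) / real m) *\<^sub>R fst z + (real j / real m) *\<^sub>R snd z)"
      using ae by (rule AE_lborel_linear_pair)
  qed simp
  then show ?thesis by eventually_elim (simp add: R_diff_def)
qed

text \<open>
  Weak derivatives depend only on classes modulo null sets.
\<close>

lemma has_weak_partials_AE:
  assumes w: "has_weak_partials f is g"
    and fm: "f \<in> borel_measurable lebesgue" "f' \<in> borel_measurable lebesgue" and f: "AE x in lebesgue. f x = f' x"
    and gm: "g \<in> borel_measurable lebesgue" "g' \<in> borel_measurable lebesgue" and g: "AE x in lebesgue. g x = g' x"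
  shows "has_weak_partials f' is g'"
proof -
  have li: "locally_integrable u'" if "locally_integrable u" and [measurable]: "u \<in> borel_measurable lebesgue" "u' \<in> borel_measurable lebesgue"
    and ae: "AE x in lebesgue. u x = u' x" for u u' :: "real ^ 'a \<Rightarrow> real"
    unfolding locally_integrable_def
  proof (intro allI impI)
    fix C :: "(real ^ 'a) set" assume C: "compact C"
    have [measurable]: "C \<in> sets lebesgue" using C by (intro fmeasurableD lmeasurable_compact)
    have "integrable lebesgue (\<lambda>x. indicator C x *\<^sub>R u x)"
      using that(1) C by (auto simp: locally_integrable_def set_integrable_def)
    then show "u' absolutely_integrable_on C"
      unfolding set_integrable_def
      by (rule integrable_cong_AE_imp) (measurable, use ae in \<open>auto elim!: eventually_mono\<close>)
  qed
  have int: "(\<integral>x. u x * \<psi> x \<partial>lebesgue) = (\<integral>x. u' x * \<psi> x \<partial>lebesgue)"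
    if [measurable]: "u \<in> borel_measurable lebesgue" "u' \<in> borel_measurable lebesgue" and \<psi>: "\<psi> \<in> borel_measurable borel"
    and ae: "AE x in lebesgue. u x = u' x" for u u' \<psi> :: "real ^ 'a \<Rightarrow> real"
  proof -
    have [measurable]: "\<psi> \<in> borel_measurable lebesgue" using \<psi> by (simp add: measurable_completion)
    show ?thesis by (intro integral_cong_AE) (measurable, use ae in \<open>auto elim!: eventually_mono\<close>)
  qed
  have "(\<integral>x. f' x * partials is \<phi> x \<partial>lebesgue) = (- 1) ^ length is * (\<integral>x. g' x * \<phi> x \<partial>lebesgue)"
    if \<phi>: "test_function \<phi>" for \<phi>
  proof -
    have "\<phi> \<in> borel_measurable borel" using test_function_measurable[OF \<phi>, of "[]"] by (simp add: partials_def)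
    then have "(\<integral>x. g x * \<phi> x \<partial>lebesgue) = (\<integral>x. g' x * \<phi> x \<partial>lebesgue)" by (intro int gm g)
    moreover have "(\<integral>x. f x * partials is \<phi> x \<partial>lebesgue) = (\<integral>x. f' x * partials is \<phi> x \<partial>lebesgue)"
      by (intro int fm f test_function_measurable \<phi>)
    moreover have "(\<integral>x. f x * partials is \<phi> x \<partial>lebesgue) = (- 1) ^ length is * (\<integral>x. g x * \<phi> x \<partial>lebesgue)"
      using w \<phi> unfolding has_weak_partials_def by blast
    ultimately show ?thesis by metis
  qed
  moreover have "locally_integrable f'" "locally_integrable g'"
    using w li[OF _ fm f] li[OF _ gm g] by (simp_all add: has_weak_partials_def)
  ultimately show ?thesis by (simp add: has_weak_partials_def)
qed

lemma (in convex_body) norm_minus: "norm_of_ball K (- x) = norm_of_ball K x"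
proof -
  have K: "- y \<in> K \<longleftrightarrow> y \<in> K" for y
    using symm by (metis image_eqI minus_minus)
  have "(- x) /\<^sub>R l \<in> K \<longleftrightarrow> x /\<^sub>R l \<in> K" for l
    using K[of "x /\<^sub>R l"] by simp
  then show ?thesis by (simp add: norm_of_ball_def)
qed

context sobolev_setting
begin

lemma R_diff_eq_diff: "R_diff m f x (x + (real m * e) *\<^sub>R k) = diff (e *\<^sub>R k) x"
  unfolding R_diff_def diff_def atMost_atLeast0
proof (rule sum.cong[OF refl])
  fix j assume j: "j \<in> {0..m}"
  have "(real (m - j) / real m) *\<^sub>R x + (real j / real m) *\<^sub>R (x + (real m * e) *\<^sub>R k)
    = (real (m - j) / real m + real j / real m) *\<^sub>R x + (real j * e) *\<^sub>R k"
    using m by (simp add: scaleR_add_right scaleR_add_left)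
  also have "real (m - j) / real m + real j / real m = 1" using j m by (simp add: field_simps)
  finally show "(- 1) ^ j * real (m choose j) * f ((real (m - j) / real m) *\<^sub>R x + (real j / real m) *\<^sub>R (x + (real m * e) *\<^sub>R k))
    = (- 1) ^ j * real (m choose j) * f (x + real j *\<^sub>R e *\<^sub>R k)" by simp
qed

text \<open>
  For fixed \<open>x\<close> substitute \<open>y = x + m e k\<close>. The Jacobian \<open>(m e) ^ N\<close>
  and the numerator \<open>e powr (m p)\<close> cancel against \<open>(m e) powr a\<close> except for the
  power of \<open>m\<close>.
\<close>

lemma functional_rescaled:
  assumes e: "0 < e"
  shows "(\<integral>\<^sup>+z. ennreal ((e ^ m) powr p / norm_of_ball K (fst z - snd z) powr a) * indicator {z. \<bar>R_diff m f (fst z) (snd z)\<bar> > e ^ m} z \<partial>(lborel \<Otimes>\<^sub>M lborel))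
    = ennreal (1 / real m powr (real m * p)) * (\<integral>\<^sup>+k. w k * diff_level e k \<partial>lborel)"
proof -
  note loc_int_measurable[OF f, measurable]
  define c where "c = real m * e"
  have c: "0 < c" using e m by (simp add: c_def)
  let ?G = "\<lambda>x y. ennreal ((e ^ m) powr p / norm_of_ball K (x - y) powr a) * indicator {z. \<bar>R_diff m f (fst z) (snd z)\<bar> > e ^ m} (x, y)"
  have [measurable]: "(\<lambda>z. R_diff m f (fst z) (snd z)) \<in> borel_measurable (borel \<Otimes>\<^sub>M borel)"
    unfolding R_diff_def by measurable
  have [measurable]: "(\<lambda>z. ?G (fst z) (snd z)) \<in> borel_measurable (borel \<Otimes>\<^sub>M borel)"
    by simp
  have Gx: "?G x \<in> borel_measurable borel" for x by measurable
  have "(\<integral>\<^sup>+z. ennreal ((e ^ m) powr p / norm_of_ball K (fst z - snd z) powr a) * indicator {z. \<bar>R_diff m f (fst z) (snd z)\<bar> > e ^ m} z \<partial>(lborel \<Otimes>\<^sub>M lborel))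
    = (\<integral>\<^sup>+x. \<integral>\<^sup>+y. ?G x y \<partial>lborel \<partial>lborel)"
    by (subst lborel.nn_integral_fst[symmetric]) (simp_all)
  also have "\<dots> = (\<integral>\<^sup>+x. \<integral>\<^sup>+k. ennreal (1 / real m powr (real m * p)) * (w k * indicator {x. \<bar>diff (e *\<^sub>R k) x\<bar> > e ^ m} x) \<partial>lborel \<partial>lborel)"
  proof (rule nn_integral_cong)
    fix x
    have Gs: "(\<lambda>y. ?G x (y + x)) \<in> borel_measurable borel"
      by (rule measurable_compose[OF _ Gx]) measurable
    have Gc: "(\<lambda>k. ?G x (c *\<^sub>R k + x)) \<in> borel_measurable borel"
      by (rule measurable_compose[OF _ Gx]) measurable
    have "(\<integral>\<^sup>+y. ?G x y \<partial>lborel) = (\<integral>\<^sup>+y. ?G x (y + x) \<partial>lborel)"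
      by (rule nn_integral_lborel_shift[symmetric, OF Gx])
    also have "\<dots> = ennreal (\<bar>c\<bar> ^ DIM(real^'n)) * (\<integral>\<^sup>+k. ?G x (c *\<^sub>R k + x) \<partial>lborel)"
      using c by (intro nn_integral_lborel_scale[OF Gs]) simp
    also have "\<dots> = (\<integral>\<^sup>+k. ennreal (\<bar>c\<bar> ^ DIM(real^'n)) * ?G x (c *\<^sub>R k + x) \<partial>lborel)"
      by (rule nn_integral_cmult[symmetric]) (use Gc in simp)
    also have "\<dots> = (\<integral>\<^sup>+k. ennreal (1 / real m powr (real m * p)) * (w k * indicator {x. \<bar>diff (e *\<^sub>R k) x\<bar> > e ^ m} x) \<partial>lborel)"
    proof (rule nn_integral_cong)
      fix k :: "real ^ 'n"
      have R: "R_diff m f x (c *\<^sub>R k + x) = diff (e *\<^sub>R k) x"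
        using R_diff_eq_diff[of x e k] by (simp add: c_def add.commute)
      have N: "norm_of_ball K (x - (c *\<^sub>R k + x)) = c * norm_of_ball K k"
        using norm_minus[of "c *\<^sub>R k"] norm_scale[OF c, of k] by simp
      have const: "c ^ CARD('n) * ((e ^ m) powr p / (c * norm_of_ball K k) powr a) = (1 / real m powr (real m * p)) * (1 / norm_of_ball K k powr a)"
      proof -
        have "(c * norm_of_ball K k) powr a = c powr a * norm_of_ball K k powr a"
          using c norm_nonneg by (simp add: powr_mult)
        moreover have "c powr a = c ^ CARD('n) * (real m powr (real m * p) * (e ^ m) powr p)"
        proof -
          have "c powr a = c ^ CARD('n) * c powr (real m * p)"
            using c by (simp add: a_def powr_add powr_realpow)
          also have "c powr (real m * p) = real m powr (real m * p) * e powr (real m * p)"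
            using e by (simp add: c_def powr_mult)
          also have "e powr (real m * p) = (e ^ m) powr p"
            using e by (simp add: powr_realpow[symmetric] powr_powr)
          finally show ?thesis .
        qed
        moreover have "c ^ CARD('n) \<noteq> 0" "(e ^ m) powr p \<noteq> 0" using c e by auto
        ultimately show ?thesis by simp
      qed
      have "ennreal (\<bar>c\<bar> ^ DIM(real^'n)) * ennreal ((e ^ m) powr p / (c * norm_of_ball K k) powr a) = ennreal (1 / real m powr (real m * p)) * w k"
        using c const by (simp add: w_def ennreal_mult[symmetric])
      then show "ennreal (\<bar>c\<bar> ^ DIM(real^'n)) * ?G x (c *\<^sub>R k + x) = ennreal (1 / real m powr (real m * p)) * (w k * indicator {x. \<bar>diff (e *\<^sub>R k) x\<bar> > e ^ m} x)"
        unfolding N by (simp add: mult.assoc[symmetric] indicator_def R)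
    qed
    finally show "(\<integral>\<^sup>+y. ?G x y \<partial>lborel) = (\<integral>\<^sup>+k. ennreal (1 / real m powr (real m * p)) * (w k * indicator {x. \<bar>diff (e *\<^sub>R k) x\<bar> > e ^ m} x) \<partial>lborel)" .
  qed
  also have "\<dots> = (\<integral>\<^sup>+k. \<integral>\<^sup>+x. ennreal (1 / real m powr (real m * p)) * (w k * indicator {x. \<bar>diff (e *\<^sub>R k) x\<bar> > e ^ m} x) \<partial>lborel \<partial>lborel)"
    by (rule lborel_pair.Fubini') measurable
  also have "\<dots> = (\<integral>\<^sup>+k. ennreal (1 / real m powr (real m * p)) * (w k * diff_level e k) \<partial>lborel)"
    by (simp add: nn_integral_cmult)
  also have "\<dots> = ennreal (1 / real m powr (real m * p)) * (\<integral>\<^sup>+k. w k * diff_level e k \<partial>lborel)"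
    by (rule nn_integral_cmult) (intro borel_measurable_times_ennreal lborel.measurable_emeasure; measurable)
  finally show ?thesis .
qed

end

theorem theorem1p1:
  fixes m :: nat and p :: real and K :: "(real ^ 'n) set" and f :: "real ^ 'n \<Rightarrow> real"
  assumes "1 \<le> m" and "1 < p"
    and "bounded K" and "convex K" and "K = uminus ` K" and "0 \<in> K" and "interior K \<noteq> {}"
    and "f \<in> Sobolev m p"
  shows "((\<lambda>\<delta>. \<integral>\<^sup>+(x, y)\<in>{(x, y). \<bar>R_diff m f x y\<bar> > \<delta>}.
             ennreal (\<delta> powr p / norm_of_ball K (x - y) powr (real CARD('n) + real m * p))
             \<partial>(lebesgue :: ((real ^ 'n) \<times> (real ^ 'n)) measure))
          \<longlongrightarrow> ennreal ((real CARD('n) + real m * p) / (real m powr (real m * p + 1) * p)) *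
              (\<integral>\<^sup>+x. (\<integral>\<^sup>+y\<in>K. ennreal (\<bar>D_pow m f x y\<bar> powr p) \<partial>lebesgue) \<partial>lebesgue))
         (at_right 0)"
proof -
  interpret convex_body K using assms by unfold_locales
  let ?L = "{is :: 'n list. length is = m}"
  have fm: "f \<in> borel_measurable lebesgue" using assms(8) by (simp add: Sobolev_def Lp_def)
  obtain f' where f' [measurable]: "f' \<in> borel_measurable borel" and ff': "AE x in lborel. f x = f' x"
    using completion_ex_borel_measurable_real[OF fm] by auto
  have "\<exists>G. G \<in> borel_measurable borel \<and> has_weak_partials f' is G \<and> (AE x in lborel. weak_partials is f x = G x) \<and>
      Lp_mass p G < \<infinity>" if L: "is \<in> ?L" for "is"
  proof -
    obtain G0 where G0: "G0 \<in> Lp p" "has_weak_partials f is G0"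
    proof -
      have "length is \<le> m" using L by simp
      then have "\<exists>G0\<in>Lp p. has_weak_partials f is G0" using assms(8) unfolding Sobolev_def by blast
      then show thesis using that by blast
    qed
    have G0m: "G0 \<in> borel_measurable lebesgue" using G0(1) by (simp add: Lp_def)
    obtain G where G [measurable]: "G \<in> borel_measurable borel" and GG: "AE x in lborel. G0 x = G x"
      using completion_ex_borel_measurable_real[OF G0m] by auto
    have "has_weak_partials f' is G"
      using G0(2) fm _ _ G0m
      by (rule has_weak_partials_AE) (use ff' GG in \<open>auto simp: AE_completion_iff measurable_completion intro!: AE_completion\<close>)
    moreover have "has_weak_partials f is (weak_partials is f)"
      unfolding weak_partials_def by (rule someI[of "has_weak_partials f is", OF G0(2)])
    then have "AE x in lebesgue. weak_partials is f x = G0 x"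
      using G0(2) by (rule weak_partials_unique)
    then have "AE x in lborel. weak_partials is f x = G0 x" by (simp add: AE_completion_iff)
    then have "AE x in lborel. weak_partials is f x = G x" using GG by eventually_elim simp
    moreover have "Lp_mass p G < \<infinity>"
    proof -
      have "(\<integral>\<^sup>+x. ennreal (norm (\<bar>G0 x\<bar> powr p)) \<partial>lebesgue) < \<infinity>"
        using G0(1) by (simp add: Lp_def integrable_iff_bounded)
      also have "(\<integral>\<^sup>+x. ennreal (norm (\<bar>G0 x\<bar> powr p)) \<partial>lebesgue) = Lp_mass p G"
        unfolding nn_integral_completion using GG by (intro nn_integral_cong_AE, elim eventually_mono) simp
      finally show ?thesis .
    qed
    ultimately show ?thesis using G by blast
  qed
  then have "\<forall>is\<in>?L. \<exists>G. G \<in> borel_measurable borel \<and> has_weak_partials f' is G \<and> (AE x in lborel. weak_partials is f x = G x) \<and>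
      Lp_mass p G < \<infinity>" by (rule ballI)
  from bchoice[OF this] obtain g where g_all: "\<forall>is\<in>?L. g is \<in> borel_measurable borel \<and> has_weak_partials f' is (g is) \<and> (AE x in lborel. weak_partials is f x = g is x) \<and>
      Lp_mass p (g is) < \<infinity>" by (rule exE)
  then have gf: "\<And>is. is \<in> ?L \<Longrightarrow> g is \<in> borel_measurable borel" "\<And>is. is \<in> ?L \<Longrightarrow> has_weak_partials f' is (g is)"
    "\<And>is. is \<in> ?L \<Longrightarrow> AE x in lborel. weak_partials is f x = g is x"
    "\<And>is. is \<in> ?L \<Longrightarrow> Lp_mass p (g is) < \<infinity>"
    by blast+
  \<comment> \<open>Any list of length \<open>m\<close> serves: local integrability of \<open>f\<close> is part of
    \<open>has_weak_partials\<close>.\<close>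
  have "has_weak_partials f' (replicate m undefined) (g (replicate m undefined))" by (rule gf(2)) simp
  then have f'l: "loc_int f'" by (subst loc_int_iff) (auto simp: has_weak_partials_def)
  have gl: "loc_int (g is)" if "is \<in> ?L" for "is"
    using gf(1,2)[OF that] by (subst loc_int_iff) (auto simp: has_weak_partials_def)
  interpret sobolev_setting K m p f' g
    by unfold_locales (use assms f'l gl gf in auto)
  have DF: "AE x in lborel. \<forall>y. D_pow m f x y = F y x"
  proof -
    have "AE x in lborel. \<forall>is\<in>?L. weak_partials is f x = g is x"
      using finite_lists_of_length gf(3) by (intro AE_finite_allI) auto
    then show ?thesis by eventually_elim (simp add: D_pow_def F_def dir_power_def)
  qed
  \<comment> \<open>The limit of the rescaled integral.\<close>
  define J where "J = (\<integral>\<^sup>+k. w k * F_level k \<partial>lborel)"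
  have J: "ennreal (1 / real m powr (real m * p)) * J = ennreal ((real CARD('n) + real m * p) / (real m powr (real m * p + 1) * p)) *
              (\<integral>\<^sup>+x. (\<integral>\<^sup>+y\<in>K. ennreal (\<bar>D_pow m f x y\<bar> powr p) \<partial>lebesgue) \<partial>lebesgue)"
  proof -
    have "(\<integral>\<^sup>+x. (\<integral>\<^sup>+y\<in>K. ennreal (\<bar>D_pow m f x y\<bar> powr p) \<partial>lebesgue) \<partial>lebesgue)
      = (\<integral>\<^sup>+x. (\<integral>\<^sup>+y\<in>interior K. ennreal (\<bar>F y x\<bar> powr p) \<partial>lborel) \<partial>lborel)"
      unfolding nn_integral_completion[of lborel, symmetric, where f = "\<lambda>x. \<integral>\<^sup>+y\<in>interior K. ennreal (\<bar>F y x\<bar> powr p) \<partial>lborel"]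
    proof (rule nn_integral_cong_AE)
      have "AE x in lebesgue. \<forall>y. D_pow m f x y = F y x" using DF by (rule AE_completion)
      then show "AE x in lebesgue. (\<integral>\<^sup>+y\<in>K. ennreal (\<bar>D_pow m f x y\<bar> powr p) \<partial>lebesgue) = (\<integral>\<^sup>+y\<in>interior K. ennreal (\<bar>F y x\<bar> powr p) \<partial>lborel)"
      proof eventually_elim
        case (elim x)
        have "(\<integral>\<^sup>+y\<in>K. ennreal (\<bar>D_pow m f x y\<bar> powr p) \<partial>lebesgue) = (\<integral>\<^sup>+y\<in>interior K. ennreal (\<bar>F y x\<bar> powr p) \<partial>lebesgue)"
          using AE_interior by (intro nn_integral_cong_AE, elim eventually_mono) (simp add: elim indicator_def)
        then show ?case by (simp add: nn_integral_completion)
      qed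
    qed
    moreover have "(1 / real m powr (real m * p)) * (a / (real m * p)) = (real CARD('n) + real m * p) / (real m powr (real m * p + 1) * p)"
      using assms(1,2) by (simp add: a_def powr_add)
    then have "ennreal (1 / real m powr (real m * p)) * ennreal (a / (real m * p)) = ennreal ((real CARD('n) + real m * p) / (real m powr (real m * p + 1) * p))"
      using a_pos assms(1,2) by (simp add: ennreal_mult[symmetric])
    ultimately show ?thesis unfolding J_def limit_value by (simp add: mult.assoc[symmetric])
  qed
  have functional: "(\<integral>\<^sup>+(x, y)\<in>{(x, y). \<bar>R_diff m f x y\<bar> > \<delta>}.
             ennreal (\<delta> powr p / norm_of_ball K (x - y) powr (real CARD('n) + real m * p))
             \<partial>(lebesgue :: ((real ^ 'n) \<times> (real ^ 'n)) measure))
    = ennreal (1 / real m powr (real m * p)) * (\<integral>\<^sup>+k. w k * diff_level (\<delta> powr (1 / real m)) k \<partial>lborel)"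
    if \<delta>: "0 < \<delta>" for \<delta>
  proof -
    define e where "e = \<delta> powr (1 / real m)"
    have e: "0 < e" "e ^ m = \<delta>"
      using \<delta> assms(1) by (simp_all add: e_def powr_realpow[symmetric] powr_powr)
    have "(\<integral>\<^sup>+(x, y)\<in>{(x, y). \<bar>R_diff m f x y\<bar> > \<delta>}.
             ennreal (\<delta> powr p / norm_of_ball K (x - y) powr (real CARD('n) + real m * p))
             \<partial>(lebesgue :: ((real ^ 'n) \<times> (real ^ 'n)) measure))
      = (\<integral>\<^sup>+z. ennreal ((e ^ m) powr p / norm_of_ball K (fst z - snd z) powr a) * indicator {z. \<bar>R_diff m f' (fst z) (snd z)\<bar> > e ^ m} z \<partial>(lborel \<Otimes>\<^sub>M lborel))"
      unfolding nn_integral_completion lborel_prod[symmetric]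
      using R_diff_AE[OF assms(1) ff']
      by (intro nn_integral_cong_AE, elim eventually_mono) (auto simp: e a_def case_prod_beta indicator_def)
    also have "\<dots> = ennreal (1 / real m powr (real m * p)) * (\<integral>\<^sup>+k. w k * diff_level e k \<partial>lborel)"
      by (rule functional_rescaled[OF e(1)])
    finally show ?thesis unfolding e_def .
  qed
  show ?thesis
    unfolding J[symmetric]
  proof (rule tendsto_at_right_sequentially[of 0 1])
    fix S :: "nat \<Rightarrow> real"
    assume S: "\<And>n. 0 < S n" and lim: "S \<longlonglongrightarrow> 0"
    have "(\<lambda>n. S n powr (1 / real m)) \<longlonglongrightarrow> 0"
    proof -
      have "(\<lambda>n. S n powr (1 / real m)) \<longlonglongrightarrow> 0 powr (1 / real m)"
        using S assms(1) by (intro tendsto_powr' lim tendsto_const) (auto intro!: always_eventually less_imp_le)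
      then show ?thesis by simp
    qed
    then have "(\<lambda>n. \<integral>\<^sup>+k. w k * diff_level (S n powr (1 / real m)) k \<partial>lborel) \<longlonglongrightarrow> J"
      unfolding J_def by (intro rescaled_limit) (use S[THEN less_imp_neq] S in \<open>simp_all add: less_le\<close>)
    then show "(\<lambda>n. \<integral>\<^sup>+(x, y)\<in>{(x, y). \<bar>R_diff m f x y\<bar> > S n}.
             ennreal (S n powr p / norm_of_ball K (x - y) powr (real CARD('n) + real m * p))
             \<partial>(lebesgue :: ((real ^ 'n) \<times> (real ^ 'n)) measure)) \<longlonglongrightarrow> ennreal (1 / real m powr (real m * p)) * J"
      unfolding functional[OF S] by (intro ennreal_tendsto_cmult) (auto simp: less_top)
  qed simp
qed

end
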